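(* Let $E_1\subset\{0,1\}^\omega$ be the set of $\xi$ such that the infinite orbital Schreier graph $\Gamma_\xi$ of the Basilica group has one end. For almost every $\xi\in E_1$ (with respect to the uniform measure $\lambda$ on $\{0,1\}^\omega$), $$\lim_{n\to\infty}\mathbb{P}_{\mu_n}\big(Mav_{H_n}(\cdot,\xi_n)=M\big)\sim M^{-1},$$ where $\{H_n\}$ is the exhaustion of $(\Gamma_\xi,\xi)$ with unique dissipative vertex $0^n$ described in the context, and $\sim$ is the criticality relation defined in the context.
   Context: **Basilica group.** $\mathcal{B}$ is the group of automorphisms of the binary rooted tree (vertices = finite words over $\{0,1\}$) generated by $a,b$ defined recursively by $a(0w)=0\,b(w)$, $a(1w)=1w$, $b(0w)=1\,a(w)$, $b(1w)=0w$. It acts on $\{0,1\}^n$ and on $\{0,1\}^\omega$. For $n\ge1$, $\Gamma_n$ is the Schreier graph of the action on $\{0,1\}^n$: vertex set $\{0,1\}^n$, and for each vertex $w$ and each $s\in\{a,b\}$ one (unoriented) edge between $w$ and $s(w)$ (loops and multiple edges allowed). For $\xi\in\{0,1\}^\omega$, $\Gamma_\xi$ is the Schreier graph defined in the same way on the orbit $\mathcal{B}\cdot\xi$; $\xi_n$ is the prefix of length $n$ of $\xi$. The rooted graphs $(\Gamma_n,\xi_n)$ converge to $(\Gamma_\xi,\xi)$ (for each $r$, the balls of radius $r$ around the roots are isomorphic for all large $n$). $\lambda$ is the uniform (Bernoulli) measure on $\{0,1\}^\omega$. **Sandpile model.** Let $H$ be a finite connected graph (loops and multiple edges allowed; a loop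 contributes 2 to the degree) with a nonempty set $P$ of dissipative vertices and $V_0=V(H)\setminus P$. A configuration is a map $\eta:V_0\to\mathbb{N}$; it is stable if $\eta(v)<\deg(v)$ for all $v\in V_0$. Firing a vertex $v\in V_0$ with $\eta(v)\ge\deg(v)$ sends one chip along each edge incident to $v$; chips reaching $P$ disappear. Every configuration reaches a stable one by finitely many firings; the result and the number of times each vertex fires do not depend on the order. Recurrent configurations are the recurrent states of the Markov chain on stable configurations that adds a chip at a random vertex of $V_0$ (every vertex having positive probability) and stabilizes; equivalently, stable $c$ such that there is no nonempty $U\subset V_0$ with $c(v)<\deg_{H[U]}(v)$ for all $v\in U$. $\mathcal{R}_H$ is the set of recurrent configurations. For $c\in\mathcal{R}_H$ and $v\in V_0$, $Mav_H(c,v)$ is the mass of the avalanche, i.e. the number of distinct vertices fired while stabilizing $c+\delta_v$. $\mu_n$ is the uniform distribution on $\mathcal{R}_{H_n}$. **Subgraphs $H_n$.** A block is a maximal 2-connected subgraph (here: a cycle, possibly of length 2 or a loop). The central cycle of $\Gamma_n$ is the unique cycle containing $0^n$ and $0^{n-1}1$. Let $\mathcal{CP}_{\xi_n}$ be the minimal sequence of distinct blocks, consecutive ones intersecting, joining $\xi_n$ to the central cycle (the last block being the central cycle). For $\xi\in E_1$ there are infinitely many $n$ such that the vertex separating the penultimate block from the last block of $\mathcal{CP}_{\xi_n}$ is different from $0^n$; $n$ is taken in this subsequence. $H_n$ is the connected component of $\xi_n$ in $\Gamma_n\setminus\{0^n\}$ together with $0^n$, and $0^n$ is its unique dissipative vertex.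 Up to isomorphism (with $\xi_n$ corresponding to $\xi$), the $H_n$ form an exhaustion of $(\Gamma_\xi,\xi)$. **The relation $\sim$.** $\lim_{n\to\infty}\mathbb{P}_{\mu_n}(Mav_{H_n}(\cdot,\xi_n)=M)\sim M^{-\delta}$ (the sandpile model is critical with critical exponent $\delta>0$) means: there are constants $C_1,C_2>0$ such that for every $\epsilon>0$ there is $M_\epsilon\ge1$ such that for all $M>M_\epsilon$ $$C_1M^{-\delta-\epsilon}\le\lim_{n\to\infty}\mathbb{P}_{\mu_n}(Mav_{H_n}(\cdot,\xi_n)=M)\le C_2M^{-\delta+\epsilon},$$ where only those integers $M$ are considered which can be realized as the mass of an avalanche. *)

theory Defs
  imports
    "HOL-Probability.Probability"
    "HOL-Algebra.Bij"
    "HOL-Algebra.Generated_Groups"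
    "Graph_Theory.Digraph_Component"
begin

section \<open>The Basilica group\<close>

text \<open>
  The letters 0 and 1 are \<^const>\<open>False\<close> and \<^const>\<open>True\<close>; the vertices of the binary rooted tree
  are the finite words, and its boundary is the set of streams.
\<close>

fun bas_a :: "bool list \<Rightarrow> bool list" and bas_b :: "bool list \<Rightarrow> bool list" where
  "bas_a [] = []"
| "bas_a (False # w) = False # bas_b w"
| "bas_a (True # w) = True # w"
| "bas_b [] = []"
| "bas_b (False # w) = True # bas_a w"
| "bas_b (True # w) = False # w"

definition basilica_gens :: "(bool list \<Rightarrow> bool list) set" where
  "basilica_gens = {bas_a, bas_b}"

definition basilica :: "(bool list \<Rightarrow> bool list) set" where
  "basilica = generate (BijGroup UNIV) basilica_gens"

text \<open>
  The action of a tree automorphism on the boundary: the prefix of length \<open>n\<close> of the image of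
  \<open>\<xi>\<close> is the image of the prefix of length \<open>n\<close> of \<open>\<xi>\<close>.
\<close>

definition boundary_act :: "(bool list \<Rightarrow> bool list) \<Rightarrow> bool stream \<Rightarrow> bool stream" where
  "boundary_act g \<xi> = to_stream (\<lambda>n. g (stake (Suc n) \<xi>) ! n)"

definition boundary_orbit :: "bool stream \<Rightarrow> bool stream set" where
  "boundary_orbit \<xi> = (\<lambda>g. boundary_act g \<xi>) ` basilica"

lemma length_bas [simp]: "length (bas_a w) = length w" "length (bas_b w) = length w"
  by (induction w rule: bas_a_bas_b.induct[of "\<lambda>w. length (bas_a w) = length w"
        "\<lambda>w. length (bas_b w) = length w"]) auto

fun bas_a_inv :: "bool list \<Rightarrow> bool list" and bas_b_inv :: "bool list \<Rightarrow> bool list" where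
  "bas_a_inv [] = []"
| "bas_a_inv (False # w) = False # bas_b_inv w"
| "bas_a_inv (True # w) = True # w"
| "bas_b_inv [] = []"
| "bas_b_inv (True # w) = False # bas_a_inv w"
| "bas_b_inv (False # w) = True # w"

lemma bas_inv_left: "bas_a_inv (bas_a w) = w" "bas_b_inv (bas_b w) = w"
  by (induction w rule: bas_a_bas_b.induct[of "\<lambda>w. bas_a_inv (bas_a w) = w"
        "\<lambda>w. bas_b_inv (bas_b w) = w"]) auto

lemma bas_inv_right: "bas_a (bas_a_inv w) = w" "bas_b (bas_b_inv w) = w"
  by (induction w rule: bas_a_inv_bas_b_inv.induct[of "\<lambda>w. bas_a (bas_a_inv w) = w"
        "\<lambda>w. bas_b (bas_b_inv w) = w"]) auto

lemma basilica_gens_carrier: "basilica_gens \<subseteq> carrier (BijGroup UNIV)"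
proof -
  have "bij bas_a" "bij bas_b"
    by (rule o_bij[of bas_a_inv] o_bij[of bas_b_inv]; simp add: fun_eq_iff bas_inv_left bas_inv_right)+
  then show ?thesis
    by (simp add: basilica_gens_def BijGroup_def Bij_def)
qed

lemma snth_boundary_act: "boundary_act g \<xi> !! n = g (stake (Suc n) \<xi>) ! n"
  by (simp add: boundary_act_def to_stream_def del: stake.simps)

lemma boundary_actI:
  assumes "\<And>n. g (stake (Suc n) \<xi>) ! n = \<zeta> !! n"
  shows "boundary_act g \<xi> = \<zeta>"
  unfolding boundary_act_def assms to_stream_def
  by (rule stream_smap_nats[symmetric])

lemma boundary_act_bas:
  "boundary_act bas_a (False ## \<xi>) = False ## boundary_act bas_b \<xi>"
  "boundary_act bas_a (True ## \<xi>) = True ## \<xi>"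
  "boundary_act bas_b (False ## \<xi>) = True ## boundary_act bas_a \<xi>"
  "boundary_act bas_b (True ## \<xi>) = False ## \<xi>"
proof -
  have stake_Stream: "stake (Suc n) (x ## \<eta>) = x # stake n \<eta>" for n and x :: bool and \<eta>
    by simp
  have split: "P n" if "P 0" "\<And>m. P (Suc m)" for P and n :: nat
    using that by (cases n) auto
  show "boundary_act bas_a (False ## \<xi>) = False ## boundary_act bas_b \<xi>"
    by (rule boundary_actI, rule split)
      (simp_all only: stake_Stream snth_boundary_act stake_nth bas_a.simps bas_b.simps
        nth_Cons_0 nth_Cons_Suc snth.simps stream.sel lessI)
  show "boundary_act bas_a (True ## \<xi>) = True ## \<xi>"
    by (rule boundary_actI, rule split)
      (simp_all only: stake_Stream snth_boundary_act stake_nth bas_a.simps bas_b.simps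
        nth_Cons_0 nth_Cons_Suc snth.simps stream.sel lessI)
  show "boundary_act bas_b (False ## \<xi>) = True ## boundary_act bas_a \<xi>"
    by (rule boundary_actI, rule split)
      (simp_all only: stake_Stream snth_boundary_act stake_nth bas_a.simps bas_b.simps
        nth_Cons_0 nth_Cons_Suc snth.simps stream.sel lessI)
  show "boundary_act bas_b (True ## \<xi>) = False ## \<xi>"
    by (rule boundary_actI, rule split)
      (simp_all only: stake_Stream snth_boundary_act stake_nth bas_a.simps bas_b.simps
        nth_Cons_0 nth_Cons_Suc snth.simps stream.sel lessI)
qed


section \<open>Undirected multigraphs\<close>

text \<open>
  An undirected multigraph is represented by a \<^typ>\<open>('a, 'b) pre_digraph\<close> whose arcs are the edges,
  each with an arbitrary orientation. Only orientation-independent notions are used below; in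
  particular a loop contributes 2 to the degree.
\<close>

definition degree :: "('a, 'b) pre_digraph \<Rightarrow> 'a \<Rightarrow> nat" where
  "degree G v = in_degree G v + out_degree G v"

text \<open>The number of chips that \<open>w\<close> receives when \<open>v\<close> sends one chip along each incident edge-end.\<close>

definition edge_mult :: "('a, 'b) pre_digraph \<Rightarrow> 'a \<Rightarrow> 'a \<Rightarrow> nat" where
  "edge_mult G v w = card (out_arcs G v \<inter> in_arcs G w) + card (out_arcs G w \<inter> in_arcs G v)"

definition adjacent :: "('a, 'b) pre_digraph \<Rightarrow> 'a \<Rightarrow> 'a \<Rightarrow> bool" where
  "adjacent G u v \<longleftrightarrow> dominates (with_proj (mk_symmetric G)) u v"

definition joined :: "('a, 'b) pre_digraph \<Rightarrow> 'a \<Rightarrow> 'a \<Rightarrow> bool" where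
  "joined G u v \<longleftrightarrow> reachable (with_proj (mk_symmetric G)) u v"

definition is_cycle :: "('a, 'b) pre_digraph \<Rightarrow> bool" where
  "is_cycle C \<longleftrightarrow> finite (arcs C) \<and> Digraph_Component.connected C \<and> (\<forall>v\<in>verts C. degree C v = 2)"

text \<open>
  2-connectedness is understood in the sense of blocks of multigraphs: the graph is not the union of
  two edge-disjoint connected subgraphs, each having an edge, that meet in a single vertex. With this
  convention a loop is a block of its own.
\<close>

definition two_connected :: "('a, 'b) pre_digraph \<Rightarrow> bool" where
  "two_connected H \<longleftrightarrow> Digraph_Component.connected H \<and>
     \<not> (\<exists>H1 H2 v. subgraph H1 H \<and> subgraph H2 H \<and>
          Digraph_Component.connected H1 \<and> Digraph_Component.connected H2 \<and>
          arcs H1 \<noteq> {} \<and> arcs H2 \<noteq> {} \<and>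
          arcs H1 \<inter> arcs H2 = {} \<and> arcs H1 \<union> arcs H2 = arcs H \<and>
          verts H1 \<inter> verts H2 = {v} \<and> verts H1 \<union> verts H2 = verts H)"

definition is_block :: "('a, 'b) pre_digraph \<Rightarrow> ('a, 'b) pre_digraph \<Rightarrow> bool" where
  "is_block G B \<longleftrightarrow> pre_digraph.max_subgraph G two_connected B"

definition block_chain ::
    "('a, 'b) pre_digraph \<Rightarrow> 'a \<Rightarrow> ('a, 'b) pre_digraph \<Rightarrow> ('a, 'b) pre_digraph list \<Rightarrow> bool" where
  "block_chain G v C Bs \<longleftrightarrow>
     Bs \<noteq> [] \<and> distinct Bs \<and> (\<forall>B\<in>set Bs. is_block G B) \<and>
     (\<forall>i. Suc i < length Bs \<longrightarrow> verts (Bs ! i) \<inter> verts (Bs ! Suc i) \<noteq> {}) \<and>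
     v \<in> verts (hd Bs) \<and> last Bs = C"

definition min_block_chain ::
    "('a, 'b) pre_digraph \<Rightarrow> 'a \<Rightarrow> ('a, 'b) pre_digraph \<Rightarrow> ('a, 'b) pre_digraph list" where
  "min_block_chain G v C = (ARG_MIN length Bs. block_chain G v C Bs)"

text \<open>
  Ends of an infinite graph: classes of rays, two rays being equivalent if for every finite set \<open>F\<close>
  of vertices they have tails in the same connected component of the complement of \<open>F\<close>.
\<close>

definition rays :: "('a, 'b) pre_digraph \<Rightarrow> (nat \<Rightarrow> 'a) set" where
  "rays G = {f. inj f \<and> range f \<subseteq> verts G \<and> (\<forall>i. adjacent G (f i) (f (Suc i)))}"

definition ray_equiv :: "('a, 'b) pre_digraph \<Rightarrow> ((nat \<Rightarrow> 'a) \<times> (nat \<Rightarrow> 'a)) set" where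
  "ray_equiv G = {(f, g). f \<in> rays G \<and> g \<in> rays G \<and>
     (\<forall>F. finite F \<longrightarrow> F \<subseteq> verts G \<longrightarrow>
        (\<exists>k. \<forall>i\<ge>k. \<forall>j\<ge>k. joined (G \<restriction> (verts G - F)) (f i) (g j)))}"

definition ends :: "('a, 'b) pre_digraph \<Rightarrow> (nat \<Rightarrow> 'a) set set" where
  "ends G = rays G // ray_equiv G"


section \<open>Schreier graphs of the Basilica group\<close>

text \<open>One edge for each pair of a point \<open>x\<close> and a generator \<open>s\<close>, joining \<open>x\<close> to its image.\<close>

definition schreier_graph ::
    "('g \<Rightarrow> 'x \<Rightarrow> 'x) \<Rightarrow> 'g set \<Rightarrow> 'x set \<Rightarrow> ('x, 'x \<times> 'g) pre_digraph" where
  "schreier_graph act S X =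
     \<lparr> verts = X, arcs = X \<times> S, tail = fst, head = (\<lambda>(x, s). act s x) \<rparr>"

type_synonym 'x basilica_graph = "('x, 'x \<times> (bool list \<Rightarrow> bool list)) pre_digraph"

definition Gamma_fin :: "nat \<Rightarrow> bool list basilica_graph" where
  "Gamma_fin n = schreier_graph (\<lambda>s. s) basilica_gens {w. length w = n}"

definition Gamma_inf :: "bool stream \<Rightarrow> bool stream basilica_graph" where
  "Gamma_inf \<xi> = schreier_graph boundary_act basilica_gens (boundary_orbit \<xi>)"

definition E1 :: "bool stream set" where
  "E1 = {\<xi>. card (ends (Gamma_inf \<xi>)) = 1}"

definition uniform_boundary :: "bool stream measure" where
  "uniform_boundary = stream_space (measure_pmf (bernoulli_pmf (1/2)))"

abbreviation zeros :: "nat \<Rightarrow> bool list" where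
  "zeros n \<equiv> replicate n False"

definition central_cycle :: "nat \<Rightarrow> bool list basilica_graph" where
  "central_cycle n = (THE C. subgraph C (Gamma_fin n) \<and> is_cycle C \<and>
     zeros n \<in> verts C \<and> zeros (n - 1) @ [True] \<in> verts C)"

definition CP :: "nat \<Rightarrow> bool stream \<Rightarrow> bool list basilica_graph list" where
  "CP n \<xi> = min_block_chain (Gamma_fin n) (stake n \<xi>) (central_cycle n)"

text \<open>
  The vertex \<open>v\<close> separates the penultimate block from the central cycle. Levels at which the prefix of
  \<open>\<xi>\<close> lies on the central cycle itself have no penultimate block and are left out.
\<close>

definition good_levels :: "bool stream \<Rightarrow> nat set" where
  "good_levels \<xi> = {n. 1 \<le> n \<and> 2 \<le> length (CP n \<xi>) \<and>
     (\<exists>v. verts (CP n \<xi> ! (length (CP n \<xi>) - 2)) \<inter> verts (last (CP n \<xi>)) = {v} \<and> v \<noteq> zeros n)}"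

definition H_graph :: "nat \<Rightarrow> bool stream \<Rightarrow> bool list basilica_graph" where
  "H_graph n \<xi> = Gamma_fin n \<restriction>
     ({w. joined (Gamma_fin n \<restriction> (verts (Gamma_fin n) - {zeros n})) (stake n \<xi>) w} \<union> {zeros n})"


section \<open>The sandpile model\<close>

text \<open>
  In what follows \<open>H\<close> is a finite connected multigraph and \<open>P\<close> its set of dissipative vertices.
  Configurations are functions on all of \<^typ>\<open>'a\<close> that vanish outside \<^term>\<open>verts H - P\<close>.
\<close>

definition stable_configs :: "('a, 'b) pre_digraph \<Rightarrow> 'a set \<Rightarrow> ('a \<Rightarrow> nat) set" where
  "stable_configs H P =
     {\<eta>. (\<forall>v\<in>verts H - P. \<eta> v < degree H v) \<and> (\<forall>v. v \<notin> verts H - P \<longrightarrow> \<eta> v = 0)}"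

definition add_chip :: "('a \<Rightarrow> nat) \<Rightarrow> 'a \<Rightarrow> 'a \<Rightarrow> nat" where
  "add_chip \<eta> v = \<eta>(v := Suc (\<eta> v))"

definition fire :: "('a, 'b) pre_digraph \<Rightarrow> 'a set \<Rightarrow> 'a \<Rightarrow> ('a \<Rightarrow> nat) \<Rightarrow> 'a \<Rightarrow> nat" where
  "fire H P v \<eta> = (\<lambda>w. if w \<in> verts H - P
     then \<eta> w - (if w = v then degree H v else 0) + edge_mult H v w else 0)"

inductive firing_seq ::
    "('a, 'b) pre_digraph \<Rightarrow> 'a set \<Rightarrow> ('a \<Rightarrow> nat) \<Rightarrow> 'a list \<Rightarrow> ('a \<Rightarrow> nat) \<Rightarrow> bool"
  for H P where
  "firing_seq H P \<eta> [] \<eta>"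
| "v \<in> verts H - P \<Longrightarrow> degree H v \<le> \<eta> v \<Longrightarrow> firing_seq H P (fire H P v \<eta>) vs \<eta>'
    \<Longrightarrow> firing_seq H P \<eta> (v # vs) \<eta>'"

text \<open>
  The stabilization and the set of fired vertices do not depend on the order of the firings, so the
  following descriptions are well defined.
\<close>

definition stabilization :: "('a, 'b) pre_digraph \<Rightarrow> 'a set \<Rightarrow> ('a \<Rightarrow> nat) \<Rightarrow> 'a \<Rightarrow> nat" where
  "stabilization H P \<eta> = (THE \<eta>'. \<eta>' \<in> stable_configs H P \<and> (\<exists>vs. firing_seq H P \<eta> vs \<eta>'))"

definition avalanche_mass :: "('a, 'b) pre_digraph \<Rightarrow> 'a set \<Rightarrow> ('a \<Rightarrow> nat) \<Rightarrow> 'a \<Rightarrow> nat" where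
  "avalanche_mass H P c v = (THE m. \<exists>vs. \<exists>\<eta>'\<in>stable_configs H P.
     firing_seq H P (add_chip c v) vs \<eta>' \<and> m = card (set vs))"

text \<open>
  \<open>return_prob K x n y\<close> is the probability that the Markov chain with kernel \<open>K\<close> started in \<open>y\<close>
  visits \<open>x\<close> at some time in \<open>{1..n}\<close>.
\<close>

primrec return_prob :: "('s \<Rightarrow> 's pmf) \<Rightarrow> 's \<Rightarrow> nat \<Rightarrow> 's \<Rightarrow> real" where
  "return_prob K x 0 y = 0"
| "return_prob K x (Suc n) y =
     measure_pmf.expectation (K y) (\<lambda>z. if z = x then 1 else return_prob K x n z)"

definition recurrent_state :: "('s \<Rightarrow> 's pmf) \<Rightarrow> 's \<Rightarrow> bool" where
  "recurrent_state K x \<longleftrightarrow> (\<lambda>n. return_prob K x n x) \<longlonglongrightarrow> 1"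

definition sandpile_step ::
    "('a, 'b) pre_digraph \<Rightarrow> 'a set \<Rightarrow> 'a pmf \<Rightarrow> ('a \<Rightarrow> nat) \<Rightarrow> ('a \<Rightarrow> nat) pmf" where
  "sandpile_step H P p c = map_pmf (\<lambda>v. stabilization H P (add_chip c v)) p"

text \<open>
  The chip may be added according to any distribution \<open>p\<close> charging every vertex of
  \<^term>\<open>verts H - P\<close>; the recurrent states do not depend on it.
\<close>

definition recurrent_configs :: "('a, 'b) pre_digraph \<Rightarrow> 'a set \<Rightarrow> ('a \<Rightarrow> nat) set" where
  "recurrent_configs H P = {c \<in> stable_configs H P.
     \<forall>p. set_pmf p = verts H - P \<longrightarrow> recurrent_state (sandpile_step H P p) c}"


section \<open>Criticality\<close>

definition Rec_n :: "bool stream \<Rightarrow> nat \<Rightarrow> (bool list \<Rightarrow> nat) set" where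
  "Rec_n \<xi> n = recurrent_configs (H_graph n \<xi>) {zeros n}"

definition Mav_n :: "bool stream \<Rightarrow> nat \<Rightarrow> (bool list \<Rightarrow> nat) \<Rightarrow> nat" where
  "Mav_n \<xi> n c = avalanche_mass (H_graph n \<xi>) {zeros n} c (stake n \<xi>)"

definition Mav_prob :: "bool stream \<Rightarrow> nat \<Rightarrow> nat \<Rightarrow> real" where
  "Mav_prob \<xi> n M = measure_pmf.prob (pmf_of_set (Rec_n \<xi> n)) {c. Mav_n \<xi> n c = M}"

definition level_filter :: "bool stream \<Rightarrow> nat filter" where
  "level_filter \<xi> = inf sequentially (principal (good_levels \<xi>))"

text \<open>
  A mass counts as realizable if it occurs for infinitely many levels: masses occurring only for
  finitely many levels are boundary effects which are invisible in the limit.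
\<close>

definition realizable_masses :: "bool stream \<Rightarrow> nat set" where
  "realizable_masses \<xi> = {M. \<exists>\<^sub>F n in level_filter \<xi>. \<exists>c\<in>Rec_n \<xi> n. Mav_n \<xi> n c = M}"

definition critical_exponent :: "nat set \<Rightarrow> (nat \<Rightarrow> real) \<Rightarrow> real \<Rightarrow> bool" where
  "critical_exponent R q \<delta> \<longleftrightarrow>
     (\<exists>C1>0. \<exists>C2>0. \<forall>\<epsilon>>0. \<exists>M\<^sub>\<epsilon>\<ge>1. \<forall>M\<in>R. M > M\<^sub>\<epsilon> \<longrightarrow>
        C1 * real M powr (- \<delta> - \<epsilon>) \<le> q M \<and> q M \<le> C2 * real M powr (- \<delta> + \<epsilon>))"

end

theory Submission
  imports Defs
begin

text \<open>
  Every vertex of a Basilica Schreier graph lies on one \<open>a\<close>-cycle and one \<open>b\<close>-cycle, and the graph is a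
  cactus. Rooted at \<open>0\<^sup>n\<close>, a configuration on it is recurrent iff all vertices carry two or three chips
  and every cycle has at most one vertex with two, so a uniform recurrent configuration amounts to
  independent uniform states in \<open>{0..<k}\<close>, one for every cycle of length \<open>k\<close>. If \<open>N\<close> chips arrive at
  position \<open>i\<close> of a cycle in state \<open>z\<close>, then \<open>N + [z = 0] - [z = N i mod k]\<close> chips leave through its root;
  the avalanche thus climbs along the path of cycles from \<open>\<xi>\<^sub>n\<close> to the root as a Markov chain \<open>N\<^sub>j\<close>, which
  is absorbed at \<open>0\<close>.

  Let \<open>s\<^sub>0 < s\<^sub>1 < \<dots>\<close> be the position of the first one of \<open>\<xi>\<close> and then, successively, of the next one of
  the opposite parity. The \<open>j\<close>-th cycle of the path has length about \<open>2 ^ (s\<^bsub>j+1\<^esub> / 2)\<close> and there are about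
  \<open>2 ^ s\<^sub>j\<close> vertices below its entrance. A mass \<open>M\<close> determines the cycle \<open>j\<close> on which the avalanche
  stops, and then at most two states of that cycle and exactly one of the next cycle are possible. So the
  probability of \<open>M\<close> is the inverse product of two consecutive cycle lengths up to a factor, which is
  \<open>M ^ (-1 + o(1))\<close> because \<open>s\<^bsub>j+1\<^esub> / s\<^sub>j\<close> tends to \<open>1\<close> almost surely. The factor is bounded below since
  \<open>N\<^sub>j = 1\<close> for all large \<open>j\<close> with positive probability, unless \<open>\<xi>\<close> ends with ones only.

  Nothing depends on whether the level \<open>n\<close> is good, so the good levels only have to be infinite in
  number; all levels \<open>n\<close> at which \<open>\<xi>\<close> has a one are good, except for finitely many.
\<close>

section \<open>Orbits of the generators on words\<close>

text \<open>No avalanche is ever simulated. A candidate odometer is written down together with a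
  candidate final configuration, and both are recognized as the true ones because recurrent
  configurations are unique modulo the Laplacian; only a Laplacian has to be evaluated. The
  candidate comes from dimension one. Whatever hangs off the path fires exactly as often as the
  vertex it hangs from, so a cycle of the path behaves like a segment with sinks at both ends. On a
  segment with a single non-critical site \<open>z\<close>, a chip dropped at \<open>i\<close> moves
  that site to \<open>z - i\<close> modulo the length; the bracket terms in the number of outgoing
  chips express conservation of chips. The probabilities are eventually constant in
  \<open>n\<close>: a mass that stops on cycle \<open>j\<close> depends on the states of the cycles
  up to \<open>j + 1\<close> only, and the data of these cycles do not change with the level. The
  obstacle for the lower bound is a cycle of length 2, which turns one chip into none or two. The
  single chip is therefore reached by a detour through two chips, which ends on a cycle where
  \<open>2 * i\<close> is not a multiple of the length.\<close>

fun gen :: "bool \<Rightarrow> bool list \<Rightarrow> bool list" where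
  "gen True w = bas_b w"
| "gen False w = bas_a w"

fun genI :: "bool \<Rightarrow> bool list \<Rightarrow> bool list" where
  "genI True w = bas_b_inv w"
| "genI False w = bas_a_inv w"

lemma gen_rec [simp]:
  "gen \<tau> [] = []"
  "gen True (False # w) = True # gen False w" "gen True (True # w) = False # w"
  "gen False (False # w) = False # gen True w" "gen False (True # w) = True # w"
  by (cases \<tau>) simp_all

lemma genI_rec [simp]:
  "genI \<tau> [] = []"
  "genI True (True # w) = False # genI False w" "genI True (False # w) = True # w"
  "genI False (False # w) = False # genI True w" "genI False (True # w) = True # w"
  by (cases \<tau>) simp_all

declare gen.simps [simp del] genI.simps [simp del]

lemma genI_gen [simp]: "genI \<tau> (gen \<tau> w) = w" and gen_genI [simp]: "gen \<tau> (genI \<tau> w) = w"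
  by (cases \<tau>; simp add: gen.simps genI.simps bas_inv_left bas_inv_right)+

lemma length_gen [simp]: "length (gen \<tau> w) = length w"
  by (cases \<tau>) (simp_all add: gen.simps)

lemma length_genI [simp]: "length (genI \<tau> w) = length w"
  by (metis gen_genI length_gen)

section \<open>Coordinates on the cycles of the two generators\<close>

fun base :: "bool \<Rightarrow> bool list \<Rightarrow> bool list" where
  "base \<tau> [] = []"
| "base True (x # w) = False # base False w"
| "base False (False # w) = False # base True w"
| "base False (True # w) = True # w"

text \<open>The square of b acts as a on the tail, so a b-orbit is traversed in binary: the first
  letter is the lowest digit and the a-orbit of the tail supplies the others. An a-orbit is a
  b-orbit behind the letter 0, or a fixed point behind the letter 1.\<close>

fun pos :: "bool \<Rightarrow> bool list \<Rightarrow> nat" where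
  "pos \<tau> [] = 0"
| "pos True (x # w) = of_bool x + 2 * pos False w"
| "pos False (False # w) = pos True w"
| "pos False (True # w) = 0"

fun len :: "bool \<Rightarrow> bool list \<Rightarrow> nat" where
  "len \<tau> [] = 1"
| "len True (x # w) = 2 * len False w"
| "len False (False # w) = len True w"
| "len False (True # w) = 1"

fun mk :: "bool \<Rightarrow> bool list \<Rightarrow> nat \<Rightarrow> bool list" where
  "mk \<tau> [] i = []"
| "mk True (x # w) i = odd i # mk False w (i div 2)"
| "mk False (False # w) i = False # mk True w i"
| "mk False (True # w) i = True # w"

lemma length_base [simp]: "length (base \<tau> w) = length w"
  by (induction \<tau> w rule: base.induct) auto

lemma length_mk [simp]: "length (mk \<tau> w i) = length w"
  by (induction \<tau> w i rule: mk.induct) auto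

lemma len_pos [simp]: "0 < len \<tau> w"
  by (induction \<tau> w rule: len.induct) auto

lemma pos_less_len: "pos \<tau> w < len \<tau> w"
  by (induction \<tau> w rule: pos.induct) (auto simp: of_bool_def)

lemma base_mk [simp]: "base \<tau> (mk \<tau> w i) = base \<tau> w"
  by (induction \<tau> w i rule: mk.induct) auto

lemma base_base [simp]: "base \<tau> (base \<tau> w) = base \<tau> w"
  by (induction \<tau> w rule: base.induct) auto

lemma len_base [simp]: "len \<tau> (base \<tau> w) = len \<tau> w"
  by (induction \<tau> w rule: base.induct) auto

lemma pos_base [simp]: "pos \<tau> (base \<tau> w) = 0"
  by (induction \<tau> w rule: base.induct) auto

lemma mk_base [simp]: "mk \<tau> (base \<tau> w) i = mk \<tau> w i"
  by (induction \<tau> w i rule: mk.induct) auto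

lemma mk_pos [simp]: "mk \<tau> w (pos \<tau> w) = w"
  by (induction \<tau> w rule: pos.induct) auto

lemma mk_0 [simp]: "mk \<tau> w 0 = base \<tau> w"
  by (induction \<tau> w "0 :: nat" rule: mk.induct) auto

lemma pos_mk [simp]: "pos \<tau> (mk \<tau> w i) = i mod len \<tau> w"
proof (induction \<tau> w i rule: mk.induct)
  case (2 x w i)
  have "i mod (2 * m) = of_bool (odd i) + 2 * ((i div 2) mod m)" for m
    by (simp add: mod_mult2_eq mod2_eq_if)
  with 2 show ?case by simp
qed auto

text \<open>Fixes the orientation used throughout: the generators walk down to the base of their
  cycle, the inverses walk away from it.\<close>

lemma gen_mk [simp]: "gen \<tau> (mk \<tau> w (Suc i)) = mk \<tau> w i"
proof (induction \<tau> w i rule: mk.induct)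
  case (2 x w i)
  show ?case
  proof (cases "odd i")
    case True
    then obtain m where "i = 2 * m + 1" by (auto elim: oddE)
    then show ?thesis using 2 by simp
  qed (auto elim: evenE)
qed auto

lemma genI_mk [simp]: "genI \<tau> (mk \<tau> w i) = mk \<tau> w (Suc i)"
  by (metis gen_mk genI_gen)

lemma mk_mod: "mk \<tau> w (i mod len \<tau> w) = mk \<tau> w i"
proof -
  have "mk \<tau> (mk \<tau> w i) (pos \<tau> (mk \<tau> w i)) = mk \<tau> w i" by (rule mk_pos)
  then show ?thesis by (metis base_mk mk_base pos_mk)
qed

lemma mk_len [simp]: "mk \<tau> w (len \<tau> w) = base \<tau> w"
  using mk_mod[of \<tau> w "len \<tau> w"] by simp

lemma base_gen [simp]: "base \<tau> (gen \<tau> w) = base \<tau> w"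
  by (metis base_mk gen_genI gen_mk genI_gen genI_mk mk_pos)

lemma base_genI [simp]: "base \<tau> (genI \<tau> w) = base \<tau> w"
  by (metis base_gen gen_genI)

section \<open>Parent cycles and the path to the zero word\<close>

abbreviation nz :: "bool list \<Rightarrow> bool" where "nz w \<equiv> True \<in> set w"

lemma not_nz_iff: "\<not> nz w \<longleftrightarrow> w = zeros (length w)"
  by (induction w) auto

lemma nz_iff: "length w = n \<Longrightarrow> nz w \<longleftrightarrow> w \<noteq> zeros n"
  using not_nz_iff by auto

text \<open>The parity of the index of the first one. For a nonzero word it is the type of its
  parent cycle, the only one of its two cycles of which it is not the base; the cycle of the other
  type hangs below it.\<close>

fun par :: "bool list \<Rightarrow> bool" where
  "par [] = False"
| "par (True # w) = True"
| "par (False # w) = (\<not> par w)"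

text \<open>The parity of the index of the last one. For a nonzero word it is the type of the cycle
  at the zero word through which its path arrives, and so it labels the components that remain when
  the zero word is deleted.\<close>

fun lt :: "bool list \<Rightarrow> bool" where
  "lt [] = False"
| "lt (x # w) = (if nz w then \<not> lt w else True)"

fun fo :: "bool list \<Rightarrow> nat" where
  "fo [] = 0"
| "fo (True # w) = 1"
| "fo (False # w) = Suc (fo w)"

text \<open>The letters as binary digits, lowest first. It serves as a rank: every step towards the
  root lowers it.\<close>

fun val :: "bool list \<Rightarrow> nat" where
  "val [] = 0"
| "val (x # w) = of_bool x + 2 * val w"


lemma base_zero: "\<not> nz w \<Longrightarrow> base \<tau> w = w"
  by (induction \<tau> w rule: base.induct) auto

lemma base_zeros [simp]: "base \<tau> (zeros n) = zeros n"
  by (rule base_zero) simp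

lemma base_nonzero_iff: "nz w \<Longrightarrow> base \<tau> w = w \<longleftrightarrow> \<tau> = (\<not> par w)"
proof (induction \<tau> w rule: base.induct)
  case (2 x w)
  then show ?case by (cases x) auto
qed auto

lemma base_eq_par_iff: "base (par w) w = w \<longleftrightarrow> \<not> nz w"
  using base_nonzero_iff[of w "par w"] base_zero[of w "par w"] by auto

lemma base_not_par: "nz w \<Longrightarrow> base (\<not> par w) w = w"
  by (simp add: base_nonzero_iff)

lemma pos_eq_0_iff: "pos \<tau> w = 0 \<longleftrightarrow> base \<tau> w = w"
  by (metis mk_0 mk_pos pos_base)

lemma val_base_le: "val (base \<tau> w) \<le> val w"
  by (induction \<tau> w rule: base.induct) auto

lemma val_inj: "length v = length w \<Longrightarrow> val v = val w \<Longrightarrow> v = w"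
proof (induction v w rule: list_induct2)
  case (Cons x xs y ys)
  have "of_bool x + 2 * val xs = (of_bool y + 2 * val ys :: nat)" using Cons.prems by simp
  then have "x = y \<and> val xs = val ys" by (cases x; cases y) (simp_all, presburger+)
  then show ?case using Cons.IH by simp
qed simp

lemma val_base_less: "base \<tau> w \<noteq> w \<Longrightarrow> val (base \<tau> w) < val w"
  using val_base_le[of \<tau> w] val_inj[of "base \<tau> w" w] by fastforce

lemma val_gen_less: "nz w \<Longrightarrow> val (gen (par w) w) < val w"
proof (induction w rule: par.induct)
  case (2 w)
  then show ?case by simp
next
  case (3 w)
  then have "val (gen (par w) w) < val w" by simp
  then show ?case by (cases "par w") auto
qed auto

lemma nz_baseD [dest]: "nz (base \<tau> w) \<Longrightarrow> nz w"
  by (metis base_zero)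

text \<open>Passing to the base erases the letters up to the first one read in type
  \<open>False\<close> and keeps the rest, so the last one survives unless everything is erased. In
  that case every one, the last included, was read in type \<open>True\<close>, which fixes its
  parity.\<close>

lemma lt_base: "nz (base \<tau> w) \<Longrightarrow> lt (base \<tau> w) = lt w"
  and lt_base_zero: "nz w \<Longrightarrow> \<not> nz (base \<tau> w) \<Longrightarrow> lt w = \<tau>"
  by (induction \<tau> w rule: base.induct) (auto split: if_splits)

lemma par_eq_fo: "nz w \<Longrightarrow> par w = odd (fo w)"
  by (induction w rule: par.induct) auto

lemma fo_pos: "nz w \<Longrightarrow> 0 < fo w"
  by (induction w rule: par.induct) auto

text \<open>\<^term>\<open>desc x y\<close>: the path from \<open>y\<close> to the root of the cactus passes through \<open>x\<close>.\<close>

fun desc :: "bool list \<Rightarrow> bool list \<Rightarrow> bool" where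
  "desc (True # x) y = (y = True # x)"
| "desc (False # x) (c # y) = (desc x y \<and> (y \<noteq> x \<or> \<not> c \<or> par x))"
| "desc _ _ = False"

lemma desc_self: "nz x \<Longrightarrow> desc x x"
  by (induction x rule: par.induct) auto

lemma desc_val: "desc x y \<Longrightarrow> val x \<le> val y"
  by (induction x y rule: desc.induct) auto

lemma desc_nz: "desc x y \<Longrightarrow> nz x \<and> nz y"
  by (induction x y rule: desc.induct) auto

lemma desc_length: "desc x y \<Longrightarrow> length y = length x"
  by (induction x y rule: desc.induct) auto

text \<open>Links the letterwise recursion of \<open>desc\<close> with the geometry: climbing one
  parent link neither enters nor leaves the set of descendants of \<open>x\<close>, except at
  \<open>x\<close> itself.\<close>

lemma desc_base_iff:
  "nz y \<Longrightarrow> y \<noteq> x \<Longrightarrow> desc x (base (par y) y) \<longleftrightarrow> desc x y"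
proof (induction x y rule: desc.induct)
  case (1 x y)
  then show ?case by (cases y rule: par.cases) (auto, (cases "par (tl y)"; auto)+)
next
  case (2 x c y)
  show ?case
  proof (cases "nz y")
    case False
    then show ?thesis using 2 desc_nz[of x y] by (cases c) (auto simp: base_zero)
  next
    case nzy: True
    show ?thesis
    proof (cases c)
      case True
      have "desc x (base False y) \<longleftrightarrow> desc x y \<and> (y \<noteq> x \<or> par x)"
      proof (cases "par y")
        case True
        then have "base False y = y" using base_not_par[OF nzy] by simp
        then show ?thesis using True by auto
      next
        case p: False
        show ?thesis
        proof (cases "y = x")
          case True
          have "\<not> desc x (base False x)"
            using desc_val[of x "base False x"] val_base_less[of False x] p True nzy
              base_eq_par_iff[of x] by (auto simp: not_less)
          then show ?thesis using True p by simp
        next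
          case False
          then show ?thesis using 2(1) nzy p by simp
        qed
      qed
      then show ?thesis using True by simp
    next
      case False
      then show ?thesis using 2 nzy by (cases "par y") auto
    qed
  qed
qed auto

text \<open>For positive \<open>t\<close> this is 2^t / 3 rounded up. A zero in front of a word
  doubles its descendants; only the copy of the word itself that starts with a one may be missing,
  depending on the parity of the first one.\<close>

fun dsz :: "nat \<Rightarrow> nat" where
  "dsz 0 = 0"
| "dsz (Suc 0) = 1"
| "dsz (Suc (Suc t)) = 2 * (dsz (Suc t) - 1) + (if even t then 2 else 1)"

lemma three_dsz: "3 * dsz (Suc t) = 2 ^ Suc t + (if even t then 1 else 2)"
proof (induction t)
  case (Suc t)
  have "dsz (Suc t) \<ge> 1" using Suc by (cases "dsz (Suc t)") auto
  then have "3 * dsz (Suc (Suc t)) + 6 = 2 * (3 * dsz (Suc t)) + 3 * (if even t then 2 else 1)"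
    by (simp add: diff_mult_distrib2)
  then show ?case unfolding Suc by auto
qed simp

lemma card_desc: "nz x \<Longrightarrow> card {y. desc x y} = dsz (fo x)"
proof (induction x rule: par.induct)
  case (3 x)
  then have nz: "nz x" by simp
  have fin: "finite {y. desc x y}"
    by (rule finite_subset[OF _ finite_lists_length_eq[of UNIV "length x"]]) (auto dest: desc_length)
  have eq: "{y. desc (False # x) y} =
      (\<lambda>y. False # y) ` {y. desc x y} \<union> (\<lambda>y. True # y) ` ({y. desc x y} - (if par x then {} else {x}))"
  proof (rule Set.set_eqI)
    fix z show "z \<in> {y. desc (False # x) y} \<longleftrightarrow> z \<in> (\<lambda>y. False # y) ` {y. desc x y} \<union>
        (\<lambda>y. True # y) ` ({y. desc x y} - (if par x then {} else {x}))"
      by (cases z) (auto simp: image_iff)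
  qed
  have "card {y. desc (False # x) y} = card {y. desc x y} + card ({y. desc x y} - (if par x then {} else {x}))"
    unfolding eq by (subst card_Un_disjoint) (auto simp: fin card_image)
  also have "\<dots> = 2 * (dsz (fo x) - 1) + (if par x then 2 else 1)"
  proof -
    have "card {y. desc x y} > 0" using desc_self[OF nz] fin by (auto simp: card_gt_0_iff)
    then show ?thesis using desc_self[OF nz] fin 3 nz by (auto simp: card_Diff_singleton)
  qed
  also have "\<dots> = dsz (Suc (fo x))"
    using fo_pos[OF nz] par_eq_fo[OF nz] by (cases "fo x") auto
  finally show ?case by simp
next
  case (2 x)
  have "{y. desc (True # x) y} = {True # x}" by auto
  then show ?case by simp
qed auto

section \<open>The abelian sandpile model\<close>

lemma edge_mult_commute: "edge_mult G v w = edge_mult G w v"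
  by (simp add: edge_mult_def)

text \<open>The function in \<open>potential\<close> is strictly superharmonic off the sinks. It
  stands in for the usual path from every vertex to a sink and yields both termination and the
  recurrence of the maximal stable configuration.\<close>

locale sandpile =
  fixes H :: "('a, 'b) pre_digraph" and P :: "'a set"
  assumes finite_verts: "finite (verts H)"
    and degree_bound: "v \<in> verts H - P \<Longrightarrow> (\<Sum>u\<in>verts H - P. edge_mult H v u) \<le> degree H v"
    and potential: "\<exists>g :: 'a \<Rightarrow> nat. \<forall>v\<in>verts H - P.
      (\<Sum>u\<in>verts H - P. edge_mult H v u * g u) < degree H v * g v"
begin

abbreviation V where "V \<equiv> verts H - P"

lemma finite_V: "finite V"
  using finite_verts by simp

section \<open>Odometers, termination and the abelian property\<close>

definition lap :: "('a \<Rightarrow> int) \<Rightarrow> 'a \<Rightarrow> int" where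
  "lap x w = int (degree H w) * x w - (\<Sum>u\<in>V. int (edge_mult H w u) * x u)"

lemma lap_add: "lap (\<lambda>w. x w + y w) w = lap x w + lap y w"
  by (simp add: lap_def algebra_simps sum.distrib)

lemma lap_diff: "lap (\<lambda>w. x w - y w) w = lap x w - lap y w"
  by (simp add: lap_def algebra_simps sum_subtractf)

lemma lap_single:
  assumes "v \<in> V"
  shows "lap (\<lambda>u. of_bool (u = v)) w = of_bool (w = v) * int (degree H v) - int (edge_mult H v w)"
proof -
  have "(\<Sum>u\<in>V. int (edge_mult H w u) * of_bool (u = v)) = int (edge_mult H w v)"
    using assms finite_V by (simp add: of_bool_def if_distrib cong: if_cong)
  then show ?thesis by (auto simp: lap_def edge_mult_commute)
qed

lemma lap_cong: "w \<in> V \<Longrightarrow> (\<And>u. u \<in> V \<Longrightarrow> x u = y u) \<Longrightarrow> lap x w = lap y w"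
  unfolding lap_def by (auto intro!: sum.cong)

lemma fire_eq:
  assumes "v \<in> V" "degree H v \<le> \<eta> v" "w \<in> V"
  shows "int (fire H P v \<eta> w) = int (\<eta> w) - lap (\<lambda>u. of_bool (u = v)) w"
  using assms by (simp add: lap_single fire_def of_nat_diff)

lemma fire_outside: "w \<notin> V \<Longrightarrow> fire H P v \<eta> w = 0"
  by (auto simp: fire_def)

lemma firing_seq_lap:
  "firing_seq H P \<eta> vs \<zeta> \<Longrightarrow> w \<in> V \<Longrightarrow>
    int (\<zeta> w) = int (\<eta> w) - lap (\<lambda>u. int (count_list vs u)) w"
proof (induction rule: firing_seq.induct)
  case (1 \<eta>)
  then show ?case by (simp add: lap_def)
next
  case (2 v \<eta> vs \<zeta>)
  have "lap (\<lambda>u. int (count_list (v # vs) u)) w =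
      lap (\<lambda>u. of_bool (u = v) + int (count_list vs u)) w"
    by (rule lap_cong) (use 2 in auto)
  with 2 show ?case by (simp add: lap_add fire_eq)
qed

lemma firing_seq_set: "firing_seq H P \<eta> vs \<zeta> \<Longrightarrow> set vs \<subseteq> V"
  by (induction rule: firing_seq.induct) auto

lemma firing_seq_outside:
  "firing_seq H P \<eta> vs \<zeta> \<Longrightarrow> (\<And>w. w \<notin> V \<Longrightarrow> \<eta> w = 0) \<Longrightarrow> w \<notin> V \<Longrightarrow> \<zeta> w = 0"
  by (induction rule: firing_seq.induct) (auto simp: fire_outside)

text \<open>The least action principle. If \<open>x\<close> did not fire the first vertex
  \<open>v\<close> of the sequence, the firings of \<open>x\<close> could only add chips to
  \<open>v\<close>, which would stay unstable; hence one firing of \<open>v\<close> can be removed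
  from \<open>x\<close> and the induction continues.\<close>

lemma firing_seq_count_le:
  "firing_seq H P \<eta> vs \<zeta> \<Longrightarrow> (\<And>v. v \<in> V \<Longrightarrow> 0 \<le> x v) \<Longrightarrow>
    (\<And>w. w \<in> V \<Longrightarrow> int (\<eta> w) - lap x w < int (degree H w)) \<Longrightarrow> u \<in> V \<Longrightarrow>
    int (count_list vs u) \<le> x u"
proof (induction arbitrary: x u rule: firing_seq.induct)
  case (1 \<eta>)
  then show ?case by simp
next
  case (2 v \<eta> vs \<zeta>)
  have "x v \<noteq> 0"
  proof
    assume "x v = 0"
    then have "lap x v \<le> 0" using 2 unfolding lap_def by (auto intro!: sum_nonneg)
    with 2(6)[OF 2(1)] 2(2) show False by linarith
  qed
  define y where "y = (\<lambda>w. x w - of_bool (w = v))"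
  have "int (count_list vs u) \<le> y u"
  proof (rule 2(4))
    show "0 \<le> y w" if "w \<in> V" for w
      using 2(5)[OF that] \<open>x v \<noteq> 0\<close> by (auto simp: y_def)
    show "int (fire H P v \<eta> w) - lap y w < int (degree H w)" if "w \<in> V" for w
      using 2(6)[OF that] 2(1,2) that unfolding y_def lap_diff by (simp add: fire_eq)
  qed fact
  then show ?case by (auto simp: y_def)
qed

lemma sum_g_fire:
  assumes v: "v \<in> V" "degree H v \<le> \<eta> v"
  shows "(\<Sum>w\<in>V. g w * fire H P v \<eta> w) + degree H v * g v =
    (\<Sum>w\<in>V. g w * \<eta> w) + (\<Sum>w\<in>V. edge_mult H v w * g w)"
proof -
  obtain k where k: "\<eta> v = degree H v + k" using v(2) le_Suc_ex by blast
  have "(\<Sum>w\<in>V. g w * fire H P v \<eta> w) + degree H v * g v =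
     (\<Sum>w\<in>V. g w * fire H P v \<eta> w) + (\<Sum>w\<in>V. if w = v then degree H v * g v else 0)"
    using v finite_V by simp
  also have "\<dots> = (\<Sum>w\<in>V. g w * \<eta> w + edge_mult H v w * g w)"
    unfolding sum.distrib[symmetric]
    by (rule sum.cong) (use v k in \<open>auto simp: fire_def algebra_simps\<close>)
  finally show ?thesis by (simp add: sum.distrib)
qed

text \<open>By superharmonicity every firing lowers the number of chips weighted by
  \<open>g\<close>.\<close>

lemma stabilization_exists:
  "\<exists>vs \<zeta>. firing_seq H P \<eta> vs \<zeta> \<and> (\<forall>w\<in>V. \<zeta> w < degree H w)"
proof -
  obtain g :: "'a \<Rightarrow> nat" where g: "\<And>v. v \<in> V \<Longrightarrow>
      (\<Sum>u\<in>V. edge_mult H v u * g u) < degree H v * g v"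
    using potential by blast
  show ?thesis
  proof (induction "\<Sum>w\<in>V. g w * \<eta> w" arbitrary: \<eta> rule: less_induct)
    case less
    show ?case
    proof (cases "\<forall>w\<in>V. \<eta> w < degree H w")
      case True
      then show ?thesis by (blast intro: firing_seq.intros)
    next
      case False
      then obtain v where v: "v \<in> V" "degree H v \<le> \<eta> v" by force
      then have "(\<Sum>w\<in>V. g w * fire H P v \<eta> w) < (\<Sum>w\<in>V. g w * \<eta> w)"
        using sum_g_fire[of v \<eta> g] g[of v] by simp
      from less[OF this] v show ?thesis by (blast intro: firing_seq.intros)
    qed
  qed
qed

section \<open>Absence of forbidden subconfigurations\<close>

definition allowed :: "('a \<Rightarrow> nat) \<Rightarrow> bool" where
  "allowed \<eta> \<longleftrightarrow> (\<forall>W. W \<noteq> {} \<longrightarrow> W \<subseteq> V \<longrightarrow> (\<exists>w\<in>W. (\<Sum>u\<in>W. edge_mult H w u) \<le> \<eta> w))"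

lemma allowedD:
  assumes "allowed \<eta>" "W \<noteq> {}" "W \<subseteq> V"
  obtains w where "w \<in> W" "(\<Sum>u\<in>W. edge_mult H w u) \<le> \<eta> w"
  using assms unfolding allowed_def by metis

definition Rec :: "('a \<Rightarrow> nat) set" where
  "Rec = {c \<in> stable_configs H P. allowed c}"

lemma allowed_mono: "allowed \<eta> \<Longrightarrow> (\<And>w. w \<in> V \<Longrightarrow> \<eta> w \<le> \<zeta> w) \<Longrightarrow> allowed \<zeta>"
  unfolding allowed_def by (meson order_trans subsetD)

text \<open>The set is tested without \<open>v\<close> before the firing: the vertex found there
  receives from \<open>v\<close> exactly the chips that its edges to \<open>v\<close> demand. For
  the singleton of \<open>v\<close> the chips returned along loops suffice.\<close>

lemma allowed_fire:
  assumes "allowed \<eta>" "v \<in> V" "degree H v \<le> \<eta> v"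
  shows "allowed (fire H P v \<eta>)"
  unfolding allowed_def
proof (intro allI impI)
  fix W assume W: "W \<noteq> {}" "W \<subseteq> V"
  have fin: "finite W" using W finite_V by (rule_tac finite_subset)
  show "\<exists>w\<in>W. (\<Sum>u\<in>W. edge_mult H w u) \<le> fire H P v \<eta> w"
  proof (cases "W = {v}")
    case True
    then show ?thesis using assms by (simp add: fire_def)
  next
    case False
    then have "W - {v} \<noteq> {}" "W - {v} \<subseteq> V" using W by auto
    then obtain w where w: "w \<in> W - {v}" "(\<Sum>u\<in>W - {v}. edge_mult H w u) \<le> \<eta> w"
      using allowedD[OF assms(1)] by metis
    have "(\<Sum>u\<in>W. edge_mult H w u) \<le> (\<Sum>u\<in>W - {v}. edge_mult H w u) + edge_mult H v w"
      using sum.remove[OF fin, of v "edge_mult H w"] edge_mult_commute[of H w v]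
      by (cases "v \<in> W") auto
    also have "\<dots> \<le> fire H P v \<eta> w" using w W by (auto simp: fire_def)
    finally show ?thesis using w by blast
  qed
qed

lemma allowed_firing_seq: "firing_seq H P \<eta> vs \<zeta> \<Longrightarrow> allowed \<eta> \<Longrightarrow> allowed \<zeta>"
  by (induction rule: firing_seq.induct) (auto intro: allowed_fire)

text \<open>A maximum principle. If the maximum \<open>M\<close> of \<open>x\<close> were positive,
  the set where it is attained would contain a vertex at which \<open>c'\<close> has as many chips
  as edges into the set; adding the Laplacian there makes \<open>c\<close> unstable.\<close>

lemma allowed_diff_le:
  assumes "allowed c'" and c: "\<And>w. w \<in> V \<Longrightarrow> c w < degree H w"
    and eq: "\<And>w. w \<in> V \<Longrightarrow> int (c w) = int (c' w) + lap x w" and "v \<in> V"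
  shows "x v \<le> 0"
proof (rule ccontr)
  assume "\<not> x v \<le> 0"
  define M where "M = Max (x ` V)"
  have M: "x w \<le> M" if "w \<in> V" for w using that finite_V by (auto simp: M_def)
  have "M \<ge> 1" using M[OF \<open>v \<in> V\<close>] \<open>\<not> x v \<le> 0\<close> by simp
  define W where "W = {w \<in> V. x w = M}"
  have "M \<in> x ` V" unfolding M_def using finite_V \<open>v \<in> V\<close> by (intro Max_in) auto
  then have "W \<noteq> {}" "W \<subseteq> V" by (auto simp: W_def)
  then obtain w where w: "w \<in> W" "(\<Sum>u\<in>W. edge_mult H w u) \<le> c' w"
    using allowedD[OF assms(1)] by metis
  have wV: "w \<in> V" "x w = M" using w by (auto simp: W_def)
  define S T where "S = (\<Sum>u\<in>W. int (edge_mult H w u))" and "T = (\<Sum>u\<in>V - W. int (edge_mult H w u))"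
  have "(\<Sum>u\<in>V. int (edge_mult H w u) * x u) =
      (\<Sum>u\<in>V - W. int (edge_mult H w u) * x u) + (\<Sum>u\<in>W. int (edge_mult H w u) * x u)"
    using \<open>W \<subseteq> V\<close> finite_V by (rule sum.subset_diff)
  also have "(\<Sum>u\<in>W. int (edge_mult H w u) * x u) = S * M"
    unfolding S_def sum_distrib_right by (rule sum.cong) (auto simp: W_def)
  \<comment> \<open>Integrality enters here: off the maximum set the value drops by at least
    1.\<close>
  also have "(\<Sum>u\<in>V - W. int (edge_mult H w u) * x u) \<le> (\<Sum>u\<in>V - W. int (edge_mult H w u) * (M - 1))"
  proof (rule sum_mono)
    fix u assume "u \<in> V - W"
    then have "x u \<le> M - 1" using M[of u] by (auto simp: W_def)
    then show "int (edge_mult H w u) * x u \<le> int (edge_mult H w u) * (M - 1)"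
      by (intro mult_left_mono) auto
  qed
  also have "\<dots> = T * (M - 1)" by (simp add: T_def sum_distrib_right)
  finally have le: "(\<Sum>u\<in>V. int (edge_mult H w u) * x u) \<le> T * (M - 1) + S * M" by simp
  have ST: "S + T \<le> int (degree H w)"
  proof -
    have "S + T = int (\<Sum>u\<in>V. edge_mult H w u)"
      unfolding S_def T_def using sum.subset_diff[OF \<open>W \<subseteq> V\<close> finite_V, of "\<lambda>u. int (edge_mult H w u)"]
      by simp
    then show ?thesis using degree_bound[OF wV(1)] by (metis of_nat_le_iff)
  qed
  have "int (degree H w) - S \<le> int (degree H w) * M - (T * (M - 1) + S * M)"
  proof -
    have "0 \<le> (int (degree H w) - S - T) * (M - 1)" using ST \<open>M \<ge> 1\<close> by simp
    then show ?thesis by (simp add: algebra_simps)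
  qed
  then have "int (degree H w) - S \<le> lap x w" using le wV by (simp add: lap_def)
  moreover have "S \<le> int (c' w)" using w(2) unfolding S_def by (metis of_nat_le_iff of_nat_sum)
  ultimately have "int (degree H w) \<le> int (c w)" using eq[OF wV(1)] by linarith
  then show False using c[OF wV(1)] by simp
qed

text \<open>The maximum principle applied to \<open>x\<close> and to its negative.\<close>

lemma Rec_unique:
  assumes "c \<in> Rec" "c' \<in> Rec" "\<And>w. w \<in> V \<Longrightarrow> int (c w) = int (c' w) + lap x w"
  shows "(\<forall>v\<in>V. x v = 0) \<and> c = c'"
proof -
  have lt: "c w < degree H w" "c' w < degree H w" if "w \<in> V" for w
    using assms that by (auto simp: Rec_def stable_configs_def)
  have al: "allowed c" "allowed c'" using assms by (auto simp: Rec_def)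
  have "x v \<le> 0" if "v \<in> V" for v
    by (rule allowed_diff_le[OF al(2) lt(1) assms(3) that]) auto
  moreover have "- x v \<le> 0" if "v \<in> V" for v
  proof (rule allowed_diff_le[OF al(1) lt(2) _ that])
    have "lap (\<lambda>v. - x v) w = - lap x w" for w by (simp add: lap_def sum_negf)
    then show "int (c' w) = int (c w) + lap (\<lambda>v. - x v) w" if "w \<in> V" for w
      using assms(3)[OF that] by simp
  qed auto
  ultimately have x: "\<forall>v\<in>V. x v = 0" by force
  have "lap x w = 0" if "w \<in> V" for w using x that by (simp add: lap_def)
  then have "c w = c' w" for w
    using assms by (cases "w \<in> V") (auto simp: Rec_def stable_configs_def)
  with x show ?thesis by auto
qed

text \<open>Each of the two sequences is a stabilizing odometer for the other, so the least action
  principle compares the counts in both directions.\<close>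

lemma firing_seq_unique:
  assumes "firing_seq H P \<eta> vs \<zeta>" "\<zeta> \<in> stable_configs H P"
    and "firing_seq H P \<eta> vs' \<zeta>'" "\<zeta>' \<in> stable_configs H P"
  shows "set vs = set vs'" "\<zeta> = \<zeta>'"
proof -
  have lt: "\<zeta> w < degree H w" "\<zeta>' w < degree H w" if "w \<in> V" for w
    using assms that by (auto simp: stable_configs_def)
  have "count_list vs u \<le> count_list vs' u" if "u \<in> V" for u
    using firing_seq_count_le[OF assms(1), of "\<lambda>u. int (count_list vs' u)" u] that
      firing_seq_lap[OF assms(3)] lt by fastforce
  moreover have "count_list vs' u \<le> count_list vs u" if "u \<in> V" for u
    using firing_seq_count_le[OF assms(3), of "\<lambda>u. int (count_list vs u)" u] that
      firing_seq_lap[OF assms(1)] lt by fastforce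
  ultimately have eq: "count_list vs u = count_list vs' u" if "u \<in> V" for u
    using that by (simp add: le_antisym)
  then show "set vs = set vs'"
    using firing_seq_set[OF assms(1)] firing_seq_set[OF assms(3)]
    by (metis count_list_0_iff subset_antisym subsetD subsetI)
  have "\<zeta> w = \<zeta>' w" if "w \<in> V" for w
    using firing_seq_lap[OF assms(1) that] firing_seq_lap[OF assms(3) that]
      lap_cong[OF that, of "\<lambda>u. int (count_list vs u)" "\<lambda>u. int (count_list vs' u)"] eq by simp
  moreover have "\<zeta> w = \<zeta>' w" if "w \<notin> V" for w
    using assms that by (auto simp: stable_configs_def)
  ultimately show "\<zeta> = \<zeta>'" by blast
qed

definition st :: "'a \<Rightarrow> ('a \<Rightarrow> nat) \<Rightarrow> 'a \<Rightarrow> nat" where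
  "st v c = stabilization H P (add_chip c v)"

lemma stabilization_eq:
  assumes "firing_seq H P \<eta> vs \<zeta>" "\<zeta> \<in> stable_configs H P"
  shows "stabilization H P \<eta> = \<zeta>"
  unfolding stabilization_def
  by (rule the_equality) (use assms firing_seq_unique(2) in blast)+

lemma Rec_outside: "c \<in> Rec \<Longrightarrow> w \<notin> V \<Longrightarrow> c w = 0"
  by (auto simp: Rec_def stable_configs_def)

lemma st_Rec:
  assumes "c \<in> Rec" "v \<in> V"
  obtains vs where "firing_seq H P (add_chip c v) vs (st v c)" "st v c \<in> Rec"
    "\<And>w. w \<in> V \<Longrightarrow> int (st v c w) = int (c w) + of_bool (w = v) - lap (\<lambda>u. int (count_list vs u)) w"
proof -
  obtain vs \<zeta> where *: "firing_seq H P (add_chip c v) vs \<zeta>" "\<forall>w\<in>V. \<zeta> w < degree H w"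
    using stabilization_exists by blast
  have "\<zeta> w = 0" if "w \<notin> V" for w
    by (rule firing_seq_outside[OF *(1) _ that])
      (use assms Rec_outside in \<open>auto simp: add_chip_def\<close>)
  with * have "\<zeta> \<in> stable_configs H P" by (auto simp: stable_configs_def)
  moreover have "allowed (add_chip c v)"
    using assms(1) by (rule_tac allowed_mono[of c]) (auto simp: add_chip_def Rec_def)
  then have "allowed \<zeta>" by (rule allowed_firing_seq[OF *(1)])
  moreover have "st v c = \<zeta>" unfolding st_def by (rule stabilization_eq) fact+
  ultimately show ?thesis
    using * by (intro that[of vs]) (auto simp: Rec_def firing_seq_lap add_chip_def)
qed

lemma st_in_Rec: "c \<in> Rec \<Longrightarrow> v \<in> V \<Longrightarrow> st v c \<in> Rec"
  by (rule st_Rec)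

lemma st_inj:
  assumes "v \<in> V" shows "inj_on (st v) Rec"
proof (rule inj_onI)
  fix c c' assume c: "c \<in> Rec" "c' \<in> Rec" "st v c = st v c'"
  obtain vs where vs: "w \<in> V \<Longrightarrow> int (st v c w) = int (c w) + of_bool (w = v) - lap (\<lambda>u. int (count_list vs u)) w" for w
    using st_Rec[OF c(1) assms] by metis
  obtain vs' where vs': "w \<in> V \<Longrightarrow> int (st v c' w) = int (c' w) + of_bool (w = v) - lap (\<lambda>u. int (count_list vs' u)) w" for w
    using st_Rec[OF c(2) assms] by metis
  have "int (c w) = int (c' w) + lap (\<lambda>u. int (count_list vs u) - int (count_list vs' u)) w" if "w \<in> V" for w
    using vs[OF that] vs'[OF that] c(3) by (simp add: lap_diff)
  then show "c = c'" using Rec_unique[OF c(1,2)] by blast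
qed

text \<open>The true stabilization is recurrent and differs from \<open>c'\<close> by the Laplacian
  of the difference of the two odometers, so that difference vanishes. Any guessed pair
  \<open>c'\<close>, \<open>x\<close> can be verified in this way.\<close>

lemma avalanche_mass_eq:
  assumes "c \<in> Rec" "v \<in> V" "c' \<in> Rec"
    and x: "\<And>w. w \<in> V \<Longrightarrow> int (c' w) = int (c w) + of_bool (w = v) - lap x w"
  shows "avalanche_mass H P c v = card {w \<in> V. 0 < x w}"
proof -
  obtain vs where vs: "firing_seq H P (add_chip c v) vs (st v c)" "st v c \<in> Rec"
    "\<And>w. w \<in> V \<Longrightarrow> int (st v c w) = int (c w) + of_bool (w = v) - lap (\<lambda>u. int (count_list vs u)) w"
    using st_Rec[OF assms(1,2)] by metis
  have "int (c' w) = int (st v c w) + lap (\<lambda>u. int (count_list vs u) - x u) w" if "w \<in> V" for w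
    using vs(3)[OF that] x[OF that] by (simp add: lap_diff)
  from Rec_unique[OF assms(3) vs(2) this] have "x u = int (count_list vs u)" if "u \<in> V" for u
    using that by simp
  then have "u \<in> set vs \<longleftrightarrow> 0 < x u" if "u \<in> V" for u
    using that count_list_0_iff[of vs u] by (cases "count_list vs u") auto
  then have set: "set vs = {w \<in> V. 0 < x w}"
    using firing_seq_set[OF vs(1)] by auto
  have stable: "st v c \<in> stable_configs H P" using vs(2) by (simp add: Rec_def)
  show ?thesis unfolding avalanche_mass_def
    by (rule the_equality) (use vs(1) stable set firing_seq_unique(1) in \<open>metis+\<close>)
qed

section \<open>Accessibility under the addition of chips\<close>

definition cmax :: "'a \<Rightarrow> nat" where
  "cmax v = (if v \<in> V then degree H v - 1 else 0)"

text \<open>At a vertex of \<open>W\<close> where \<open>g\<close> is smallest, superharmonicity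
  keeps the number of edges into \<open>W\<close> strictly below the degree.\<close>

lemma cmax_allowed: "allowed cmax"
  unfolding allowed_def
proof (intro allI impI)
  fix W assume W: "W \<noteq> {}" "W \<subseteq> V"
  obtain g :: "'a \<Rightarrow> nat" where g: "\<And>v. v \<in> V \<Longrightarrow>
      (\<Sum>u\<in>V. edge_mult H v u * g u) < degree H v * g v"
    using potential by blast
  have fin: "finite W" using W finite_V by (rule_tac finite_subset)
  obtain w where w: "w \<in> W" "\<And>u. u \<in> W \<Longrightarrow> g w \<le> g u"
    using ex_min_if_finite[of "g ` W"] fin W by (metis arg_min_least arg_min_if_finite(1))
  have "(\<Sum>u\<in>W. edge_mult H w u) * g w = (\<Sum>u\<in>W. edge_mult H w u * g w)"
    by (rule sum_distrib_right)
  also have "\<dots> \<le> (\<Sum>u\<in>W. edge_mult H w u * g u)"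
    using w by (intro sum_mono mult_left_mono) auto
  also have "\<dots> \<le> (\<Sum>u\<in>V. edge_mult H w u * g u)"
    using W finite_V by (intro sum_mono2) auto
  also have "\<dots> < degree H w * g w" using g w W by auto
  finally have "(\<Sum>u\<in>W. edge_mult H w u) < degree H w" by simp
  then show "\<exists>w\<in>W. (\<Sum>u\<in>W. edge_mult H w u) \<le> cmax w"
    using w W by (intro bexI[of _ w]) (auto simp: cmax_def)
qed

lemma degree_pos: "v \<in> V \<Longrightarrow> 0 < degree H v"
  using potential by (metis mult_is_0 not_gr_zero not_less_zero)

lemma cmax_Rec: "cmax \<in> Rec"
  using cmax_allowed degree_pos by (auto simp: Rec_def stable_configs_def cmax_def)

lemma finite_Rec: "finite Rec"
proof -
  have "finite {f. f ` V \<subseteq> {..<Suc (\<Sum>v\<in>V. degree H v)} \<and> (\<forall>x. x \<notin> V \<longrightarrow> f x = (0 :: nat))}"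
    using finite_set_of_finite_funs[OF finite_V, of "{..<Suc (\<Sum>v\<in>V. degree H v)}" 0]
    by (auto elim!: rev_finite_subset)
  moreover have "c v < Suc (\<Sum>v\<in>V. degree H v)" if "c \<in> Rec" "v \<in> V" for c v
  proof -
    have "c v < degree H v" "degree H v \<le> (\<Sum>v\<in>V. degree H v)"
      using finite_V that by (auto simp: Rec_def stable_configs_def intro!: member_le_sum)
    then show ?thesis by simp
  qed
  then have "Rec \<subseteq> {f. f ` V \<subseteq> {..<Suc (\<Sum>v\<in>V. degree H v)} \<and> (\<forall>x. x \<notin> V \<longrightarrow> f x = 0)}"
    using Rec_outside by blast
  ultimately show ?thesis by (rule rev_finite_subset)
qed

abbreviation reach :: "('a \<Rightarrow> nat) \<Rightarrow> ('a \<Rightarrow> nat) \<Rightarrow> bool" where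
  "reach \<equiv> (\<lambda>c d. \<exists>v\<in>V. d = st v c)\<^sup>*\<^sup>*"

lemma reach_step: "v \<in> V \<Longrightarrow> reach (st v c) d \<Longrightarrow> reach c d"
  by (rule converse_rtranclp_into_rtranclp[of "\<lambda>c d. \<exists>v\<in>V. d = st v c" c "st v c" d]) auto

lemma st_stable:
  assumes "add_chip c v \<in> stable_configs H P" shows "st v c = add_chip c v"
  unfolding st_def using assms by (intro stabilization_eq[of _ "[]"] firing_seq.intros)

lemma reach_cmax: "c \<in> stable_configs H P \<Longrightarrow> reach c cmax"
proof (induction "\<Sum>v\<in>V. cmax v - c v" arbitrary: c rule: less_induct)
  case less
  show ?case
  proof (cases "c = cmax")
    case False
    then obtain v where "c v \<noteq> cmax v" by blast
    then have "v \<in> V"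
      using less.prems by (cases "v \<in> V") (auto simp: stable_configs_def cmax_def)
    then have "c v < degree H v" using less.prems by (auto simp: stable_configs_def)
    with \<open>v \<in> V\<close> \<open>c v \<noteq> cmax v\<close> have v: "v \<in> V" "c v < cmax v"
      by (auto simp: cmax_def)
    have stable: "add_chip c v \<in> stable_configs H P"
      using less.prems v by (auto simp: stable_configs_def add_chip_def cmax_def)
    have "(\<Sum>u\<in>V. cmax u - add_chip c v u) < (\<Sum>u\<in>V. cmax u - c u)"
      using v finite_V by (intro sum_strict_mono_ex1) (auto simp: add_chip_def intro!: bexI[of _ v])
    from less.hyps[OF this stable] have "reach (add_chip c v) cmax" .
    then show ?thesis using reach_step[OF v(1)] st_stable[OF stable] by simp
  qed simp
qed

lemma reach_Rec: "reach c d \<Longrightarrow> c \<in> Rec \<Longrightarrow> d \<in> Rec"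
  by (induction rule: rtranclp_induct) (auto intro: st_in_Rec)

lemma reach_funpow: "v \<in> V \<Longrightarrow> reach c ((st v ^^ n) c)"
  by (induction n) (auto intro: rtranclp.rtrancl_into_rtrancl)

text \<open>Each \<^term>\<open>st v\<close> permutes the finite set of recurrent configurations, so its inverse is one of
  its powers.\<close>

lemma reach_back:
  assumes "c \<in> Rec" "v \<in> V" shows "reach (st v c) c"
proof -
  have in_Rec: "(st v ^^ n) c \<in> Rec" for n
    using assms by (induction n) (auto intro: st_in_Rec)
  have "finite (range (\<lambda>n. (st v ^^ n) c))"
    by (rule finite_subset[OF _ finite_Rec]) (use in_Rec in auto)
  then have "\<not> inj_on (\<lambda>n. (st v ^^ n) c) UNIV"
    using finite_imageD infinite_UNIV_nat by blast
  then obtain i j where ij: "i < j" "(st v ^^ i) c = (st v ^^ j) c"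
    unfolding inj_on_def by (metis linorder_neqE_nat)
  have eq: "(st v ^^ i) ((st v ^^ (j - i)) c) = (st v ^^ i) c"
    using ij funpow_add[of i "j - i" "st v"] by simp
  have inj: "(st v ^^ i) d = (st v ^^ i) d' \<Longrightarrow> d \<in> Rec \<Longrightarrow> d' \<in> Rec \<Longrightarrow> d = d'" for i d d'
  proof (induction i)
    case (Suc i)
    have "(st v ^^ i) d \<in> Rec" "(st v ^^ i) d' \<in> Rec"
      using reach_Rec[OF reach_funpow[OF assms(2)]] Suc.prems by auto
    then show ?case using Suc st_inj[OF assms(2)] by (auto simp: inj_on_def)
  qed simp
  have "(st v ^^ (j - i)) c = c"
    by (rule inj[OF eq in_Rec assms(1)])
  moreover obtain k where "j - i = Suc k" using ij by (metis Suc_diff_Suc)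
  ultimately have "(st v ^^ k) (st v c) = c"
    by (simp add: funpow_swap1)
  then show ?thesis using reach_funpow[OF assms(2), of "st v c" k] by simp
qed

lemma reach_sym: "reach c d \<Longrightarrow> c \<in> Rec \<Longrightarrow> reach d c"
proof (induction rule: rtranclp_induct)
  case (step d e)
  then obtain v where v: "v \<in> V" "e = st v d" by blast
  have "reach e d" unfolding v(2) using reach_back[OF reach_Rec[OF step(1,4)] v(1)] .
  then show ?case using step(3)[OF step(4)] by (rule rtranclp_trans)
qed simp

lemma reach_Rec_Rec: "c \<in> Rec \<Longrightarrow> d \<in> Rec \<Longrightarrow> reach c d"
  using reach_cmax[of c] reach_sym[OF reach_cmax[of d]]
  by (auto simp: Rec_def intro: rtranclp_trans)

section \<open>Return probabilities of the sandpile chain\<close>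

lemma return_prob_Suc:
  assumes "set_pmf p = V"
  shows "return_prob (sandpile_step H P p) x (Suc n) y =
    (\<Sum>v\<in>V. pmf p v * (if st v y = x then 1 else return_prob (sandpile_step H P p) x n (st v y)))"
  unfolding return_prob.simps sandpile_step_def integral_map_pmf st_def
  by (subst integral_measure_pmf_real[of V])
    (use assms finite_V in \<open>auto intro!: sum.cong simp: mult.commute\<close>)

declare return_prob.simps(2) [simp del]

lemma return_prob_bounds:
  assumes "set_pmf p = V"
  shows "0 \<le> return_prob (sandpile_step H P p) x n y" "return_prob (sandpile_step H P p) x n y \<le> 1"
proof -
  have sum1: "(\<Sum>v\<in>V. pmf p v) = 1" using assms finite_V by (intro sum_pmf_eq_1) auto
  have "0 \<le> return_prob (sandpile_step H P p) x n y \<and> return_prob (sandpile_step H P p) x n y \<le> 1"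
  proof (induction n arbitrary: y)
    case (Suc n)
    have "(\<Sum>v\<in>V. pmf p v * (if st v y = x then 1 else return_prob (sandpile_step H P p) x n (st v y)))
        \<le> (\<Sum>v\<in>V. pmf p v)"
      by (rule sum_mono) (auto intro!: mult_left_le simp: Suc)
    then show ?case unfolding return_prob_Suc[OF assms] sum1 by (auto intro!: sum_nonneg simp: Suc)
  qed simp
  then show "0 \<le> return_prob (sandpile_step H P p) x n y" "return_prob (sandpile_step H P p) x n y \<le> 1"
    by auto
qed

lemma return_prob_mono:
  assumes "set_pmf p = V"
  shows "return_prob (sandpile_step H P p) x n y \<le> return_prob (sandpile_step H P p) x (Suc n) y"
proof (induction n arbitrary: y)
  case 0
  then show ?case using return_prob_bounds(1)[OF assms, of x "Suc 0" y] by simp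
next
  case (Suc n)
  show ?case
    unfolding return_prob_Suc[OF assms, of x "Suc n" y] return_prob_Suc[OF assms, of x n y]
    by (rule sum_mono) (auto intro!: mult_left_mono Suc)
qed

text \<open>The return probabilities increase with the time horizon and are bounded, so they
  converge; the limit inherits the one-step equation.\<close>

lemma return_prob_limit:
  assumes "set_pmf p = V"
  shows "\<exists>r. (\<forall>y. (\<lambda>n. return_prob (sandpile_step H P p) x n y) \<longlonglongrightarrow> r y) \<and>
    (\<forall>y. r y = (\<Sum>v\<in>V. pmf p v * (if st v y = x then 1 else r (st v y)))) \<and> (\<forall>y. r y \<le> 1)"
proof -
  let ?r = "return_prob (sandpile_step H P p) x"
  have "\<exists>l. (\<lambda>n. ?r n y) \<longlonglongrightarrow> l" for y
    using incseq_convergent[of "\<lambda>n. ?r n y" 1] return_prob_bounds(2)[OF assms]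
      return_prob_mono[OF assms] by (metis incseq_SucI)
  then obtain r where r: "\<And>y. (\<lambda>n. ?r n y) \<longlonglongrightarrow> r y" by metis
  show ?thesis
  proof (rule exI[of _ r], intro conjI allI)
    fix y
    show "(\<lambda>n. ?r n y) \<longlonglongrightarrow> r y" by (rule r)
    have "(\<lambda>n. if st v y = x then 1 else ?r n (st v y)) \<longlonglongrightarrow> (if st v y = x then 1 else r (st v y))" for v
      using r by auto
    then have "(\<lambda>n. ?r (Suc n) y) \<longlonglongrightarrow> (\<Sum>v\<in>V. pmf p v * (if st v y = x then 1 else r (st v y)))"
      unfolding return_prob_Suc[OF assms] by (intro tendsto_sum tendsto_mult tendsto_const)
    with LIMSEQ_Suc[OF r] show "r y = (\<Sum>v\<in>V. pmf p v * (if st v y = x then 1 else r (st v y)))"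
      by (rule LIMSEQ_unique)
    show "r y \<le> 1" by (rule LIMSEQ_le_const2[OF r]) (use return_prob_bounds(2)[OF assms] in auto)
  qed
qed

text \<open>An average that attains the upper bound of its terms; every weight is positive because
  the support of \<open>p\<close> is all of \<open>V\<close>.\<close>

lemma weighted_sum_eq_bound:
  assumes p: "set_pmf p = V" and le: "\<And>v. v \<in> V \<Longrightarrow> h v \<le> (m :: real)"
    and eq: "(\<Sum>v\<in>V. pmf p v * h v) = m" and v: "v \<in> V"
  shows "h v = m"
proof -
  have sum1: "(\<Sum>v\<in>V. pmf p v) = 1" using p finite_V by (intro sum_pmf_eq_1) auto
  have "(\<Sum>v\<in>V. pmf p v * (m - h v)) = 0"
    using eq sum1 by (simp add: right_diff_distrib sum_subtractf flip: sum_distrib_right)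
  moreover have "0 \<le> pmf p v * (m - h v)" if "v \<in> V" for v
    using le[OF that] by simp
  ultimately have "pmf p v * (m - h v) = 0"
    using v finite_V sum_nonneg_eq_0_iff[of V "\<lambda>v. pmf p v * (m - h v)"] by auto
  moreover have "v \<in> set_pmf p" using p v by simp
  then have "pmf p v \<noteq> 0" by (simp add: set_pmf_iff)
  ultimately show ?thesis by simp
qed

text \<open>The limit \<open>r\<close> is minimized over the finite set \<open>Rec\<close>. A
  minimum below 1 would, by averaging, spread to all successors while \<open>c\<close> is never hit,
  contradicting that \<open>c\<close> can be reached.\<close>

lemma Rec_recurrent:
  assumes c: "c \<in> Rec" and p: "set_pmf p = V"
  shows "recurrent_state (sandpile_step H P p) c"
proof -
  obtain r where *: "\<forall>y. (\<lambda>n. return_prob (sandpile_step H P p) c n y) \<longlonglongrightarrow> r y"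
    "\<forall>y. r y = (\<Sum>v\<in>V. pmf p v * (if st v y = c then 1 else r (st v y)))" "\<forall>y. r y \<le> 1"
    using return_prob_limit[OF p, of c] by (elim exE conjE) (rule that)
  note r = *[rule_format]
  obtain y where y: "y \<in> Rec" "\<And>z. z \<in> Rec \<Longrightarrow> r y \<le> r z"
    using arg_min_if_finite(1)[OF finite_Rec, of r] arg_min_least[OF finite_Rec, of _ r] c by blast
  have "r y = 1"
  proof (rule ccontr)
    assume "r y \<noteq> 1"
    then have less: "r y < 1" using r(3)[of y] by simp
    have return: "st v z \<noteq> c \<and> r (st v z) = r y" if z: "z \<in> Rec" "r z = r y" "v \<in> V" for z v
    proof -
      have le: "r y \<le> (if st u z = c then 1 else r (st u z))" if "u \<in> V" for u
        using y(2)[OF st_in_Rec[OF z(1) that]] less by auto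
      \<comment> \<open>The sign turns the minimum into the maximum which the averaging lemma
        treats.\<close>
      have "(\<Sum>u\<in>V. pmf p u * - (if st u z = c then 1 else r (st u z))) = - r y"
        using r(2)[of z] z(2) by (simp only: mult_minus_right sum_negf)
      from weighted_sum_eq_bound[OF p _ this z(3)] le
      have "- (if st v z = c then 1 else r (st v z)) = - r y" by (simp only: neg_le_iff_le)
      then show ?thesis using less by (auto split: if_splits)
    qed
    obtain v where v: "v \<in> V" using set_pmf_not_empty[of p] p by blast
    have "reach (st v y) c" using reach_Rec_Rec st_in_Rec[OF y(1) v] c by blast
    \<comment> \<open>Induction along a path to \<open>c\<close>. At its end the premise that the
      state differs from \<open>c\<close> is contradictory, which is why the conclusion may contain
      \<open>False\<close>.\<close>
    then have "st v y \<in> Rec \<Longrightarrow> r (st v y) = r y \<Longrightarrow> st v y \<noteq> c \<Longrightarrow> r c = r y \<and> c \<in> Rec \<and> False"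
    proof (induction rule: converse_rtranclp_induct)
      case (step a b)
      then obtain u where u: "u \<in> V" "b = st u a" by blast
      then show ?case using return[OF step(4,5) u(1)] st_in_Rec[OF step(4) u(1)] step(3) by simp
    qed simp
    then show False using return[OF y(1) refl v] st_in_Rec[OF y(1) v] by blast
  qed
  then have "r c = 1" using y(2)[OF c] r(3)[of c] by simp
  then show ?thesis using r(1)[of c] by (simp add: recurrent_state_def)
qed

text \<open>A sure return spreads to all states reachable from \<open>c\<close>, in particular to
  \<open>cmax\<close>. From there the chain stays inside \<open>Rec\<close> and never meets
  \<open>c\<close>.\<close>

lemma not_Rec_not_recurrent:
  assumes c: "c \<in> stable_configs H P" "c \<notin> Rec" and p: "set_pmf p = V"
  shows "\<not> recurrent_state (sandpile_step H P p) c"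
proof
  assume rec: "recurrent_state (sandpile_step H P p) c"
  obtain r where *: "\<forall>y. (\<lambda>n. return_prob (sandpile_step H P p) c n y) \<longlonglongrightarrow> r y"
    "\<forall>y. r y = (\<Sum>v\<in>V. pmf p v * (if st v y = c then 1 else r (st v y)))" "\<forall>y. r y \<le> 1"
    using return_prob_limit[OF p, of c] by (elim exE conjE) (rule that)
  note r = *[rule_format]
  have zero: "return_prob (sandpile_step H P p) c n y = 0" if "y \<in> Rec" for n y
    using that
  proof (induction n arbitrary: y)
    case (Suc n)
    have "(if st v y = c then 1 else return_prob (sandpile_step H P p) c n (st v y)) = 0" if "v \<in> V" for v
      using st_in_Rec[OF Suc.prems that] Suc.IH c(2) by auto
    then show ?case unfolding return_prob_Suc[OF p] by (intro sum.neutral) auto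
  qed simp
  have "r c = 1" using rec r(1)[of c] LIMSEQ_unique unfolding recurrent_state_def by blast
  have step: "r (st v y) = 1" if "r y = 1" "v \<in> V" for y v
  proof -
    have "(if st v y = c then 1 else r (st v y)) = 1"
      by (rule weighted_sum_eq_bound[OF p _ trans[OF r(2)[of y, symmetric] that(1)] that(2)])
        (use r(3) in auto)
    then show ?thesis using \<open>r c = 1\<close> by (auto split: if_splits)
  qed
  have "reach c cmax" by (rule reach_cmax[OF c(1)])
  then have "r cmax = 1" by (induction rule: rtranclp_induct) (use \<open>r c = 1\<close> step in auto)
  moreover have "r cmax = 0" using r(1)[of cmax] zero[OF cmax_Rec] by (simp add: LIMSEQ_const_iff)
  ultimately show False by simp
qed

theorem recurrent_configs_eq:
  assumes "V \<noteq> {}" shows "recurrent_configs H P = Rec"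
proof -
  \<comment> \<open>A distribution charging exactly \<open>V\<close> must exist, otherwise the
    quantifier over \<open>p\<close> in the definition would be vacuous.\<close>
  have "set_pmf (pmf_of_set V) = V" using assms finite_V by simp
  then show ?thesis
    using Rec_recurrent not_Rec_not_recurrent unfolding recurrent_configs_def Rec_def by blast
qed

end

section \<open>One-dimensional avalanches\<close>

text \<open>A trapezoid of slope 1 over the segment from \<open>l\<close> to \<open>r\<close>, with
  corners at \<open>i\<close> and at its mirror image \<open>l + r - i\<close>: the odometer of one
  chip at \<open>i\<close> if all sites strictly between \<open>l\<close> and \<open>r\<close> are
  critical.\<close>

definition tri :: "int \<Rightarrow> int \<Rightarrow> int \<Rightarrow> int \<Rightarrow> int" where
  "tri l r i x = max 0 (min (min (x - l) (r - x)) (min (i - l) (r - i)))"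

text \<open>The odometer of one chip dropped at position \<open>i\<close> of a path with sinks at \<open>0\<close> and \<open>k\<close> all of whose
  vertices are critical, except the one at \<open>z\<close> (none if \<open>z = 0\<close>).\<close>

definition tent :: "int \<Rightarrow> int \<Rightarrow> int \<Rightarrow> int \<Rightarrow> int" where
  "tent k i z x = (if z < i then tri z k i x else if i < z then tri 0 z i x else 0)"

lemma tent_nonneg: "0 \<le> tent k i z x"
  by (simp add: tent_def tri_def)

text \<open>The chip at \<open>i\<close> is used up, one chip arrives at each end, and the mirror
  image of \<open>i\<close> is left one chip short.\<close>

lemma tri_second_difference:
  assumes "l < i" "i < r"
  shows "tri l r i (x + 1) + tri l r i (x - 1) - 2 * tri l r i x =
    of_bool (x = l) + of_bool (x = r) - of_bool (x = i) - of_bool (x = l + r - i)"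
  using assms unfolding tri_def of_bool_def by (smt (verit))

lemma mod_diff_less: "0 \<le> z \<Longrightarrow> z < k \<Longrightarrow> 0 < i \<Longrightarrow> i < k \<Longrightarrow>
   (z - i) mod k = (if z < i then z + k - i else z - i)" for z i k :: int
  by (smt (verit) mod_pos_pos_trivial mod_add_self2)

text \<open>If \<open>z = i\<close>, the chip fills the gap. Otherwise \<open>z\<close> acts as a
  sink: the segment reaches from \<open>z\<close> to \<open>k\<close> or from \<open>0\<close> to
  \<open>z\<close>, and the mirror image of \<open>i\<close> in it is \<open>z - i\<close> modulo
  \<open>k\<close> in both cases.\<close>

lemma tent_second_difference:
  assumes "0 < i" "i < k" "0 \<le> z" "z < k" "0 < x" "x < k"
  shows "tent k i z (x + 1) + tent k i z (x - 1) - 2 * tent k i z x =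
    of_bool (x = z) - of_bool (x = (z - i) mod k) - of_bool (x = i)"
proof -
  consider "z = i" | "z < i" | "i < z" by linarith
  then show ?thesis
  proof cases
    case 2
    then show ?thesis using tri_second_difference[of z i k x] assms
      by (simp add: tent_def mod_diff_less add.commute)
  next
    case 3
    then show ?thesis using tri_second_difference[of 0 i z x] assms
      by (simp add: tent_def mod_diff_less)
  qed (use assms in \<open>auto simp: tent_def\<close>)
qed

lemma tent_ends:
  assumes "0 < i" "i < k" "0 \<le> z" "z < k"
  shows "tent k i z 0 = 0" "tent k i z k = 0"
  using assms by (auto simp: tent_def tri_def)

text \<open>Conservation of chips: one chip enters, and the cycle gains or loses one more when its
  deficient site disappears or appears.\<close>

lemma tent_flux:
  assumes "0 < i" "i < k" "0 \<le> z" "z < k"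
  shows "tent k i z 1 + tent k i z (k - 1) = 1 + of_bool (z = 0) - of_bool ((z - i) mod k = 0)"
proof -
  have "tent k i z 1 = (if z = i \<or> 0 < z \<and> z < i then 0 else 1)"
    using assms by (auto simp: tent_def tri_def)
  moreover have "tent k i z (k - 1) = (if i \<le> z then 0 else 1)"
    using assms by (auto simp: tent_def tri_def)
  ultimately show ?thesis using assms by (auto simp: mod_diff_less)
qed

lemma tent_pos_iff:
  assumes "0 < i" "i < k" "0 \<le> z" "z < k" "0 \<le> x" "x \<le> k"
  shows "0 < tent k i z x \<longleftrightarrow> (z < i \<and> z < x \<and> x < k) \<or> (i < z \<and> 0 < x \<and> x < z)"
  using assms by (auto simp: tent_def tri_def)

text \<open>Dropping \<open>N\<close> chips one after the other; each of them moves the special position by \<open>-i\<close>.\<close>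

definition profile :: "nat \<Rightarrow> int \<Rightarrow> int \<Rightarrow> int \<Rightarrow> int \<Rightarrow> int" where
  "profile N k i z x = (\<Sum>s<N. tent k i ((z - int s * i) mod k) x)"

lemma profile_nonneg: "0 \<le> profile N k i z x"
  unfolding profile_def by (intro sum_nonneg tent_nonneg)

lemma mod_step: "((z - int s * i) mod k - i) mod k = (z - int (Suc s) * i) mod k" for z i k :: int
  by (simp add: mod_diff_left_eq algebra_simps)

context
  fixes k i z :: int
  assumes ki: "0 < i" "i < k" "0 \<le> z" "z < k"
begin

lemma profile_second_difference:
  assumes "0 < x" "x < k"
  shows "profile N k i z (x + 1) + profile N k i z (x - 1) - 2 * profile N k i z x =
    of_bool (x = z) - of_bool (x = (z - int N * i) mod k) - int N * of_bool (x = i)"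
proof (induction N)
  case 0
  then show ?case using ki by (simp add: profile_def)
next
  case (Suc N)
  have "tent k i ((z - int N * i) mod k) (x + 1) + tent k i ((z - int N * i) mod k) (x - 1)
      - 2 * tent k i ((z - int N * i) mod k) x =
      of_bool (x = (z - int N * i) mod k) - of_bool (x = (z - int (Suc N) * i) mod k) - of_bool (x = i)"
    using tent_second_difference[of i k "(z - int N * i) mod k" x] ki assms mod_step[of z N i k] by simp
  then show ?case using Suc by (simp add: profile_def algebra_simps)
qed

lemma profile_ends: "profile N k i z 0 = 0" "profile N k i z k = 0"
  using ki by (simp_all add: profile_def tent_ends)

lemma profile_flux:
  "profile N k i z 1 + profile N k i z (k - 1) =
    int N + of_bool (z = 0) - of_bool ((z - int N * i) mod k = 0)"
proof (induction N)
  case 0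
  then show ?case using ki by (simp add: profile_def)
next
  case (Suc N)
  have "tent k i ((z - int N * i) mod k) 1 + tent k i ((z - int N * i) mod k) (k - 1) =
      1 + of_bool ((z - int N * i) mod k = 0) - of_bool ((z - int (Suc N) * i) mod k = 0)"
    using tent_flux[of i k "(z - int N * i) mod k"] ki mod_step[of z N i k] by simp
  then show ?case using Suc by (simp add: profile_def algebra_simps)
qed

lemma profile_1_eq_tent: "profile (Suc 0) k i z x = tent k i z x"
  using ki by (simp add: profile_def)

lemma profile_eq_0:
  assumes "0 \<le> x" "x \<le> k" "N = 0 \<or> N = 1 \<and> z = i"
  shows "profile N k i z x = 0"
  using assms ki by (auto simp: profile_def tent_def)

text \<open>Successive special positions differ by \<open>i\<close>, which is nonzero modulo
  \<open>k\<close>, so at most one of the first two equals \<open>i\<close>; a chip that does not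
  find it at \<open>i\<close> fires the site \<open>i\<close>.\<close>

lemma profile_pos:
  assumes "\<not> (N = 0 \<or> N = 1 \<and> z = i)"
  shows "0 < profile N k i z i"
proof -
  obtain s where s: "s < N" "(z - int s * i) mod k \<noteq> i"
  proof (cases "z = i")
    case True
    then show ?thesis using that[of 1] assms ki by auto
  next
    case False
    then show ?thesis using that[of 0] assms ki by auto
  qed
  have "0 < tent k i ((z - int s * i) mod k) i"
    using ki s(2) by (subst tent_pos_iff) auto
  also have "\<dots> \<le> profile N k i z i"
    unfolding profile_def using s(1) by (intro member_le_sum tent_nonneg) auto
  finally show ?thesis .
qed

end

section \<open>Chips handed on along a path of cycles\<close>

text \<open>\<open>chips K I Z j\<close> is the number of chips which the avalanche sends to the \<open>j\<close>-th cut vertex, if the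
  cycles on the way have lengths \<open>K\<close>, are entered at positions \<open>I\<close> and are in states \<open>Z\<close>.\<close>

primrec chips :: "(nat \<Rightarrow> nat) \<Rightarrow> (nat \<Rightarrow> nat) \<Rightarrow> (nat \<Rightarrow> nat) \<Rightarrow> nat \<Rightarrow> nat" where
  "chips K I Z 0 = 1"
| "chips K I Z (Suc j) = chips K I Z j + of_bool (Z j = 0) - of_bool (Z j = chips K I Z j * I j mod K j)"

lemma chips_cong:
  "(\<And>l. l < j \<Longrightarrow> K l = K' l \<and> I l = I' l \<and> Z l = Z' l) \<Longrightarrow> chips K I Z j = chips K' I' Z' j"
  by (induction j) auto

text \<open>The subtraction of naturals in \<open>chips\<close> never truncates: with no chips
  arriving, both brackets test whether the state is 0 and cancel.\<close>

lemma int_chips_Suc: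
  "int (chips K I Z (Suc j)) =
    int (chips K I Z j) + of_bool (Z j = 0) - of_bool (Z j = chips K I Z j * I j mod K j)"
  by (cases "chips K I Z j") (auto simp: of_bool_def)

lemma chips_Suc_eq_0_iff:
  assumes "0 < I j" "I j < K j"
  shows "chips K I Z (Suc j) = 0 \<longleftrightarrow> chips K I Z j = 0 \<or> chips K I Z j = 1 \<and> Z j = I j"
  using assms by (cases "chips K I Z j") auto

lemma mod_eq_0_iff_eq_mod:
  assumes "z < k" shows "(int z - int N * int i) mod int k = 0 \<longleftrightarrow> z = N * i mod k"
proof -
  have "(int z - int N * int i) mod int k = 0 \<longleftrightarrow> int z mod int k = int (N * i) mod int k"
    by (simp add: mod_eq_dvd_iff mod_0_imp_dvd dvd_eq_mod_eq_0)
  also have "\<dots> \<longleftrightarrow> z = N * i mod k"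
    using assms by (simp flip: of_nat_mod of_nat_mult)
  finally show ?thesis .
qed

section \<open>Sandpiles on a rooted cactus\<close>

lemma sum_count_list:
  "finite A \<Longrightarrow> (\<Sum>u\<in>A. of_nat (count_list xs u) * f u) =
    sum_list (map (\<lambda>u. if u \<in> A then f u else (0 :: 'c :: comm_semiring_1)) xs)"
proof (induction xs)
  case (Cons x xs)
  have "(\<Sum>u\<in>A. of_nat (count_list (x # xs) u) * f u) =
      (\<Sum>u\<in>A. (if u = x then f u else 0) + of_nat (count_list xs u) * f u)"
    by (rule sum.cong) (auto simp: algebra_simps)
  then show ?case using Cons by (simp add: sum.distrib)
qed simp

text \<open>A rooted cactus without its root \<open>p\<close>: the vertex \<open>cyc y i\<close> is at position \<open>i\<close> of the cycle of
  length \<open>k y\<close> hanging at \<open>y\<close>.\<close>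

locale cactus =
  fixes H :: "('a, 'b) pre_digraph" and p :: 'a and up :: "'a \<Rightarrow> 'a" and cpos :: "'a \<Rightarrow> nat"
    and cyc :: "'a \<Rightarrow> nat \<Rightarrow> 'a" and k :: "'a \<Rightarrow> nat" and rk :: "'a \<Rightarrow> nat"
  assumes finite_verts: "finite (verts H)" and p_in: "p \<in> verts H"
    and up_in: "x \<in> verts H - {p} \<Longrightarrow> up x \<in> verts H"
    and cpos_pos: "x \<in> verts H - {p} \<Longrightarrow> 0 < cpos x"
    and cpos_less: "x \<in> verts H - {p} \<Longrightarrow> cpos x < k (up x)"
    and cyc_cpos: "x \<in> verts H - {p} \<Longrightarrow> cyc (up x) (cpos x) = x"
    and cyc_in: "y \<in> verts H \<Longrightarrow> 0 < i \<Longrightarrow> i < k y \<Longrightarrow> cyc y i \<in> verts H - {p}"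
    and up_cyc: "y \<in> verts H \<Longrightarrow> 0 < i \<Longrightarrow> i < k y \<Longrightarrow> up (cyc y i) = y"
    and cpos_cyc: "y \<in> verts H \<Longrightarrow> 0 < i \<Longrightarrow> i < k y \<Longrightarrow> cpos (cyc y i) = i"
    and k_pos: "y \<in> verts H \<Longrightarrow> 0 < k y"
    and cyc_0: "y \<in> verts H \<Longrightarrow> cyc y 0 = y"
    and cyc_k: "y \<in> verts H \<Longrightarrow> cyc y (k y) = y"
    and rk_prev: "x \<in> verts H - {p} \<Longrightarrow> rk (cyc (up x) (cpos x - 1)) < rk x"
    and degree_4: "x \<in> verts H - {p} \<Longrightarrow> degree H x = 4"
    and edge_mult_eq: "x \<in> verts H - {p} \<Longrightarrow> w \<in> verts H - {p} \<Longrightarrow>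
      edge_mult H x w = count_list [cyc (up x) (Suc (cpos x)), cyc (up x) (cpos x - 1),
        cyc x 1, cyc x (k x - 1)] w"
begin

abbreviation nbs :: "'a \<Rightarrow> 'a list" where
  "nbs x \<equiv> [cyc (up x) (Suc (cpos x)), cyc (up x) (cpos x - 1), cyc x 1, cyc x (k x - 1)]"

lemma sum_edge_mult:
  assumes "A \<subseteq> verts H - {p}" "x \<in> verts H - {p}"
  shows "(\<Sum>u\<in>A. of_nat (edge_mult H x u) * f u) =
    sum_list (map (\<lambda>u. if u \<in> A then f u else (0 :: 'c :: comm_semiring_1)) (nbs x))"
proof -
  have "finite A" using assms finite_verts by (blast intro: finite_subset)
  have "(\<Sum>u\<in>A. of_nat (edge_mult H x u) * f u) = (\<Sum>u\<in>A. of_nat (count_list (nbs x) u) * f u)"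
  proof (rule sum.cong[OF refl])
    fix u assume "u \<in> A"
    then have "edge_mult H x u = count_list (nbs x) u"
      using edge_mult_eq[OF assms(2)] assms(1) by blast
    then show "of_nat (edge_mult H x u) * f u = of_nat (count_list (nbs x) u) * f u"
      by (simp only:)
  qed
  then show ?thesis using sum_count_list[OF \<open>finite A\<close>] by metis
qed

lemma sum_edge_mult_of_bool:
  assumes "A \<subseteq> verts H - {p}" "x \<in> verts H - {p}"
  shows "(\<Sum>u\<in>A. edge_mult H x u) = of_bool (cyc (up x) (Suc (cpos x)) \<in> A) +
    of_bool (cyc (up x) (cpos x - 1) \<in> A) + of_bool (cyc x 1 \<in> A) + of_bool (cyc x (k x - 1) \<in> A)"
  using sum_edge_mult[OF assms, of "\<lambda>_. 1 :: nat"] by (simp add: of_bool_def)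

lemma cyc_in_verts: "y \<in> verts H \<Longrightarrow> i \<le> k y \<Longrightarrow> cyc y i \<in> verts H"
  by (metis DiffD1 cyc_0 cyc_in cyc_k le_neq_implies_less not_gr_zero)

lemma rk_cyc: "y \<in> verts H \<Longrightarrow> 0 < i \<Longrightarrow> i < k y \<Longrightarrow> rk y < rk (cyc y i)"
proof (induction i)
  case (Suc i)
  have "rk (cyc y i) < rk (cyc y (Suc i))"
    using rk_prev[OF cyc_in[OF Suc.prems]] up_cyc[OF Suc.prems] cpos_cyc[OF Suc.prems] by simp
  then show ?case using Suc cyc_0 by (cases i) auto
qed simp

lemma rk_up: "x \<in> verts H - {p} \<Longrightarrow> rk (up x) < rk x"
  using rk_cyc[of "up x" "cpos x"] up_in cpos_pos cpos_less cyc_cpos by metis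

lemma prev_in: "x \<in> verts H - {p} \<Longrightarrow> cyc (up x) (cpos x - 1) \<in> verts H"
  using cyc_in_verts[OF up_in] cpos_less less_imp_diff_less less_imp_le by metis

lemma potential_exists:
  "\<exists>g :: 'a \<Rightarrow> nat. \<forall>v\<in>verts H - {p}. (\<Sum>u\<in>verts H - {p}. edge_mult H v u * g u) < degree H v * g v"
proof -
  define R where "R = Max (rk ` verts H)"
  have R: "rk x \<le> R" if "x \<in> verts H" for x
    using finite_verts that by (auto simp: R_def)
  \<comment> \<open>The base 5 exceeds the degree 4. The neighbour one position closer to the base
    has smaller rank, hence a deficit \<open>h\<close> at least five times that of \<open>v\<close>,
    which beats the factor 4 on the right-hand side.\<close>
  define h where "h = (\<lambda>x. 5 ^ (R - rk x) :: nat)"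
  define g where "g = (\<lambda>x. 5 ^ R - h x)"
  have gh: "g x + h x = 5 ^ R" for x by (simp add: g_def h_def)
  show ?thesis
  proof (intro exI[of _ g] ballI)
    fix v assume v: "v \<in> verts H - {p}"
    define G where "G = (\<lambda>u. if u \<in> verts H - {p} then g u else 0)"
    have G: "G u < 5 ^ R" for u
    proof -
      have "0 < h u" by (simp add: h_def)
      then show ?thesis using gh[of u] by (auto simp: G_def)
    qed
    define w where "w = cyc (up v) (cpos v - 1)"
    have "G w + 5 * h v \<le> 5 ^ R"
    proof -
      have rk: "rk w < rk v" "rk v \<le> R" using rk_prev[OF v] R v by (auto simp: w_def)
      have "Suc (R - rk v) \<le> R - rk w" using rk by linarith
      then obtain d where d: "R - rk w = Suc (R - rk v) + d" using le_Suc_ex by blast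
      have "h w = 5 * h v * 5 ^ d" unfolding h_def d by (simp add: power_add)
      then have "5 * h v \<le> h w" by simp
      moreover have "G w \<le> g w" by (simp add: G_def)
      ultimately show ?thesis using gh[of w] by linarith
    qed
    moreover have "(\<Sum>u\<in>verts H - {p}. edge_mult H v u * g u) =
        G (cyc (up v) (Suc (cpos v))) + G w + G (cyc v 1) + G (cyc v (k v - 1))"
      using sum_edge_mult[OF order_refl v, of g] by (simp add: G_def w_def)
    moreover have "0 < h v" by (simp add: h_def)
    ultimately show "(\<Sum>u\<in>verts H - {p}. edge_mult H v u * g u) < degree H v * g v"
      using G[of "cyc (up v) (Suc (cpos v))"] G[of "cyc v 1"] G[of "cyc v (k v - 1)"] gh[of v]
      unfolding degree_4[OF v] by linarith
  qed
qed

sublocale sandpile H "{p}"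
proof
  fix v assume v: "v \<in> verts H - {p}"
  show "(\<Sum>u\<in>verts H - {p}. edge_mult H v u) \<le> degree H v"
    unfolding sum_edge_mult_of_bool[OF order_refl v] degree_4[OF v] by (auto simp: of_bool_def)
qed (rule finite_verts potential_exists)+

text \<open>Since \<open>f\<close> vanishes at the sink, the sink may be counted among the four
  neighbours.\<close>

lemma lap_eq:
  assumes "x \<in> V" "f p = 0"
  shows "lap f x = 4 * f x - (f (cyc (up x) (Suc (cpos x))) + f (cyc (up x) (cpos x - 1)) +
    f (cyc x 1) + f (cyc x (k x - 1)))"
proof -
  have ext: "(if u \<in> V then f u else 0) = f u" if "u \<in> verts H" for u
    using that assms(2) by auto
  have x: "x \<in> verts H" "up x \<in> verts H" using assms(1) up_in by auto
  have in_verts: "cyc (up x) (Suc (cpos x)) \<in> verts H" "cyc x 1 \<in> verts H" "cyc x (k x - 1) \<in> verts H"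
    using cyc_in_verts[OF x(2), of "Suc (cpos x)"] cyc_in_verts[OF x(1), of 1]
      cyc_in_verts[OF x(1), of "k x - 1"] cpos_less[OF assms(1)] k_pos[OF x(1)] by auto
  show ?thesis
    unfolding lap_def sum_edge_mult[OF order_refl assms(1), of f] degree_4[OF assms(1)]
    by (simp only: list.map sum_list.Cons sum_list.Nil ext[OF in_verts(1)] ext[OF in_verts(2)]
        ext[OF in_verts(3)] ext[OF prev_in[OF assms(1)]])
qed

section \<open>Forbidden subconfigurations of a cactus\<close>

inductive_set below :: "'a \<Rightarrow> 'a set" for x where
  refl: "x \<in> V \<Longrightarrow> x \<in> below x"
| step: "y \<in> V \<Longrightarrow> up y \<in> below x \<Longrightarrow> y \<in> below x"

lemma below_subset: "below x \<subseteq> V"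
  by (auto elim: below.cases)

lemma finite_below: "finite (below x)"
  using below_subset finite_V by (rule finite_subset)

lemma up_below: "y \<in> below x \<Longrightarrow> y \<noteq> x \<Longrightarrow> up y \<in> below x"
  by (auto elim: below.cases)

lemma rk_below: "y \<in> below x \<Longrightarrow> rk x \<le> rk y"
  by (induction rule: below.induct) (use rk_up in force)+

lemma cyc_below: "y \<in> below x \<Longrightarrow> i \<le> k y \<Longrightarrow> cyc y i \<in> below x"
proof -
  assume y: "y \<in> below x" and i: "i \<le> k y"
  then have yv: "y \<in> verts H" using below_subset by blast
  consider "i = 0" | "i = k y" | "0 < i" "i < k y" using i by linarith
  then show ?thesis
  proof cases
    case 3
    show ?thesis by (rule below.step) (use y cyc_in[OF yv 3] up_cyc[OF yv 3] in simp_all)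
  qed (use y cyc_0[OF yv] cyc_k[OF yv] in simp_all)
qed

lemma sum_edge_mult_ge:
  assumes "A \<subseteq> V" "x \<in> A" "cyc x 1 \<in> A" "cyc x (k x - 1) \<in> A"
  shows "2 + of_bool (cyc (up x) (Suc (cpos x)) \<in> A) + of_bool (cyc (up x) (cpos x - 1) \<in> A)
     \<le> (\<Sum>u\<in>A. edge_mult H x u)"
  using assms by (subst sum_edge_mult_of_bool) auto

lemma child_below:
  assumes "y \<in> below x" shows "cyc y 1 \<in> below x" "cyc y (k y - 1) \<in> below x"
  using assms k_pos[of y] below_subset[of x] by (auto intro!: cyc_below)

lemma proper_below:
  assumes "y \<in> below x" "y \<noteq> x"
  shows "cyc (up y) (Suc (cpos y)) \<in> below x" "cyc (up y) (cpos y - 1) \<in> below x"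
proof -
  have "y \<in> V" using assms(1) below_subset by blast
  then show "cyc (up y) (Suc (cpos y)) \<in> below x" "cyc (up y) (cpos y - 1) \<in> below x"
    using up_below[OF assms] cpos_less[of y] by (auto intro!: cyc_below)
qed

lemma Rec_less: "c \<in> Rec \<Longrightarrow> x \<in> V \<Longrightarrow> c x < 4"
  using degree_4 by (auto simp: Rec_def stable_configs_def)

text \<open>The subtree below \<open>x\<close> is tested. All its vertices except \<open>x\<close>
  have their four neighbours inside and would need four chips, so \<open>x\<close> passes the test,
  and two of its neighbours are inside.\<close>

lemma Rec_ge_2:
  assumes c: "c \<in> Rec" and x: "x \<in> V" shows "2 \<le> c x"
proof -
  obtain w where w: "w \<in> below x" "(\<Sum>u\<in>below x. edge_mult H w u) \<le> c w"
  proof (rule allowedD)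
    show "allowed c" using c by (simp add: Rec_def)
    show "below x \<noteq> {}" using below.refl[OF x] by blast
  qed (use below_subset in blast)+
  have "w \<in> V" using w(1) below_subset by auto
  have ge: "2 + of_bool (cyc (up w) (Suc (cpos w)) \<in> below x) + of_bool (cyc (up w) (cpos w - 1) \<in> below x)
     \<le> c w" using sum_edge_mult_ge[OF below_subset w(1) child_below[OF w(1)]] w(2) by linarith
  show ?thesis
  proof (cases "w = x")
    case False
    then show ?thesis using ge proper_below[OF w(1) False] Rec_less[OF c \<open>w \<in> V\<close>] by simp
  qed (use ge in simp)
qed

text \<open>A segment of the cycle together with all subtrees hanging from it is forbidden if both
  its ends carry two chips: the ends have at least three edges into the set, all other vertices
  four.\<close>

lemma Rec_cycle:
  assumes c: "c \<in> Rec" and y: "y \<in> verts H" and i: "0 < i1" "i1 < i2" "i2 < k y"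
  shows "\<not> (c (cyc y i1) = 2 \<and> c (cyc y i2) = 2)"
proof
  assume eq: "c (cyc y i1) = 2 \<and> c (cyc y i2) = 2"
  define A where "A = (\<Union>i\<in>{i1..i2}. below (cyc y i))"
  have A: "A \<subseteq> V" using below_subset by (auto simp: A_def)
  have self: "cyc y i \<in> A" if "i1 \<le> i" "i \<le> i2" for i
    using that cyc_in[OF y, of i] i by (auto simp: A_def intro!: bexI[of _ i] below.refl)
  obtain w where w: "w \<in> A" "(\<Sum>u\<in>A. edge_mult H w u) \<le> c w"
  proof (rule allowedD)
    show "allowed c" using c by (simp add: Rec_def)
    show "A \<noteq> {}" using self[of i1] i by auto
  qed (use A in blast)+
  obtain i where i': "i1 \<le> i" "i \<le> i2" "w \<in> below (cyc y i)" using w(1) by (auto simp: A_def)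
  have sub: "below (cyc y i) \<subseteq> A" using i' by (auto simp: A_def)
  have "w \<in> V" using w(1) A by auto
  have ge: "2 + of_bool (cyc (up w) (Suc (cpos w)) \<in> A) + of_bool (cyc (up w) (cpos w - 1) \<in> A) \<le> c w"
    using sum_edge_mult_ge[OF A w(1)] child_below[OF i'(3)] sub w(2) by fastforce
  have lt: "c w < 4" by (rule Rec_less[OF c \<open>w \<in> V\<close>])
  show False
  proof (cases "w = cyc y i")
    case False
    then show False using ge proper_below[OF i'(3) False] sub lt by (auto simp: subset_iff)
  next
    case True
    then have nb: "up w = y" "cpos w = i" using up_cyc[OF y, of i] cpos_cyc[OF y, of i] i i' by auto
    consider "i = i1" | "i = i2" | "i1 < i" "i < i2" using i' by linarith
    then show False
    proof cases
      case 1
      then have "cyc y (Suc i) \<in> A" using i self by auto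
      then show False using ge nb eq 1 True by simp
    next
      case 2
      then have "cyc y (i - 1) \<in> A" using i self by auto
      then show False using ge nb eq 2 True by simp
    next
      case 3
      then have "cyc y (Suc i) \<in> A" "cyc y (i - 1) \<in> A" using self by auto
      then show False using ge nb lt by simp
    qed
  qed
qed

section \<open>Recurrent configurations as cycle states\<close>

text \<open>The state of a cycle is the position of its vertex with two chips, and \<open>0\<close> if there is none.\<close>

definition states :: "('a \<Rightarrow> nat) set" where
  "states = PiE_dflt (verts H) 0 (\<lambda>y. {..<k y})"

definition config :: "('a \<Rightarrow> nat) \<Rightarrow> 'a \<Rightarrow> nat" where
  "config z x = (if x \<in> V then 3 - of_bool (cpos x = z (up x)) else 0)"

text \<open>For a vertex of least rank in \<open>A\<close>, the base of its parent cycle is not in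
  \<open>A\<close>. The first and the last position of \<open>A\<close> on that cycle each have a
  neighbour outside; at most one of the two carries two chips, so the other passes the test. If they
  coincide, two chips suffice.\<close>

lemma config_Rec:
  assumes "z \<in> states" shows "config z \<in> Rec"
proof -
  have "allowed (config z)"
    unfolding allowed_def
  proof (intro allI impI)
    fix A assume A: "A \<noteq> {}" "A \<subseteq> V"
    have "finite A" using A finite_V by (rule_tac finite_subset)
    obtain w where w: "w \<in> A" "\<And>u. u \<in> A \<Longrightarrow> rk w \<le> rk u"
      using arg_min_if_finite(1)[OF \<open>finite A\<close> A(1), of rk] arg_min_least[OF \<open>finite A\<close> A(1), of _ rk] by blast
    define y where "y = up w"
    have wV: "w \<in> V" using w A by auto
    have y: "y \<in> verts H" "y \<notin> A" using up_in[OF wV] w(2)[of y] rk_up[OF wV] by (auto simp: y_def)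
    define J where "J = {i. 0 < i \<and> i < k y \<and> cyc y i \<in> A}"
    have "finite J" by (rule finite_subset[of _ "{..<k y}"]) (auto simp: J_def)
    have "cpos w \<in> J" using w wV cpos_pos cpos_less cyc_cpos by (auto simp: J_def y_def)
    define a b where "a = Min J" and "b = Max J"
    have "J \<noteq> {}" using \<open>cpos w \<in> J\<close> by blast
    then have ab: "a \<in> J" "b \<in> J" "\<And>i. i \<in> J \<Longrightarrow> a \<le> i \<and> i \<le> b"
      using \<open>finite J\<close> by (auto simp: a_def b_def intro!: Min_in Max_in)
    have "a - 1 \<notin> J" "Suc b \<notin> J" using ab(3)[of "a - 1"] ab(3)[of "Suc b"] ab(1)
      by (auto simp: J_def)
    have prev: "cyc y (a - 1) \<notin> A"
    proof (cases "a = 1")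
      case True
      then show ?thesis using y cyc_0 by simp
    next
      case False
      then show ?thesis using \<open>a - 1 \<notin> J\<close> ab(1) by (auto simp: J_def)
    qed
    have nxt: "cyc y (Suc b) \<notin> A"
    proof (cases "Suc b = k y")
      case True
      then show ?thesis using y cyc_k by simp
    next
      case False
      then show ?thesis using \<open>Suc b \<notin> J\<close> ab(2) by (auto simp: J_def)
    qed
    have nb: "up (cyc y i) = y" "cpos (cyc y i) = i" "cyc y i \<in> V" "cyc y i \<in> A" if "i \<in> J" for i
      using that y up_cyc cpos_cyc cyc_in by (auto simp: J_def)
    show "\<exists>w\<in>A. (\<Sum>u\<in>A. edge_mult H w u) \<le> config z w"
    proof (cases "a = b")
      case True
      show ?thesis
      proof (intro bexI[of _ "cyc y a"])
        show "(\<Sum>u\<in>A. edge_mult H (cyc y a) u) \<le> config z (cyc y a)"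
          using prev nxt True nb[OF ab(1)]
          by (subst sum_edge_mult_of_bool[OF A(2)]) (auto simp: config_def of_bool_def)
      qed (rule nb(4)[OF ab(1)])
    next
      case False
      define e where "e = (if z y = a then b else a)"
      have e: "e \<in> J" "e \<noteq> z y" using ab False by (auto simp: e_def)
      have "cyc y (e - 1) \<notin> A \<or> cyc y (Suc e) \<notin> A" using prev nxt by (auto simp: e_def)
      then show ?thesis
        using nb[OF e(1)] e(2)
        by (intro bexI[of _ "cyc y e"], subst sum_edge_mult_of_bool[OF A(2)])
          (auto simp: config_def of_bool_def)
    qed
  qed
  then show ?thesis using degree_4 by (auto simp: Rec_def stable_configs_def config_def)
qed

lemma Rec_config:
  assumes c: "c \<in> Rec" shows "\<exists>z\<in>states. c = config z"
proof -
  define Q where "Q = (\<lambda>y i. 0 < i \<and> i < k y \<and> c (cyc y i) = 2)"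
  define z where "z = (\<lambda>y. if y \<in> verts H \<and> (\<exists>i. Q y i) then (SOME i. Q y i) else 0)"
  have zQ: "Q y (z y)" if "y \<in> verts H" "Q y i" for y i
    using that someI_ex[of "Q y"] by (auto simp: z_def)
  have uniq: "i = j" if "Q y i" "Q y j" "y \<in> verts H" for y i j
    using Rec_cycle[OF c that(3), of i j] Rec_cycle[OF c that(3), of j i] that(1,2)
    by (auto simp: Q_def) (metis linorder_neqE_nat)
  have "z \<in> states"
    unfolding states_def PiE_dflt_def
  proof (intro CollectI allI conjI impI)
    fix y assume y: "y \<in> verts H"
    show "z y \<in> {..<k y}"
    proof (cases "\<exists>i. Q y i")
      case True
      then show ?thesis using zQ[OF y] by (auto simp: Q_def)
    next
      case False
      then show ?thesis using k_pos[OF y] by (auto simp: z_def)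
    qed
  qed (auto simp: z_def)
  moreover have "c x = config z x" for x
  proof (cases "x \<in> V")
    case True
    have "c x = 2 \<or> c x = 3" using Rec_ge_2[OF c True] Rec_less[OF c True] by linarith
    moreover have "c x = 2 \<longleftrightarrow> cpos x = z (up x)"
    proof
      assume "c x = 2"
      then have Q: "Q (up x) (cpos x)"
        using True cpos_pos cpos_less cyc_cpos by (auto simp: Q_def)
      show "cpos x = z (up x)" by (rule uniq[OF Q zQ[OF _ Q]]) (use up_in True in auto)
    next
      assume eq: "cpos x = z (up x)"
      then have "\<exists>i. Q (up x) i" using cpos_pos[OF True] by (auto simp: z_def split: if_splits)
      then have "Q (up x) (z (up x))" using zQ up_in[OF True] by blast
      then show "c x = 2" using eq cyc_cpos[OF True] by (simp add: Q_def)
    qed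
    ultimately show ?thesis using True by (auto simp: config_def)
  qed (use c Rec_outside in \<open>auto simp: config_def\<close>)
  ultimately show ?thesis by blast
qed

lemma config_inj: "inj_on config states"
proof (rule inj_onI)
  fix z z' assume z: "z \<in> states" "z' \<in> states" "config z = config z'"
  have iff: "i = z y \<longleftrightarrow> i = z' y" if "y \<in> verts H" "0 < i" "i < k y" for y i
    using fun_cong[OF z(3), of "cyc y i"] that cyc_in[of y i] up_cyc[of y i] cpos_cyc[of y i]
    by (auto simp: config_def of_bool_def split: if_splits)
  show "z = z'"
  proof
    fix y show "z y = z' y"
    proof (cases "y \<in> verts H")
      case True
      then have "z y < k y" "z' y < k y" using z(1,2) by (auto simp: states_def PiE_dflt_def)
      then show ?thesis using iff[OF True, of "z y"] iff[OF True, of "z' y"] by (metis not_gr_zero)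
    qed (use z in \<open>auto simp: states_def PiE_dflt_def\<close>)
  qed
qed

lemma bij_betw_config: "bij_betw config states Rec"
  using config_inj config_Rec Rec_config by (auto simp: bij_betw_def)

end

section \<open>Laplacians of functions given by increments\<close>

context cactus begin

text \<open>A function on the cactus is described by its increments \<open>w y\<close> along the cycle below each \<open>y\<close>.\<close>

function odo :: "('a \<Rightarrow> nat \<Rightarrow> int) \<Rightarrow> 'a \<Rightarrow> int" where
  "odo w x = (if x \<in> V then odo w (up x) + w (up x) (cpos x) else 0)"
  by auto
termination
  by (relation "Wellfounded.measure (\<lambda>(w, x). rk x)") (use rk_up in auto)

declare odo.simps [simp del]

lemma odo_p [simp]: "odo w p = 0"
  by (simp add: odo.simps)

lemma odo_up: "x \<in> V \<Longrightarrow> odo w x = odo w (up x) + w (up x) (cpos x)"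
  by (simp add: odo.simps)

lemma odo_cyc:
  assumes "y \<in> verts H" "w y 0 = 0" "w y (k y) = 0" "i \<le> k y"
  shows "odo w (cyc y i) = odo w y + w y i"
proof -
  consider "i = 0" | "i = k y" | "0 < i" "i < k y" using assms(4) by linarith
  then show ?thesis
  proof cases
    case 3
    then show ?thesis using odo_up[OF cyc_in[OF assms(1) 3], of w] up_cyc[OF assms(1) 3]
        cpos_cyc[OF assms(1) 3] by simp
  qed (use assms cyc_0 cyc_k in auto)
qed

text \<open>The values themselves cancel: the parent cycle contributes the second difference of its
  increments and the cycle hanging at \<open>x\<close> contributes its flux into
  \<open>x\<close>.\<close>

lemma lap_odo:
  assumes x: "x \<in> V" and w: "\<And>y. y \<in> verts H \<Longrightarrow> w y 0 = 0 \<and> w y (k y) = 0"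
  shows "- lap (odo w) x = w (up x) (Suc (cpos x)) + w (up x) (cpos x - 1) - 2 * w (up x) (cpos x)
    + w x 1 + w x (k x - 1)"
proof -
  have v: "x \<in> verts H" "up x \<in> verts H" using x up_in by auto
  have le: "Suc (cpos x) \<le> k (up x)" "cpos x - 1 \<le> k (up x)" "1 \<le> k x" "k x - 1 \<le> k x"
    using cpos_less[OF x] k_pos[OF v(1)] by auto
  show ?thesis
    unfolding lap_eq[of x "odo w", OF x odo_p] using odo_cyc[of "up x" w, OF v(2) _ _ le(1)] odo_cyc[of "up x" w, OF v(2) _ _ le(2)]
      odo_cyc[of x w, OF v(1) _ _ le(3)] odo_cyc[of x w, OF v(1) _ _ le(4)] odo_up[OF x, of w] w v
    by simp
qed

lemma odo_mono_below:
  assumes "x \<in> below a" "\<And>y i. 0 \<le> w y i"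
  shows "odo w a \<le> odo w x"
  using assms(1)
proof induction
  case (step y)
  then show ?case using odo_up[of y w] assms(2)[of "up y" "cpos y"] by simp
qed simp

lemma below_linear: "x \<in> below a \<Longrightarrow> x \<in> below b \<Longrightarrow> a \<in> below b \<or> b \<in> below a"
proof (induction rule: below.induct)
  case (step y)
  then show ?case using up_below[of y b] below.step[of y a] by metis
qed simp

lemma below_trans: "x \<in> below a \<Longrightarrow> a \<in> below b \<Longrightarrow> x \<in> below b"
proof (induction rule: below.induct)
  case (step y)
  show ?case by (rule below.step[OF step(1) step(3)[OF step(4)]])
qed

lemma below_disjoint:
  assumes "y \<in> verts H" "0 < i" "i < k y" "0 < j" "j < k y" "i \<noteq> j"
  shows "below (cyc y i) \<inter> below (cyc y j) = {}"
proof -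
  have no: "cyc y i \<notin> below (cyc y j)" if "0 < i" "i < k y" "0 < j" "j < k y" "i \<noteq> j" for i j
  proof
    assume *: "cyc y i \<in> below (cyc y j)"
    have "cyc y i \<noteq> cyc y j" using cpos_cyc[OF assms(1) that(1,2)] cpos_cyc[OF assms(1) that(3,4)] that by auto
    then have "y \<in> below (cyc y j)" using up_below[OF *] up_cyc[OF assms(1) that(1,2)] by simp
    then show False using rk_below[of y "cyc y j"] rk_cyc[OF assms(1) that(3,4)] by simp
  qed
  show ?thesis using below_linear no[OF assms(2-6)] no[OF assms(4,5,2,3)] assms(6) by blast
qed

end

section \<open>The odometer of a single chip\<close>

locale cactus_path = cactus +
  fixes v\<^sub>0 :: 'a and z :: "'a \<Rightarrow> nat"
  assumes v0_in: "v\<^sub>0 \<in> V" and z_states: "z \<in> states"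
begin

definition pt :: "nat \<Rightarrow> 'a" where "pt j = (up ^^ j) v\<^sub>0"
definition m :: nat where "m = (LEAST j. pt j = p)"

definition Kj :: "nat \<Rightarrow> nat" where "Kj j = k (pt (Suc j))"
definition Ij :: "nat \<Rightarrow> nat" where "Ij j = cpos (pt j)"
definition Zj :: "nat \<Rightarrow> nat" where "Zj j = z (pt (Suc j))"
definition Nj :: "nat \<Rightarrow> nat" where "Nj = chips Kj Ij Zj"
definition wj :: "nat \<Rightarrow> nat \<Rightarrow> int" where
  "wj j i = profile (Nj j) (int (Kj j)) (int (Ij j)) (int (Zj j)) (int i)"

lemma pt_0 [simp]: "pt 0 = v\<^sub>0" and pt_Suc: "pt (Suc j) = up (pt j)"
  by (simp_all add: pt_def)

lemma pt_reaches_p: "\<exists>j. pt j = p"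
proof (rule ccontr)
  assume neq: "\<nexists>j. pt j = p"
  have "pt j \<in> V" for j
  proof (induction j)
    case (Suc j)
    then show ?case using up_in[of "pt j"] neq pt_Suc by (metis Diff_iff singletonD)
  qed (use v0_in in simp)
  then have "rk (pt (Suc j)) < rk (pt j)" for j using rk_up pt_Suc by metis
  then show False using wf_iff_no_infinite_down_chain[of "Wellfounded.measure rk"] by auto
qed

lemma pt_m: "pt m = p"
  unfolding m_def using pt_reaches_p by (rule LeastI_ex)

lemma pt_in: "j < m \<Longrightarrow> pt j \<in> V"
proof (induction j)
  case (Suc j)
  then have "pt (Suc j) \<noteq> p" using not_less_Least unfolding m_def by blast
  then show ?case using Suc up_in by (auto simp: pt_Suc)
qed (use v0_in in simp)

lemma pt_in_verts: "j \<le> m \<Longrightarrow> pt j \<in> verts H"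
  using pt_in[of j] pt_m p_in by (cases "j = m") auto

lemma m_pos: "0 < m"
  using v0_in pt_m by (cases m) auto

lemma rk_pt: "i < j \<Longrightarrow> j \<le> m \<Longrightarrow> rk (pt j) < rk (pt i)"
proof (induction j)
  case (Suc j)
  then have "rk (pt (Suc j)) < rk (pt j)" using rk_up[OF pt_in[of j]] by (simp add: pt_Suc)
  then show ?case using Suc by (cases "i = j") auto
qed simp

lemma pt_inj: "i \<le> m \<Longrightarrow> j \<le> m \<Longrightarrow> pt i = pt j \<Longrightarrow> i = j"
  by (metis linorder_neqE_nat nat_neq_iff rk_pt)

lemma IK: assumes "j < m" shows "0 < Ij j" "Ij j < Kj j" "Zj j < Kj j" "cyc (pt (Suc j)) (Ij j) = pt j"
proof -
  have "pt (Suc j) \<in> verts H" using assms pt_in_verts by simp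
  then show "0 < Ij j" "Ij j < Kj j" "Zj j < Kj j" "cyc (pt (Suc j)) (Ij j) = pt j"
    using cpos_pos[OF pt_in[OF assms]] cpos_less[OF pt_in[OF assms]] cyc_cpos[OF pt_in[OF assms]]
      z_states by (auto simp: Ij_def Kj_def Zj_def pt_Suc states_def PiE_dflt_def)
qed

lemma int_IK: "j < m \<Longrightarrow> 0 < int (Ij j) \<and> int (Ij j) < int (Kj j) \<and> 0 \<le> int (Zj j) \<and> int (Zj j) < int (Kj j)"
  using IK[of j] by simp

text \<open>Zero increments off the path express that everything hanging there fires as often as its
  point of attachment.\<close>

definition w :: "'a \<Rightarrow> nat \<Rightarrow> int" where
  "w y i = (if \<exists>j<m. y = pt (Suc j) then wj (THE j. j < m \<and> y = pt (Suc j)) i else 0)"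

lemma w_pt: "j < m \<Longrightarrow> w (pt (Suc j)) i = wj j i"
  unfolding w_def by (subst the_equality[of _ j]) (use pt_inj[of "Suc _" "Suc j"] in auto)

lemma w_other: "(\<And>j. j < m \<Longrightarrow> y \<noteq> pt (Suc j)) \<Longrightarrow> w y i = 0"
  by (auto simp: w_def)

lemma wj_nonneg: "0 \<le> wj j i" by (simp add: wj_def profile_nonneg)

lemma w_nonneg: "0 \<le> w y i" by (simp add: w_def wj_nonneg)

lemma w_ends: "w y 0 = 0 \<and> w y (k y) = 0"
proof (cases "\<exists>j<m. y = pt (Suc j)")
  case True
  then obtain j where j: "j < m" "y = pt (Suc j)" by blast
  have "wj j 0 = 0" "wj j (Kj j) = 0"
    using profile_ends[of "int (Ij j)" "int (Kj j)" "int (Zj j)"] int_IK[OF j(1)] by (auto simp: wj_def)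
  then show ?thesis using w_pt[OF j(1)] j(2) by (simp add: Kj_def)
qed (auto simp: w_other)

definition u :: "'a \<Rightarrow> int" where "u = odo w"

lemma u_nonneg: "0 \<le> u x"
proof (induction "rk x" arbitrary: x rule: less_induct)
  case less
  show ?case
  proof (cases "x \<in> V")
    case True
    then show ?thesis using less[OF rk_up[OF True]] odo_up[OF True, of w] w_nonneg[of "up x" "cpos x"]
      by (simp add: u_def)
  next
    case False
    then show ?thesis by (simp only: u_def odo.simps[of w x] if_False order_refl)
  qed
qed

text \<open>The states after the avalanche: on cycle \<open>j\<close> each of the
  \<open>Nj j\<close> chips moves the special position back by \<open>Ij j\<close>; all other cycles
  keep their state.\<close>

definition z' :: "'a \<Rightarrow> nat" where
  "z' y = (if \<exists>j<m. y = pt (Suc j) then let j = (THE j. j < m \<and> y = pt (Suc j)) in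
     nat ((int (Zj j) - int (Nj j) * int (Ij j)) mod int (Kj j)) else z y)"

lemma z'_pt: "j < m \<Longrightarrow> int (z' (pt (Suc j))) = (int (Zj j) - int (Nj j) * int (Ij j)) mod int (Kj j)"
  unfolding z'_def by (subst the_equality[of _ j]) (use pt_inj[of "Suc _" "Suc j"] IK(2)[of j] in auto)

lemma z'_states: "z' \<in> states"
  unfolding states_def PiE_dflt_def
proof (intro CollectI allI conjI impI)
  fix y
  show "z' y \<in> {..<k y}" if "y \<in> verts H"
  proof (cases "\<exists>j<m. y = pt (Suc j)")
    case True
    then obtain j where j: "j < m" "y = pt (Suc j)" by blast
    have "int (z' y) < int (Kj j)" unfolding j(2) z'_pt[OF j(1)] using IK(2)[OF j(1)] by simp
    then show ?thesis by (simp add: j(2) Kj_def)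
  qed (use z_states that in \<open>auto simp: z'_def states_def PiE_dflt_def\<close>)
  show "z' y = 0" if "y \<notin> verts H"
    using that z_states pt_in_verts by (auto simp: z'_def states_def PiE_dflt_def)
qed

lemma flux: "Suc j < m \<Longrightarrow> w (pt (Suc j)) 1 + w (pt (Suc j)) (k (pt (Suc j)) - 1) = int (Nj (Suc j))"
proof -
  assume "Suc j < m"
  then have j: "j < m" by simp
  have k1: "int (k (pt (Suc j)) - 1) = int (Kj j) - 1" using IK(2)[OF j] by (auto simp: Kj_def)
  have "w (pt (Suc j)) 1 + w (pt (Suc j)) (k (pt (Suc j)) - 1) =
      int (Nj j) + of_bool (int (Zj j) = 0) -
        of_bool ((int (Zj j) - int (Nj j) * int (Ij j)) mod int (Kj j) = 0)"
    unfolding w_pt[OF j] wj_def k1 using int_IK[OF j] by (simp add: profile_flux)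
  also have "\<dots> = int (Nj (Suc j))"
    unfolding mod_eq_0_iff_eq_mod[OF IK(3)[OF j]] Nj_def int_chips_Suc by simp
  finally show ?thesis .
qed

text \<open>On a path cycle the second difference moves the special position and consumes
  \<open>Nj j\<close> chips at the entrance. These are exactly the chips that arrive there: the
  dropped one for \<open>j = 0\<close>, the flux of the preceding cycle otherwise. Elsewhere nothing
  changes.\<close>

lemma config_topple:
  assumes x: "x \<in> V"
  shows "int (config z' x) = int (config z x) + of_bool (x = v\<^sub>0) - lap u x"
proof -
  have conf: "int (config z x) = 3 - of_bool (cpos x = z (up x))" "int (config z' x) = 3 - of_bool (cpos x = z' (up x))"
    using x by (auto simp: config_def)
  have lap: "- lap u x = w (up x) (Suc (cpos x)) + w (up x) (cpos x - 1) - 2 * w (up x) (cpos x)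
    + w x 1 + w x (k x - 1)" unfolding u_def by (rule lap_odo[OF x w_ends])
  show ?thesis
  proof (cases "\<exists>j<m. up x = pt (Suc j)")
    case True
    then obtain j where j: "j < m" "up x = pt (Suc j)" by blast
    have pos: "0 < int (cpos x)" "int (cpos x) < int (Kj j)"
      using cpos_pos[OF x] cpos_less[OF x] j by (auto simp: Kj_def)
    have c1: "int (cpos x - 1) = int (cpos x) - 1" using pos by simp
    have c2: "int (Suc (cpos x)) = int (cpos x) + 1" by simp
    have x_eq: "x = pt j \<longleftrightarrow> cpos x = Ij j"
      using cyc_cpos[OF x] IK(4)[OF j(1)] j(2) by (metis Ij_def)
    have "w (up x) (Suc (cpos x)) + w (up x) (cpos x - 1) - 2 * w (up x) (cpos x) =
      of_bool (int (cpos x) = int (Zj j)) - of_bool (int (cpos x) = (int (Zj j) - int (Nj j) * int (Ij j)) mod int (Kj j))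
       - int (Nj j) * of_bool (int (cpos x) = int (Ij j))"
      unfolding j(2) w_pt[OF j(1)] wj_def c2 c1
      by (rule profile_second_difference) (use int_IK[OF j(1)] pos in auto)
    also have "\<dots> = of_bool (cpos x = z (up x)) - of_bool (cpos x = z' (up x)) - int (Nj j) * of_bool (x = pt j)"
      unfolding z'_pt[OF j(1), symmetric] j(2) x_eq by (simp add: Zj_def)
    finally have second: "w (up x) (Suc (cpos x)) + w (up x) (cpos x - 1) - 2 * w (up x) (cpos x) =
      of_bool (cpos x = z (up x)) - of_bool (cpos x = z' (up x)) - int (Nj j) * of_bool (x = pt j)" .
    have "of_bool (x = v\<^sub>0) + w x 1 + w x (k x - 1) = int (Nj j) * of_bool (x = pt j)"
    proof (cases "x = pt j")
      case xj: True
      show ?thesis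
      proof (cases j)
        case 0
        have "w x i = 0" for i
        proof (rule w_other)
          fix l assume "l < m"
          then show "x \<noteq> pt (Suc l)" using xj 0 pt_inj[of 0 "Suc l"] by auto
        qed
        then show ?thesis using xj 0 by (simp add: Nj_def)
      next
        case (Suc l)
        have "x \<noteq> v\<^sub>0" using xj Suc pt_inj[of 0 "Suc l"] j by auto
        then show ?thesis using flux[of l] xj Suc j by simp
      qed
    next
      case False
      have no: "x \<noteq> pt l" if "l < m" for l
        using pt_inj[of "Suc l" "Suc j"] that j False by (auto simp: pt_Suc)
      then have "x \<noteq> v\<^sub>0" using m_pos pt_0 by metis
      moreover have "w x i = 0" for i
      proof (rule w_other)
        fix l assume l: "l < m"
        show "x \<noteq> pt (Suc l)"
        proof (cases "Suc l < m")
          case False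
          then show ?thesis using l pt_m x by (metis DiffD2 Suc_lessI singletonI)
        qed (rule no)
      qed
      ultimately show ?thesis using False by simp
    qed
    then show ?thesis using conf lap second by linarith
  next
    case False
    have no: "x \<noteq> pt l" if "l < m" for l using False that pt_Suc by auto
    then have "x \<noteq> v\<^sub>0" using m_pos pt_0 by metis
    moreover have "w x i = 0" for i
    proof (rule w_other)
      fix l assume l: "l < m"
      show "x \<noteq> pt (Suc l)"
      proof (cases "Suc l < m")
        case False
        then show ?thesis using l pt_m x by (metis DiffD2 Suc_lessI singletonI)
      qed (rule no)
    qed
    moreover have "w (up x) i = 0" for i by (rule w_other) (use False in auto)
    moreover have "z' (up x) = z (up x)" using False by (auto simp: z'_def)
    ultimately show ?thesis using conf lap by simp
  qed
qed

section \<open>The mass as a function of the stopping cycle\<close>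

lemma mass_eq: "avalanche_mass H {p} (config z) v\<^sub>0 = card {x \<in> V. 0 < u x}"
  by (rule avalanche_mass_eq[OF config_Rec[OF z_states] v0_in config_Rec[OF z'_states] config_topple])

lemma Nj_Suc_eq_0_iff: "j < m \<Longrightarrow> Nj (Suc j) = 0 \<longleftrightarrow> Nj j = 0 \<or> Nj j = 1 \<and> Zj j = Ij j"
  unfolding Nj_def using IK(1,2) by (rule chips_Suc_eq_0_iff)

lemma wj_eq_0: "j < m \<Longrightarrow> Nj (Suc j) = 0 \<Longrightarrow> i \<le> Kj j \<Longrightarrow> wj j i = 0"
  unfolding Nj_Suc_eq_0_iff wj_def using int_IK[of j] by (intro profile_eq_0) auto

lemma wj_pos: "j < m \<Longrightarrow> Nj (Suc j) \<noteq> 0 \<Longrightarrow> 0 < wj j (Ij j)"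
  unfolding Nj_Suc_eq_0_iff wj_def using int_IK[of j] by (intro profile_pos) auto

lemma u_pt: "j < m \<Longrightarrow> u (pt j) = u (pt (Suc j)) + wj j (Ij j)"
  unfolding u_def using odo_up[OF pt_in, of j w] w_pt[of j] by (simp add: pt_Suc Ij_def)

lemma Nj_0_mono: "i \<le> j \<Longrightarrow> j \<le> m \<Longrightarrow> Nj i = 0 \<Longrightarrow> Nj j = 0"
proof (induction rule: dec_induct)
  case (step j)
  then show ?case using Nj_Suc_eq_0_iff[of j] by simp
qed

lemma u_pt_eq_0: "j \<le> m \<Longrightarrow> (j < m \<Longrightarrow> Nj (Suc j) = 0) \<Longrightarrow> u (pt j) = 0"
proof (induction rule: inc_induct)
  case base
  then show ?case by (simp add: pt_m u_def)
next
  case (step j)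
  then have "u (pt (Suc j)) = 0" using Nj_0_mono[of "Suc j" "Suc (Suc j)"] by auto
  then show ?case using u_pt[of j] step wj_eq_0[of j "Ij j"] IK(2)[of j] by simp
qed

lemma u_pt_pos: "j < m \<Longrightarrow> Nj (Suc j) \<noteq> 0 \<Longrightarrow> 0 < u (pt j)"
  using u_pt[of j] wj_pos[of j] u_nonneg[of "pt (Suc j)"] by simp

text \<open>Found by climbing from \<open>x\<close> to its last ancestor that fires.\<close>

lemma u_pos_cases:
  assumes "x \<in> V" "0 < u x"
  shows "\<exists>l<m. Nj (Suc l) \<noteq> 0 \<and> u (pt (Suc l)) = 0 \<and> (\<exists>i. 0 < i \<and> i < Kj l \<and> 0 < wj l i \<and> x \<in> below (cyc (pt (Suc l)) i))"
  using assms
proof (induction "rk x" arbitrary: x rule: less_induct)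
  case less
  show ?case
  proof (cases "up x \<in> V \<and> 0 < u (up x)")
    case True
    with less.hyps[of "up x"] rk_up[OF less.prems(1)] less.prems(1) show ?thesis
      by (meson below.step)
  next
    case False
    then have u0: "u (up x) = 0" using u_nonneg[of "up x"] up_in[OF less.prems(1)]
      by (cases "up x = p") (auto simp: u_def)
    then have wpos: "0 < w (up x) (cpos x)"
      using less.prems odo_up[of x w] by (simp add: u_def)
    then obtain l where l: "l < m" "up x = pt (Suc l)" using w_other[of "up x"] by force
    have pos: "0 < cpos x" "cpos x < Kj l" using cpos_pos[OF less.prems(1)] cpos_less[OF less.prems(1)] l by (auto simp: Kj_def)
    have "0 < wj l (cpos x)" using wpos w_pt l by simp
    moreover from this have "Nj (Suc l) \<noteq> 0" using wj_eq_0[OF l(1), of "cpos x"] pos by auto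
    moreover have "x \<in> below (cyc (pt (Suc l)) (cpos x))"
      using cyc_cpos[OF less.prems(1)] l(2) less.prems(1) by (auto intro: below.refl)
    ultimately show ?thesis using l u0 pos by auto
  qed
qed

text \<open>Cycle \<open>j\<close> is the last one on which anything fires. Its base stays silent,
  while the bases of all earlier path cycles fire, so every fired vertex hangs from a fired position
  of cycle \<open>j\<close>.\<close>

lemma set_u_pos:
  assumes j: "j < m" "Nj (Suc j) \<noteq> 0" "Suc j < m \<Longrightarrow> Nj (Suc (Suc j)) = 0"
  shows "{x \<in> V. 0 < u x} = (\<Union>i\<in>{i. 0 < i \<and> i < Kj j \<and> 0 < wj j i}. below (cyc (pt (Suc j)) i))"
proof (intro equalityI subsetI)
  have u0: "u (pt (Suc j)) = 0" by (rule u_pt_eq_0) (use j in auto)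
  fix x
  { assume x: "x \<in> {x \<in> V. 0 < u x}"
    then obtain l i where l: "l < m" "Nj (Suc l) \<noteq> 0" "u (pt (Suc l)) = 0" "0 < i" "i < Kj l"
      "0 < wj l i" "x \<in> below (cyc (pt (Suc l)) i)" using u_pos_cases[of x] by blast
    have "l = j"
    proof (rule ccontr)
      assume "l \<noteq> j"
      then consider "l < j" | "j < l" by linarith
      then show False
      proof cases
        case 1
        then have "Nj (Suc (Suc l)) \<noteq> 0" using Nj_0_mono[of "Suc (Suc l)" "Suc j"] j by auto
        then show False using u_pt_pos[of "Suc l"] l 1 j by simp
      next
        case 2
        then have "Nj (Suc (Suc j)) = 0" using j l by auto
        then show False using Nj_0_mono[of "Suc (Suc j)" "Suc l"] 2 l by auto
      qed
    qed
    with l show "x \<in> (\<Union>i\<in>{i. 0 < i \<and> i < Kj j \<and> 0 < wj j i}. below (cyc (pt (Suc j)) i))" by auto }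
  { assume "x \<in> (\<Union>i\<in>{i. 0 < i \<and> i < Kj j \<and> 0 < wj j i}. below (cyc (pt (Suc j)) i))"
    then obtain i where i: "0 < i" "i < Kj j" "0 < wj j i" "x \<in> below (cyc (pt (Suc j)) i)" by auto
    have y: "pt (Suc j) \<in> verts H" using j pt_in_verts by simp
    have ik: "0 < i" "i < k (pt (Suc j))" using i by (auto simp: Kj_def)
    have "u (cyc (pt (Suc j)) i) = wj j i"
      using odo_up[OF cyc_in[OF y ik], of w] up_cyc[OF y ik] cpos_cyc[OF y ik] w_pt[OF j(1), of i] u0
      by (simp add: u_def)
    then have "0 < u x" using odo_mono_below[OF i(4), of w] w_nonneg i(3) by (simp add: u_def)
    then show "x \<in> {x \<in> V. 0 < u x}" using i(4) below_subset by auto }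
qed

definition mj :: "nat \<Rightarrow> nat" where
  "mj j = (\<Sum>i | 0 < i \<and> i < Kj j \<and> 0 < wj j i. card (below (cyc (pt (Suc j)) i)))"

abbreviation mass :: nat where "mass \<equiv> avalanche_mass H {p} (config z) v\<^sub>0"

lemma mass_eq_mj:
  assumes "j < m" "Nj (Suc j) \<noteq> 0" "Suc j < m \<Longrightarrow> Nj (Suc (Suc j)) = 0"
  shows "mass = mj j"
proof -
  have eq: "{x \<in> V. 0 < u x} = (\<Union>i\<in>{i. 0 < i \<and> i < Kj j \<and> 0 < wj j i}. below (cyc (pt (Suc j)) i))"
    by (rule set_u_pos) (fact assms)+
  show ?thesis unfolding mass_eq eq mj_def
proof (rule card_UN_disjoint)
  show "finite {i. 0 < i \<and> i < Kj j \<and> 0 < wj j i}"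
    by (rule finite_subset[of _ "{..<Kj j}"]) auto
  have y: "pt (Suc j) \<in> verts H" using assms pt_in_verts by simp
  show "\<forall>i\<in>{i. 0 < i \<and> i < Kj j \<and> 0 < wj j i}. \<forall>i'\<in>{i. 0 < i \<and> i < Kj j \<and> 0 < wj j i}. i \<noteq> i' \<longrightarrow>
      below (cyc (pt (Suc j)) i) \<inter> below (cyc (pt (Suc j)) i') = {}"
    using below_disjoint[OF y] by (auto simp: Kj_def)
qed (use finite_below in auto)
qed

lemma mass_eq_0_iff: "mass = 0 \<longleftrightarrow> Nj 1 = 0"
proof
  assume "Nj 1 = 0"
  then have no: "Nj (Suc l) = 0" if "l < m" for l using Nj_0_mono[of 1 "Suc l"] that by simp
  have "{x \<in> V. 0 < u x} = {}" using u_pos_cases no by fastforce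
  then show "mass = 0" by (simp only: mass_eq card.empty)
next
  assume "mass = 0"
  then have "{x \<in> V. 0 < u x} = {}" unfolding mass_eq using finite_V by simp
  then show "Nj 1 = 0" using u_pt_pos[of 0] m_pos v0_in by auto
qed

lemma card_below_le_mass: "j < m \<Longrightarrow> Nj (Suc j) \<noteq> 0 \<Longrightarrow> card (below (pt j)) \<le> mass"
  unfolding mass_eq
proof (rule card_mono)
  assume j: "j < m" "Nj (Suc j) \<noteq> 0"
  show "below (pt j) \<subseteq> {x \<in> V. 0 < u x}"
    using odo_mono_below[of _ "pt j" w] w_nonneg u_pt_pos[OF j] below_subset by (fastforce simp: u_def)
qed (use finite_V in auto)

lemma mass_less_card_below:
  assumes j: "Suc j < m" "Nj (Suc (Suc j)) = 0"
  shows "mass < card (below (pt (Suc j)))"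
proof -
  have "{x \<in> V. 0 < u x} \<subset> below (pt (Suc j))"
  proof (rule psubsetI)
    have self: "pt (Suc j) \<in> below (pt (Suc j))" by (rule below.refl[OF pt_in[OF j(1)]])
    have u0: "u (pt (Suc j)) = 0" by (rule u_pt_eq_0) (use j in auto)
    show "{x \<in> V. 0 < u x} \<subseteq> below (pt (Suc j))"
    proof
      fix x assume "x \<in> {x \<in> V. 0 < u x}"
      then obtain l i where l: "l < m" "Nj (Suc l) \<noteq> 0" "0 < i" "i < Kj l" "x \<in> below (cyc (pt (Suc l)) i)"
        using u_pos_cases[of x] by blast
      have "l \<le> j"
      proof (rule ccontr)
        assume "\<not> l \<le> j"
        then show False using Nj_0_mono[of "Suc (Suc j)" "Suc l"] l j by auto
      qed
      have "pt l' \<in> below (pt (Suc j))" if "l' \<le> Suc j" for l'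
        using that
      proof (induction rule: inc_induct)
        case (step i)
        then show ?case using j by (intro below.step[of "pt i"] pt_in) (simp_all add: pt_Suc)
      qed (rule self)
      then have "pt (Suc l) \<in> below (pt (Suc j))" using \<open>l \<le> j\<close> by simp
      then have "cyc (pt (Suc l)) i \<in> below (pt (Suc j))" using l by (intro cyc_below) (auto simp: Kj_def)
      with l(5) show "x \<in> below (pt (Suc j))" by (rule below_trans)
    qed
    show "{x \<in> V. 0 < u x} \<noteq> below (pt (Suc j))"
    proof
      assume "{x \<in> V. 0 < u x} = below (pt (Suc j))"
      then have "0 < u (pt (Suc j))" using self by blast
      then show False using u0 by simp
    qed
  qed
  then show ?thesis unfolding mass_eq using finite_below by (intro psubset_card_mono)
qed

text \<open>If \<open>pt j\<close> fires, its whole subtree does; if \<open>pt (Suc j)\<close> does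
  not, the avalanche stays strictly inside its subtree. The window containing \<open>M\<close> thus
  determines the cycle where the avalanche stops.\<close>

lemma mass_eq_iff:
  assumes j: "Suc j < m" and M: "card (below (pt j)) \<le> M" "M < card (below (pt (Suc j)))"
  shows "mass = M \<longleftrightarrow> Nj (Suc j) \<noteq> 0 \<and> Nj (Suc (Suc j)) = 0 \<and> mj j = M"
proof
  assume mass: "mass = M"
  have N2: "Nj (Suc (Suc j)) = 0"
  proof (rule ccontr)
    assume "Nj (Suc (Suc j)) \<noteq> 0"
    then have "card (below (pt (Suc j))) \<le> mass" by (rule card_below_le_mass[OF j])
    then show False using M(2) mass by linarith
  qed
  have N1: "Nj (Suc j) \<noteq> 0"
  proof
    assume N0: "Nj (Suc j) = 0"
    show False
    proof (cases j)
      case 0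
      have "mass = 0" unfolding mass_eq_0_iff using N0 0 by simp
      moreover have "pt j \<in> below (pt j)" by (rule below.refl, rule pt_in) (use j in simp)
      then have "0 < card (below (pt j))" using finite_below card_gt_0_iff by blast
      ultimately show False using M(1) mass by linarith
    next
      case (Suc l)
      have "mass < card (below (pt (Suc l)))"
        by (rule mass_less_card_below) (use Suc N0 j in simp_all)
      then show False using M(1) mass Suc by simp
    qed
  qed
  have "mass = mj j" by (rule mass_eq_mj) (use j N1 N2 in simp_all)
  then show "Nj (Suc j) \<noteq> 0 \<and> Nj (Suc (Suc j)) = 0 \<and> mj j = M"
    using mass N1 N2 by simp
next
  assume *: "Nj (Suc j) \<noteq> 0 \<and> Nj (Suc (Suc j)) = 0 \<and> mj j = M"
  have "mass = mj j" by (rule mass_eq_mj) (use j * in simp_all)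
  then show "mass = M" using * by simp
qed

lemma mass_less_card_v0:
  assumes "mass < card (below v\<^sub>0)" shows "mass = 0"
proof (rule ccontr)
  assume "mass \<noteq> 0"
  then have "Nj (Suc 0) \<noteq> 0" using mass_eq_0_iff by simp
  from card_below_le_mass[OF m_pos this] assms show False by simp
qed

end

section \<open>The rooted Schreier graphs as cacti\<close>

definition nbr :: "('a, 'b) pre_digraph \<Rightarrow> 'a \<Rightarrow> 'a \<Rightarrow> bool" where
  "nbr G x y \<longleftrightarrow> (\<exists>e\<in>arcs G. (tail G e = x \<and> head G e = y) \<or> (tail G e = y \<and> head G e = x))"

lemma joined_iff:
  assumes "wf_digraph G" shows "joined G u v \<longleftrightarrow> u \<in> verts G \<and> (nbr G)\<^sup>*\<^sup>* u v"
proof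
  assume "joined G u v"
  then have "(u, v) \<in> rtrancl_on (verts G) (parcs (mk_symmetric G))"
    by (simp add: joined_def reachable_def)
  then show "u \<in> verts G \<and> (nbr G)\<^sup>*\<^sup>* u v"
  proof (induction rule: rtrancl_on_induct)
    case (step y z)
    then have "nbr G y z" by (auto simp: parcs_mk_symmetric nbr_def)
    then show ?case using step by auto
  qed simp
next
  assume "u \<in> verts G \<and> (nbr G)\<^sup>*\<^sup>* u v"
  then have "(nbr G)\<^sup>*\<^sup>* u v" "u \<in> verts G" by auto
  then have "(u, v) \<in> rtrancl_on (verts G) (parcs (mk_symmetric G))"
  proof induction
    case (step y z)
    then have "(y, z) \<in> parcs (mk_symmetric G)" by (auto simp: parcs_mk_symmetric nbr_def)
    moreover have "z \<in> verts G" using step(2) assms by (auto simp: nbr_def wf_digraph.wellformed)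
    ultimately show ?case using step by (auto intro: rtrancl_on_into_rtrancl_on)
  qed auto
  then show "joined G u v" by (simp add: joined_def reachable_def)
qed

lemma gen_eq: "gen True = bas_b" "gen False = bas_a"
  by (auto simp: gen.simps)

lemma basilica_gens_eq: "basilica_gens = range gen"
  by (auto simp: basilica_gens_def gen_eq UNIV_bool)

lemma gen_inj [simp]: "gen \<sigma> = gen \<sigma>' \<longleftrightarrow> \<sigma> = \<sigma>'"
proof -
  have "gen True [False] \<noteq> gen False [False]" by simp
  then show ?thesis by (cases \<sigma>; cases \<sigma>') metis+
qed

lemma Gamma_fin_simps [simp]:
  "verts (Gamma_fin n) = {w. length w = n}"
  "arcs (Gamma_fin n) = {w. length w = n} \<times> range gen"
  "tail (Gamma_fin n) = fst" "head (Gamma_fin n) (w, s) = s w"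
  by (auto simp: Gamma_fin_def schreier_graph_def basilica_gens_eq)

lemma wf_Gamma_fin: "wf_digraph (Gamma_fin n)"
  by unfold_locales auto

lemma wf_induce: "wf_digraph (Gamma_fin n \<restriction> A)"
  by (simp add: wf_digraph_def)

lemma nbr_induce:
  assumes "A \<subseteq> {w. length w = n}"
  shows "nbr (Gamma_fin n \<restriction> A) x y \<longleftrightarrow> x \<in> A \<and> y \<in> A \<and> (\<exists>\<sigma>. y = gen \<sigma> x \<or> x = gen \<sigma> y)"
  using assms by (auto simp: nbr_def induce_subgraph_def subset_iff)

section \<open>The component that carries the sandpile\<close>

text \<open>The vertices whose path to the root \<open>0\<close> arrives through the \<open>\<tau>\<close>-cycle.\<close>

definition Vset :: "nat \<Rightarrow> bool \<Rightarrow> bool list set" where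
  "Vset n \<tau> = {w. length w = n \<and> (nz w \<longrightarrow> lt w = \<tau>)}"

lemma zeros_iff: "w = zeros n \<longleftrightarrow> length w = n \<and> \<not> nz w"
  using nz_iff[of w n] by fastforce

lemma Vset_eq: "Vset n \<tau> = {w. length w = n \<and> nz w \<and> lt w = \<tau>} \<union> {zeros n}"
  unfolding Vset_def using zeros_iff by blast

lemma Vset_length: "w \<in> Vset n \<tau> \<Longrightarrow> length w = n"
  by (simp add: Vset_def)

lemma lt_gen: "nz w \<Longrightarrow> nz (gen \<sigma> w) \<Longrightarrow> lt (gen \<sigma> w) = lt w"
  by (metis base_gen lt_base lt_base_zero)

lemma gen_zero_lt: "nz w \<Longrightarrow> \<not> nz (gen \<sigma> w) \<Longrightarrow> lt w = \<sigma>"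
  by (metis base_gen base_zero lt_base_zero)

lemma nz_par_base_zero: "nz w \<Longrightarrow> \<not> nz (base (par w) w) \<Longrightarrow> lt w = par w"
  by (rule lt_base_zero)

text \<open>Walking down the parent cycles lowers \<open>val\<close>, so the walk ends next to the
  zero word, namely at position 1 of its cycle of type \<open>lt w\<close>.\<close>

lemma joined_root:
  assumes "nz w" "length w = n" "lt w = \<tau>"
  shows "(nbr (Gamma_fin n \<restriction> {w. length w = n \<and> nz w}))\<^sup>*\<^sup>* w (mk \<tau> (zeros n) 1)"
  using assms
proof (induction "val w" arbitrary: w rule: less_induct)
  case less
  show ?case
  proof (cases "nz (gen (par w) w)")
    case True
    have "nbr (Gamma_fin n \<restriction> {w. length w = n \<and> nz w}) w (gen (par w) w)"
      using less.prems True by (subst nbr_induce) auto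
    with less.hyps[OF val_gen_less True] less.prems lt_gen[OF _ True] show ?thesis
      by (auto intro: converse_rtranclp_into_rtranclp)
  next
    case False
    then have "gen (par w) w = zeros n" using nz_iff[of "gen (par w) w" n] less.prems by simp
    then have "w = genI (par w) (zeros n)" by (metis genI_gen)
    also have "\<dots> = mk (par w) (zeros n) 1" using genI_mk[of "par w" "zeros n" 0] by simp
    finally have "w = mk \<tau> (zeros n) 1" using gen_zero_lt[OF _ False] less.prems by simp
    then show ?thesis by simp
  qed
qed

lemma nbr_sym: "nbr G x y \<Longrightarrow> nbr G y x"
  by (auto simp: nbr_def)

lemma nbr_rtranclp_sym: "(nbr G)\<^sup>*\<^sup>* x y \<Longrightarrow> (nbr G)\<^sup>*\<^sup>* y x"
proof (induction rule: rtranclp_induct)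
  case (step y z)
  from nbr_sym[OF step(2)] step(3) show ?case by (rule converse_rtranclp_into_rtranclp)
qed simp

text \<open>\<open>lt\<close> is constant along edges that avoid the zero word, and each of its
  classes is connected through the vertex at position 1.\<close>

lemma H_graph_eq:
  assumes nz: "nz (stake n \<xi>)"
  shows "H_graph n \<xi> = Gamma_fin n \<restriction> Vset n (lt (stake n \<xi>))"
proof -
  define A where "A = {w. length w = n \<and> nz w}"
  have A: "verts (Gamma_fin n) - {zeros n} = A"
    by (auto simp: A_def nz_iff)
  define x where "x = stake n \<xi>"
  have x: "length x = n" "nz x" using nz by (auto simp: x_def)
  have A_sub: "A \<subseteq> {w. length w = n}" by (auto simp: A_def)
  have "joined (Gamma_fin n \<restriction> A) x w \<longleftrightarrow> w \<in> A \<and> lt w = lt x" for w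
  proof
    assume "joined (Gamma_fin n \<restriction> A) x w"
    then have "(nbr (Gamma_fin n \<restriction> A))\<^sup>*\<^sup>* x w" unfolding joined_iff[OF wf_induce] by simp
    then show "w \<in> A \<and> lt w = lt x"
    proof induction
      case (step y z)
      then have "y \<in> A" "z \<in> A" "\<exists>\<sigma>. z = gen \<sigma> y \<or> y = gen \<sigma> z" by (auto simp: nbr_induce[OF A_sub])
      then show ?case using step(3) lt_gen by (auto simp: A_def)
    qed (use x in \<open>auto simp: A_def\<close>)
  next
    assume w: "w \<in> A \<and> lt w = lt x"
    have "(nbr (Gamma_fin n \<restriction> A))\<^sup>*\<^sup>* x (mk (lt x) (zeros n) 1)"
      "(nbr (Gamma_fin n \<restriction> A))\<^sup>*\<^sup>* w (mk (lt x) (zeros n) 1)"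
      using joined_root[of x n] joined_root[of w n] x w by (auto simp: A_def)
    from this(1) nbr_rtranclp_sym[OF this(2)] have "(nbr (Gamma_fin n \<restriction> A))\<^sup>*\<^sup>* x w"
      by (rule rtranclp_trans)
    then show "joined (Gamma_fin n \<restriction> A) x w"
      using x unfolding joined_iff[OF wf_induce] by (simp add: A_def)
  qed
  then have "{w. joined (Gamma_fin n \<restriction> A) x w} = {w. length w = n \<and> nz w \<and> lt w = lt x}"
    by (simp add: A_def)
  then have "{w. joined (Gamma_fin n \<restriction> A) x w} \<union> {zeros n} = Vset n (lt x)"
    by (simp only: Vset_eq)
  then show ?thesis unfolding H_graph_def A x_def by simp
qed

section \<open>The cactus structure of a component\<close>

locale basilica_level =
  fixes n :: nat and \<tau> :: bool
begin

definition H :: "bool list basilica_graph" where "H = Gamma_fin n \<restriction> Vset n \<tau>"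

lemma verts_H [simp]: "verts H = Vset n \<tau>" by (simp add: H_def induce_subgraph_def)

lemma arcs_H: "(w, s) \<in> arcs H \<longleftrightarrow> w \<in> Vset n \<tau> \<and> (\<exists>\<sigma>. s = gen \<sigma> \<and> gen \<sigma> w \<in> Vset n \<tau>)"
  using Vset_length[of w n \<tau>] by (auto simp: H_def induce_subgraph_def)

lemma tail_head_H [simp]: "tail H = fst" "head H (w, s) = s w"
  by (auto simp: H_def induce_subgraph_def)

text \<open>The zero word is the base of cycles of both types; only the one of type
  \<open>\<tau>\<close> belongs to this component.\<close>

definition child :: "bool list \<Rightarrow> bool" where "child y = (if nz y then \<not> par y else \<tau>)"
definition up where "up w = base (par w) w"
definition cpos where "cpos w = pos (par w) w"
definition cyc where "cyc y i = mk (child y) y i"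
definition cl where "cl y = len (child y) y"

lemma V_iff: "w \<in> Vset n \<tau> - {zeros n} \<longleftrightarrow> length w = n \<and> nz w \<and> lt w = \<tau>"
  unfolding Vset_eq using zeros_iff by blast

lemma gen_Vset: "w \<in> Vset n \<tau> - {zeros n} \<Longrightarrow> gen \<sigma> w \<in> Vset n \<tau>"
  unfolding V_iff by (auto simp: Vset_def lt_gen)

lemma genI_Vset: "w \<in> Vset n \<tau> - {zeros n} \<Longrightarrow> genI \<sigma> w \<in> Vset n \<tau>"
  unfolding V_iff using lt_gen[of "genI \<sigma> w" \<sigma>] by (auto simp: Vset_def)

lemma child_up:
  assumes "w \<in> Vset n \<tau> - {zeros n}" shows "child (up w) = par w"
proof (cases "nz (up w)")
  case True
  then show ?thesis using base_nonzero_iff[of "up w" "par w"] by (auto simp: child_def up_def)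
next
  case False
  then have "lt w = par w" using nz_par_base_zero[of w] assms unfolding V_iff up_def by simp
  moreover have "lt w = \<tau>" using assms unfolding V_iff by simp
  ultimately show ?thesis using False unfolding child_def by (simp only: if_False)
qed

lemma base_child: "base (child y) y = y"
  by (auto simp: child_def base_not_par base_zero)

lemma cyc_props:
  assumes "y \<in> Vset n \<tau>" "0 < i" "i < cl y"
  shows "cyc y i \<in> Vset n \<tau> - {zeros n}" "par (cyc y i) = child y" "up (cyc y i) = y" "cpos (cyc y i) = i"
proof -
  define c where "c = cyc y i"
  have b: "base (child y) c = y" "pos (child y) c = i"
    using assms base_child by (auto simp: c_def cyc_def cl_def)
  have ne: "base (child y) c \<noteq> c"
  proof
    assume "base (child y) c = c"
    then have "pos (child y) c = 0" by (simp only: pos_eq_0_iff)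
    then show False using b(2) assms(2) by simp
  qed
  then have nz: "nz c" using base_zero by blast
  then have par: "par c = child y" using ne base_not_par[of c] by (metis (full_types))
  have len: "length c = n" using assms(1) by (simp add: c_def cyc_def Vset_def)
  have lt: "lt c = \<tau>"
  proof (cases "nz y")
    case True
    then have "lt y = lt c" using lt_base[of "child y" c] b(1) by simp
    then show ?thesis using True assms(1) by (simp add: Vset_def)
  next
    case False
    then show ?thesis using lt_base_zero[OF nz, of "child y"] b(1) by (simp add: child_def)
  qed
  show "cyc y i \<in> Vset n \<tau> - {zeros n}" "par (cyc y i) = child y" "up (cyc y i) = y" "cpos (cyc y i) = i"
    unfolding V_iff c_def[symmetric] using nz len lt par b by (auto simp: up_def cpos_def)
qed

lemma nbs_eq:
  assumes "w \<in> Vset n \<tau> - {zeros n}"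
  shows "cyc (up w) (Suc (cpos w)) = genI (par w) w" "cyc (up w) (cpos w - 1) = gen (par w) w"
    "cyc w 1 = genI (\<not> par w) w" "cyc w (cl w - 1) = gen (\<not> par w) w"
proof -
  have nz: "nz w" using assms unfolding V_iff by simp
  have "mk (par w) w (cpos w) = w" by (simp add: cpos_def)
  moreover have "cpos w \<noteq> 0" using nz pos_eq_0_iff base_eq_par_iff by (simp add: cpos_def)
  ultimately have "gen (par w) w = mk (par w) w (cpos w - 1)" "genI (par w) w = mk (par w) w (Suc (cpos w))"
    using gen_mk[of "par w" w "cpos w - 1"] genI_mk[of "par w" w "cpos w"] by simp_all
  then show "cyc (up w) (Suc (cpos w)) = genI (par w) w" "cyc (up w) (cpos w - 1) = gen (par w) w"
    unfolding cyc_def child_up[OF assms] by (simp_all add: up_def)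
  have child: "child w = (\<not> par w)" using nz by (simp add: child_def)
  have b: "mk (\<not> par w) w 0 = w" "mk (\<not> par w) w (len (\<not> par w) w) = w"
    using base_not_par[OF nz] by simp_all
  show "cyc w 1 = genI (\<not> par w) w" using genI_mk[of "\<not> par w" w 0] b by (simp add: cyc_def child)
  show "cyc w (cl w - 1) = gen (\<not> par w) w"
    using gen_mk[of "\<not> par w" w "cl w - 1"] b len_pos[of "\<not> par w" w] by (simp add: cyc_def child cl_def)
qed

lemma out_in_arcs:
  assumes "w \<in> Vset n \<tau> - {zeros n}"
  shows "out_arcs H w = (\<lambda>\<sigma>. (w, gen \<sigma>)) ` UNIV" "in_arcs H w = (\<lambda>\<sigma>. (genI \<sigma> w, gen \<sigma>)) ` UNIV"
proof -
  show "out_arcs H w = (\<lambda>\<sigma>. (w, gen \<sigma>)) ` UNIV"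
    using gen_Vset[OF assms] assms by (auto simp: out_arcs_def arcs_H)
  show "in_arcs H w = (\<lambda>\<sigma>. (genI \<sigma> w, gen \<sigma>)) ` UNIV"
  proof (rule Set.set_eqI)
    fix e :: "bool list \<times> (bool list \<Rightarrow> bool list)"
    obtain a s where e: "e = (a, s)" by (cases e)
    have "(a, s) \<in> in_arcs H w \<longleftrightarrow> (\<exists>\<sigma>. s = gen \<sigma> \<and> a = genI \<sigma> w)"
      using genI_Vset[OF assms] assms by (auto simp: in_arcs_def arcs_H)
    then show "e \<in> in_arcs H w \<longleftrightarrow> e \<in> (\<lambda>\<sigma>. (genI \<sigma> w, gen \<sigma>)) ` UNIV" unfolding e by auto
  qed
qed

lemma degree_eq_4: "w \<in> Vset n \<tau> - {zeros n} \<Longrightarrow> degree H w = 4"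
  unfolding degree_def in_degree_def out_degree_def out_in_arcs
  by (subst (1 2) card_image) (auto simp: inj_on_def)

lemma edge_mult_H:
  assumes "x \<in> Vset n \<tau> - {zeros n}" "w \<in> Vset n \<tau> - {zeros n}"
  shows "edge_mult H x w = count_list [genI (par x) x, gen (par x) x, genI (\<not> par x) x, gen (\<not> par x) x] w"
proof -
  have *: "card (out_arcs H x \<inter> in_arcs H w) = of_bool (gen True x = w) + of_bool (gen False x = w)"
    if "x \<in> Vset n \<tau> - {zeros n}" "w \<in> Vset n \<tau> - {zeros n}" for x w
  proof -
    have "out_arcs H x \<inter> in_arcs H w = (\<lambda>\<sigma>. (x, gen \<sigma>)) ` {\<sigma>. gen \<sigma> x = w}"
      unfolding out_in_arcs[OF that(1)] out_in_arcs[OF that(2)] by (auto simp: image_iff)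
    then have "card (out_arcs H x \<inter> in_arcs H w) = card {\<sigma>. gen \<sigma> x = w}"
      by (simp add: card_image inj_on_def)
    also have "{\<sigma>. gen \<sigma> x = w} = {\<sigma>. \<sigma> \<and> gen True x = w} \<union> {\<sigma>. \<not> \<sigma> \<and> gen False x = w}"
      by (auto, (metis (full_types))+)
    also have "card \<dots> = card {\<sigma>. \<sigma> \<and> gen True x = w} + card {\<sigma>. \<not> \<sigma> \<and> gen False x = w}"
      by (intro card_Un_disjoint) auto
    also have "{\<sigma>. \<sigma> \<and> gen True x = w} = (if gen True x = w then {True} else {})" by auto
    also have "{\<sigma>. \<not> \<sigma> \<and> gen False x = w} = (if gen False x = w then {False} else {})" by auto
    finally show ?thesis by (auto simp: of_bool_def)
  qed
  have "gen \<sigma> w = x \<longleftrightarrow> genI \<sigma> x = w" for \<sigma> by auto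
  then show ?thesis unfolding edge_mult_def *[OF assms] *[OF assms(2,1)]
    by (cases "par x") auto
qed

sublocale cactus H "zeros n" up cpos cyc cl val
proof
  show "finite (verts H)"
    by (rule finite_subset[OF _ finite_lists_length_eq[of UNIV n]]) (auto simp: Vset_def)
  show "zeros n \<in> verts H" by (simp add: Vset_def)
next
  fix x assume "x \<in> verts H - {zeros n}"
  then have x: "x \<in> Vset n \<tau> - {zeros n}" by simp
  then have nz: "nz x" "length x = n" "lt x = \<tau>" unfolding V_iff by auto
  show "up x \<in> verts H" using nz lt_base by (auto simp: Vset_def up_def)
  show "0 < cpos x" using nz pos_eq_0_iff base_eq_par_iff by (metis cpos_def gr0I)
  show "cpos x < cl (up x)" unfolding cl_def child_up[OF x] by (simp add: up_def cpos_def pos_less_len)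
  show "cyc (up x) (cpos x) = x" unfolding cyc_def child_up[OF x] by (simp add: up_def cpos_def)
  show "val (cyc (up x) (cpos x - 1)) < val x" unfolding nbs_eq[OF x] by (rule val_gen_less[OF nz(1)])
  show "degree H x = 4" by (rule degree_eq_4[OF x])
  fix w assume "w \<in> verts H - {zeros n}"
  then show "edge_mult H x w = count_list [cyc (up x) (Suc (cpos x)), cyc (up x) (cpos x - 1),
        cyc x 1, cyc x (cl x - 1)] w"
    unfolding nbs_eq[OF x] by (intro edge_mult_H[OF x]) simp
next
  fix y assume "y \<in> verts H"
  then have y: "y \<in> Vset n \<tau>" by simp
  show "0 < cl y" by (simp add: cl_def)
  show "cyc y 0 = y" "cyc y (cl y) = y" by (simp_all add: cyc_def cl_def base_child)
  fix i assume "0 < i" "i < cl y"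
  from cyc_props[OF y this]
  show "cyc y i \<in> verts H - {zeros n}" "up (cyc y i) = y" "cpos (cyc y i) = i" by simp_all
qed

lemma below_eq:
  assumes "x \<in> V" shows "below x = {y. desc x y}"
proof -
  have nzx: "nz x" "length x = n" using assms unfolding verts_H V_iff by auto
  have "desc x y" if "y \<in> below x" for y
    using that
  proof induction
    case (step y)
    have "nz y" using step(1) unfolding verts_H V_iff by simp
    then show ?case using desc_base_iff[of y x] step(3) desc_self[OF nzx(1)] by (cases "y = x") (auto simp: up_def)
  qed (rule desc_self[OF nzx(1)])
  moreover have "y \<in> below x" if "desc x y" for y
    using that
  proof (induction "val y" arbitrary: y rule: less_induct)
    case (less y)
    show ?case
    proof (cases "y = x")
      case False
      have nz: "nz y" "length y = n" using desc_nz[OF less.prems] desc_length[OF less.prems] nzx by auto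
      have "desc x (up y)" using desc_base_iff[OF nz(1) False] less.prems by (simp add: up_def)
      moreover have "val (up y) < val y" unfolding up_def
        by (rule val_base_less) (use nz base_eq_par_iff in blast)
      ultimately have up: "up y \<in> below x" using less.hyps by blast
      then have "up y \<in> V" using below_subset by blast
      then have "lt (up y) = \<tau>" "nz (up y)" unfolding verts_H V_iff by auto
      then have "lt y = \<tau>" using lt_base[of "par y" y] by (simp add: up_def)
      then have "y \<in> V" unfolding verts_H V_iff using nz by simp
      then show ?thesis using up by (rule below.step)
    qed (use assms below.refl in simp)
  qed
  ultimately show ?thesis by blast
qed

lemma card_below: "x \<in> V \<Longrightarrow> card (below x) = dsz (fo x)"
proof -
  assume x: "x \<in> V"
  then have "nz x" unfolding verts_H V_iff by simp
  then show ?thesis unfolding below_eq[OF x] by (rule card_desc)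
qed

end

section \<open>Independent cycle states along the path\<close>

lemma map_pmf_Pi_pmf_reindex:
  assumes "finite A" "inj_on h {..<r :: nat}" "h ` {..<r} \<subseteq> A"
  shows "map_pmf (\<lambda>z l. if l < r then z (h l) else d) (Pi_pmf A d p) = Pi_pmf {..<r} d (\<lambda>l. p (h l))"
  using assms
proof (induction r arbitrary: A)
  case 0
  have "(\<lambda>l. if l < (0 :: nat) then z (h l) else d) = (\<lambda>_. d)" for z by simp
  then show ?case by simp
next
  case (Suc r)
  define A' where "A' = A - {h r}"
  have A: "A = insert (h r) A'" "finite A'" "h r \<notin> A'" using Suc.prems by (auto simp: A'_def)
  have neq: "h l \<noteq> h r" if "l < r" for l using Suc.prems(2) that by (auto simp: inj_on_def)
  have IH: "map_pmf (\<lambda>z l. if l < r then z (h l) else d) (Pi_pmf A' d p) = Pi_pmf {..<r} d (\<lambda>l. p (h l))"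
  proof (rule Suc.IH)
    show "h ` {..<r} \<subseteq> A'" using Suc.prems(3) neq by (auto simp: A'_def)
    show "inj_on h {..<r}" using Suc.prems(2) by (rule inj_on_subset) auto
  qed fact
  have "map_pmf (\<lambda>z l. if l < Suc r then z (h l) else d) (Pi_pmf A d p) =
      map_pmf (\<lambda>(y, f). (\<lambda>l. if l < r then f (h l) else d)(r := y)) (pair_pmf (p (h r)) (Pi_pmf A' d p))"
    unfolding A(1) Pi_pmf_insert[OF A(2,3)] map_pmf_comp
    by (rule map_pmf_cong) (auto simp: fun_eq_iff neq less_Suc_eq)
  also have "\<dots> = map_pmf (\<lambda>(y, g). g(r := y)) (pair_pmf (p (h r)) (Pi_pmf {..<r} d (\<lambda>l. p (h l))))"
    unfolding IH[symmetric] pair_map_pmf2 map_pmf_comp by (rule map_pmf_cong) auto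
  also have "\<dots> = Pi_pmf {..<Suc r} d (\<lambda>l. p (h l))"
    unfolding lessThan_Suc by (subst Pi_pmf_insert) auto
  finally show ?case .
qed

definition unif :: "(nat \<Rightarrow> nat) \<Rightarrow> nat \<Rightarrow> (nat \<Rightarrow> nat) pmf" where
  "unif K r = Pi_pmf {..<r} 0 (\<lambda>l. pmf_of_set {..<K l})"

text \<open>The hypothesis says that \<open>P\<close> ignores coordinate \<open>r\<close>, so it is
  independent of the state of the last cycle.\<close>

lemma unif_Suc:
  assumes P: "\<And>Z y. P (Z(r := y)) \<longleftrightarrow> P Z"
  shows "measure_pmf.prob (unif K (Suc r)) {Z. P Z \<and> Z r \<in> B} =
    measure_pmf.prob (unif K r) {Z. P Z} * measure_pmf.prob (pmf_of_set {..<K r}) B"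
proof -
  let ?U = "pmf_of_set {..<K r}"
  have "unif K (Suc r) = map_pmf (\<lambda>(y, Z). Z(r := y)) (pair_pmf ?U (unif K r))"
    unfolding unif_def lessThan_Suc by (subst Pi_pmf_insert) auto
  then have "measure_pmf.prob (unif K (Suc r)) {Z. P Z \<and> Z r \<in> B} =
      measure_pmf.prob (pair_pmf ?U (unif K r)) ((\<lambda>(y, Z). Z(r := y)) -` {Z. P Z \<and> Z r \<in> B})"
    by simp
  also have "(\<lambda>(y, Z). Z(r := y)) -` {Z. P Z \<and> Z r \<in> B} = B \<times> {Z. P Z}"
    using P by auto
  \<comment> \<open>Cutting down to the supports makes both factors countable, as the product rule
    requires.\<close>
  also have "measure_pmf.prob (pair_pmf ?U (unif K r)) (B \<times> {Z. P Z}) =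
      measure_pmf.prob (pair_pmf ?U (unif K r)) ((B \<inter> set_pmf ?U) \<times> ({Z. P Z} \<inter> set_pmf (unif K r)))"
    by (rule measure_pmf.finite_measure_eq_AE) (auto simp: AE_measure_pmf_iff)
  also have "\<dots> = measure_pmf.prob ?U (B \<inter> set_pmf ?U) * measure_pmf.prob (unif K r) ({Z. P Z} \<inter> set_pmf (unif K r))"
    by (rule measure_pmf_prob_product) (auto intro: countable_subset[OF _ countable_set_pmf])
  finally show ?thesis by (simp add: measure_Int_set_pmf mult.commute)
qed

lemma prob_pmf_of_lessThan:
  "0 < K \<Longrightarrow> measure_pmf.prob (pmf_of_set {..<K :: nat}) B = card ({..<K} \<inter> B) / K"
  using measure_pmf_of_set[of "{..<K}" B] by (auto simp: lessThan_empty_iff)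

section \<open>Record positions\<close>

text \<open>If \<open>a\<close> is the \<open>j\<close>-th record, this is the \<open>j\<close>-th
  vertex on the path to the root: climbing erases everything before the record.\<close>

definition pre :: "bool stream \<Rightarrow> nat \<Rightarrow> nat \<Rightarrow> bool list" where
  "pre \<xi> a n = zeros a @ map ((!!) \<xi>) [a..<n]"

lemma length_pre [simp]: "a \<le> n \<Longrightarrow> length (pre \<xi> a n) = n"
  by (simp add: pre_def)

lemma pre_nth: "i < n \<Longrightarrow> a \<le> n \<Longrightarrow> pre \<xi> a n ! i = (a \<le> i \<and> \<xi> !! i)"
  by (auto simp: pre_def nth_append)

lemma pre_split:
  assumes "a \<le> b" "b < n" "\<xi> !! b"
  shows "pre \<xi> a n = pre \<xi> a b @ True # map ((!!) \<xi>) [Suc b..<n]"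
proof -
  have "[a..<n] = [a..<b] @ b # [Suc b..<n]"
    using assms upt_add_eq_append[of a b "n - b"] upt_conv_Cons[of b n] by simp
  then show ?thesis using assms(3) by (simp add: pre_def)
qed

lemma stake_eq_pre: "(\<And>i. i < a \<Longrightarrow> \<not> \<xi> !! i) \<Longrightarrow> a \<le> n \<Longrightarrow> stake n \<xi> = pre \<xi> a n"
  by (rule nth_equalityI) (auto simp: pre_nth not_less[symmetric])

lemma fo_zeros: "fo (zeros a @ True # s) = Suc a"
  by (induction a) auto

lemma fo_append: "nz w \<Longrightarrow> fo (w @ s) = fo w"
  by (induction w rule: fo.induct) auto

text \<open>Follows the recursion of \<open>base \<sigma>\<close>: letters read in type
  \<open>True\<close> are erased, a one read in type \<open>False\<close> ends the recursion. The
  predicate says that no letter of \<open>q\<close> ends it.\<close>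

fun free :: "bool \<Rightarrow> bool list \<Rightarrow> bool" where
  "free \<sigma> [] = True"
| "free True (x # q) = free False q"
| "free False (x # q) = (\<not> x \<and> free True q)"

lemma free_iff: "free \<sigma> q \<longleftrightarrow> (\<forall>i<length q. q ! i \<longrightarrow> even i = \<sigma>)"
proof (induction \<sigma> q rule: free.induct)
  case (2 x q)
  then show ?case by (auto simp: nth_Cons less_Suc_eq_0_disj split: nat.splits)
next
  case (3 x q)
  then show ?case by (auto simp: nth_Cons less_Suc_eq_0_disj split: nat.splits)
qed simp

text \<open>The parity condition makes the one behind \<open>q\<close> the first to be read in type
  \<open>False\<close>, so it ends the recursion and \<open>s\<close> stays untouched. The letters
  of \<open>q\<close> read in type \<open>True\<close>, half of them rounded up, are the free binary
  digits of the position.\<close>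

lemma first_hit:
  assumes "free \<sigma> q" "odd (length q) = \<sigma>"
  shows "base \<sigma> (q @ True # s) = zeros (length q) @ True # s"
    "len \<sigma> (q @ True # s) = 2 ^ ((length q + 1) div 2)"
    "pos \<sigma> (q @ True # s) = pos \<sigma> (q @ [True])"
    "mk \<sigma> (q @ True # s) i = mk \<sigma> (q @ [True]) i @ s"
    "nz (mk \<sigma> (q @ [True]) i)"
proof -
  have "base \<sigma> (q @ True # s) = zeros (length q) @ True # s \<and>
    len \<sigma> (q @ True # s) = 2 ^ ((length q + 1) div 2) \<and>
    pos \<sigma> (q @ True # s) = pos \<sigma> (q @ [True]) \<and>
    mk \<sigma> (q @ True # s) i = mk \<sigma> (q @ [True]) i @ s \<and> nz (mk \<sigma> (q @ [True]) i)"
    using assms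
  proof (induction \<sigma> q arbitrary: i rule: free.induct)
    case (1 \<sigma>)
    then show ?case by (cases \<sigma>) auto
  next
    case (2 x q)
    from 2(1)[of "i div 2"] 2(2,3) show ?case by auto
  next
    case (3 x q)
    from 3(1)[of i] 3(2,3) show ?case by (auto elim!: oddE)
  qed
  then show "base \<sigma> (q @ True # s) = zeros (length q) @ True # s"
    "len \<sigma> (q @ True # s) = 2 ^ ((length q + 1) div 2)"
    "pos \<sigma> (q @ True # s) = pos \<sigma> (q @ [True])"
    "mk \<sigma> (q @ True # s) i = mk \<sigma> (q @ [True]) i @ s"
    "nz (mk \<sigma> (q @ [True]) i)" by auto
qed

text \<open>If the position of the cut vertex is half the length of the cycle, then the next record follows
  immediately.\<close>

lemma two_pos_mod_len:
  "free \<sigma> q \<Longrightarrow> odd (length q) = \<sigma> \<Longrightarrow> nz q \<Longrightarrow> 2 * pos \<sigma> (q @ [True]) mod len \<sigma> (q @ [True]) = 0 \<Longrightarrow>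
    length q = fo q"
proof (induction \<sigma> q rule: free.induct)
  case (2 x q)
  have mod: "2 * a mod (2 * b) = 0 \<longleftrightarrow> a mod b = 0" for a b :: nat by simp
  have *: "(of_bool x + 2 * pos False (q @ [True])) mod len False (q @ [True]) = 0"
    using 2(5) unfolding append_Cons pos.simps len.simps mod .
  show ?case
  proof (cases x)
    case True
    have "len False (q @ [True]) = 2 ^ ((length q + 1) div 2)"
      by (rule first_hit(2)) (use 2 in auto)
    \<comment> \<open>With \<open>x\<close> true the dividend is odd, so the length is an odd power
      of two, hence 1.\<close>
    moreover have "odd (len False (q @ [True]))"
    proof
      assume "even (len False (q @ [True]))"
      then have "2 dvd of_bool x + 2 * pos False (q @ [True])" using * by (meson dvd_trans mod_eq_0_iff_dvd)
      then show False using True by simp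
    qed
    ultimately have "(length q + 1) div 2 = 0" by (cases "(length q + 1) div 2") auto
    then have "length q = 0" by presburger
    then show ?thesis using True by simp
  next
    case False
    then show ?thesis using 2(1) * 2(2-4) by auto
  qed
next
  case (3 x q)
  then show ?case by (cases "nz q") auto
qed simp

section \<open>The records and the data of their cycles\<close>

definition rich :: "bool stream \<Rightarrow> bool" where
  "rich \<xi> \<longleftrightarrow> (\<forall>r b. \<exists>i>r. \<xi> !! i \<and> even i = b)"

primrec spos :: "bool stream \<Rightarrow> nat \<Rightarrow> nat" where
  "spos \<xi> 0 = (LEAST i. \<xi> !! i)"
| "spos \<xi> (Suc j) = (LEAST i. spos \<xi> j < i \<and> \<xi> !! i \<and> even i \<noteq> even (spos \<xi> j))"

declare spos.simps [simp del]

text \<open>\<open>SK\<close>, \<open>SI\<close> and \<open>SD\<close> are the length, the entrance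
  and the subtree sizes of the \<open>j\<close>-th path cycle. The latter two are read off the
  shortest prefix that shows the next record; longer prefixes give the same values, which makes them
  independent of the level.\<close>

definition SK :: "bool stream \<Rightarrow> nat \<Rightarrow> nat" where "SK \<xi> j = 2 ^ ((spos \<xi> (Suc j) + 1) div 2)"
definition SI :: "bool stream \<Rightarrow> nat \<Rightarrow> nat" where
  "SI \<xi> j = pos (even (spos \<xi> j)) (pre \<xi> (spos \<xi> j) (Suc (spos \<xi> (Suc j))))"
definition SD :: "bool stream \<Rightarrow> nat \<Rightarrow> nat \<Rightarrow> nat" where
  "SD \<xi> j i = dsz (fo (mk (even (spos \<xi> j)) (pre \<xi> (spos \<xi> j) (Suc (spos \<xi> (Suc j)))) i))"

context
  fixes \<xi> assumes rich: "rich \<xi>"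
begin

lemma spos_Suc: "spos \<xi> j < spos \<xi> (Suc j)" "\<xi> !! spos \<xi> (Suc j)" "even (spos \<xi> (Suc j)) \<noteq> even (spos \<xi> j)"
proof -
  have "\<exists>i. spos \<xi> j < i \<and> \<xi> !! i \<and> even i \<noteq> even (spos \<xi> j)"
    using rich unfolding rich_def by (metis (full_types))
  from LeastI_ex[OF this] show "spos \<xi> j < spos \<xi> (Suc j)" "\<xi> !! spos \<xi> (Suc j)" "even (spos \<xi> (Suc j)) \<noteq> even (spos \<xi> j)"
    unfolding spos.simps by simp_all
qed

lemma spos_is_one: "\<xi> !! spos \<xi> j"
proof (cases j)
  case 0
  have "\<exists>i. \<xi> !! i" using rich unfolding rich_def by blast
  from LeastI_ex[OF this] show ?thesis using 0 by (simp add: spos.simps)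
qed (use spos_Suc(2) in simp)

lemma spos_between: "spos \<xi> j < i \<Longrightarrow> i < spos \<xi> (Suc j) \<Longrightarrow> \<xi> !! i \<Longrightarrow> even i = even (spos \<xi> j)"
  using not_less_Least[of i "\<lambda>i. spos \<xi> j < i \<and> \<xi> !! i \<and> even i \<noteq> even (spos \<xi> j)"]
  unfolding spos.simps by auto

lemma spos_mono: "strict_mono (spos \<xi>)"
  using spos_Suc(1) by (rule strict_monoI_Suc)

lemma le_spos: "j \<le> spos \<xi> j"
  using spos_mono by (rule strict_mono_imp_increasing)

lemma free_pre: "free (even (spos \<xi> j)) (pre \<xi> (spos \<xi> j) (spos \<xi> (Suc j)))"
  unfolding free_iff
proof (intro allI impI)
  have le: "spos \<xi> j \<le> spos \<xi> (Suc j)" using spos_Suc(1)[of j] by simp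
  fix i assume "i < length (pre \<xi> (spos \<xi> j) (spos \<xi> (Suc j)))" "pre \<xi> (spos \<xi> j) (spos \<xi> (Suc j)) ! i"
  then have "i < spos \<xi> (Suc j)" "spos \<xi> j \<le> i" "\<xi> !! i" using le by (auto simp: pre_nth)
  then show "even i = even (spos \<xi> j)" using spos_between[of j i] by (cases "i = spos \<xi> j") auto
qed

abbreviation seg :: "nat \<Rightarrow> bool list" where "seg j \<equiv> pre \<xi> (spos \<xi> j) (spos \<xi> (Suc j))"

lemma seg_split:
  assumes "spos \<xi> (Suc j) < n"
  shows "pre \<xi> (spos \<xi> j) n = seg j @ True # map ((!!) \<xi>) [Suc (spos \<xi> (Suc j))..<n]"
  using spos_Suc(1)[of j] assms spos_is_one[of "Suc j"] by (intro pre_split) auto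

lemma length_seg: "length (seg j) = spos \<xi> (Suc j)"
  using spos_Suc(1)[of j] by simp

lemma odd_length_seg: "odd (length (seg j)) = even (spos \<xi> j)"
  unfolding length_seg using spos_Suc(3)[of j] by simp

lemmas seg_hit = first_hit[OF free_pre odd_length_seg]

lemma pre_nz: "spos \<xi> j < n \<Longrightarrow> nz (pre \<xi> (spos \<xi> j) n)"
  using pre_split[of "spos \<xi> j" "spos \<xi> j" n \<xi>] spos_is_one[of j] by simp

lemma fo_pre: "spos \<xi> j < n \<Longrightarrow> fo (pre \<xi> (spos \<xi> j) n) = Suc (spos \<xi> j)"
  using pre_split[of "spos \<xi> j" "spos \<xi> j" n \<xi>] spos_is_one[of j] fo_zeros by (simp add: pre_def)

lemma par_pre: "spos \<xi> j < n \<Longrightarrow> par (pre \<xi> (spos \<xi> j) n) = even (spos \<xi> j)"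
  using par_eq_fo[OF pre_nz] fo_pre by simp

lemma pre_seg: "pre \<xi> (spos \<xi> j) (Suc (spos \<xi> (Suc j))) = seg j @ [True]"
  using seg_split[of j "Suc (spos \<xi> (Suc j))"] by simp

lemma level_base: "spos \<xi> (Suc j) < n \<Longrightarrow>
    base (even (spos \<xi> j)) (pre \<xi> (spos \<xi> j) n) = pre \<xi> (spos \<xi> (Suc j)) n"
  unfolding seg_split seg_hit(1) length_seg
  using pre_split[of "spos \<xi> (Suc j)" "spos \<xi> (Suc j)" n \<xi>] spos_is_one[of "Suc j"] by (simp add: pre_def)

lemma level_len: "spos \<xi> (Suc j) < n \<Longrightarrow> len (even (spos \<xi> j)) (pre \<xi> (spos \<xi> j) n) = SK \<xi> j"
  unfolding seg_split seg_hit(2) length_seg SK_def by simp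

lemma level_pos: "spos \<xi> (Suc j) < n \<Longrightarrow> pos (even (spos \<xi> j)) (pre \<xi> (spos \<xi> j) n) = SI \<xi> j"
  unfolding SI_def pre_seg unfolding seg_split by (rule seg_hit(3))

lemma level_SD: "spos \<xi> (Suc j) < n \<Longrightarrow> dsz (fo (mk (even (spos \<xi> j)) (pre \<xi> (spos \<xi> j) n) i)) = SD \<xi> j i"
  unfolding SD_def pre_seg unfolding seg_split seg_hit(4)[of j "map ((!!) \<xi>) _"] fo_append[OF seg_hit(5)] ..

lemma SI_less: "SI \<xi> j < SK \<xi> j" "0 < SI \<xi> j"
proof -
  let ?w = "pre \<xi> (spos \<xi> j) (Suc (spos \<xi> (Suc j)))"
  have lt: "spos \<xi> j < Suc (spos \<xi> (Suc j))" using spos_Suc(1)[of j] by simp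
  show "SI \<xi> j < SK \<xi> j"
    using pos_less_len[of "even (spos \<xi> j)" ?w] level_len[of j "Suc (spos \<xi> (Suc j))"] by (simp add: SI_def)
  have "pos (par ?w) ?w \<noteq> 0" using pos_eq_0_iff base_eq_par_iff pre_nz[OF lt] by simp
  then show "0 < SI \<xi> j" by (simp add: SI_def par_pre[OF lt])
qed

lemma two_SI: "spos \<xi> (Suc j) \<noteq> Suc (spos \<xi> j) \<Longrightarrow> 2 * SI \<xi> j mod SK \<xi> j \<noteq> 0"
proof
  assume neq: "spos \<xi> (Suc j) \<noteq> Suc (spos \<xi> j)" and "2 * SI \<xi> j mod SK \<xi> j = 0"
  then have "2 * pos (even (spos \<xi> j)) (seg j @ [True]) mod len (even (spos \<xi> j)) (seg j @ [True]) = 0"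
    using level_len[of j "Suc (spos \<xi> (Suc j))"] by (simp add: SI_def pre_seg)
  from two_pos_mod_len[OF free_pre odd_length_seg pre_nz[OF spos_Suc(1)] this]
  show False using fo_pre[OF spos_Suc(1), of j] neq by (simp add: length_seg)
qed

end

text \<open>The avalanche fires on cycle \<open>j\<close>, is absorbed on cycle
  \<open>j + 1\<close>, and the subtrees fired on cycle \<open>j\<close> have \<open>M\<close>
  vertices in total; stated without reference to a level.\<close>

definition stop_event :: "bool stream \<Rightarrow> nat \<Rightarrow> nat \<Rightarrow> (nat \<Rightarrow> nat) \<Rightarrow> bool" where
  "stop_event \<xi> j M Z \<longleftrightarrow> chips (SK \<xi>) (SI \<xi>) Z (Suc j) \<noteq> 0 \<and> chips (SK \<xi>) (SI \<xi>) Z (Suc (Suc j)) = 0 \<and>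
     (\<Sum>i | 0 < i \<and> i < SK \<xi> j \<and>
        0 < profile (chips (SK \<xi>) (SI \<xi>) Z j) (int (SK \<xi> j)) (int (SI \<xi> j)) (int (Z j)) (int i). SD \<xi> j i) = M"

section \<open>Transfer between a finite level and the records\<close>

locale rich_level = basilica_level n "lt (stake n \<xi>)" for n \<xi> +
  assumes rich: "rich \<xi>" and n_gt: "spos \<xi> 0 < n"
begin

lemma stake_eq: "stake n \<xi> = pre \<xi> (spos \<xi> 0) n"
proof (rule stake_eq_pre)
  show "\<not> \<xi> !! i" if "i < spos \<xi> 0" for i
    using not_less_Least[of i "(!!) \<xi>"] that by (simp add: spos.simps)
qed (use n_gt in simp)

lemma nz_stake: "nz (stake n \<xi>)"
  unfolding stake_eq by (rule pre_nz[OF rich n_gt])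

lemma stake_in_V: "stake n \<xi> \<in> V"
  unfolding verts_H V_iff using nz_stake by simp

lemma finite_states: "finite states" "states \<noteq> {}"
  unfolding states_def using finite_verts k_pos by (auto intro!: finite_PiE_dflt simp: lessThan_empty_iff)

lemma Rec_n_eq: "Rec_n \<xi> n = Rec"
  unfolding Rec_n_def H_graph_eq[OF nz_stake] H_def[symmetric]
  by (rule recurrent_configs_eq) (use stake_in_V in blast)

lemma path_axioms: "z \<in> states \<Longrightarrow> cactus_path H (zeros n) up cpos cyc cl val (stake n \<xi>) z"
  by unfold_locales (use stake_in_V in auto)

lemma pt_eq: "spos \<xi> j < n \<Longrightarrow> (up ^^ j) (stake n \<xi>) = pre \<xi> (spos \<xi> j) n"
proof (induction j)
  case (Suc j)
  have lt: "spos \<xi> j < n" using Suc.prems spos_Suc(1)[OF rich, of j] by linarith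
  show ?case using Suc.IH[OF lt] level_base[OF rich Suc.prems] par_pre[OF rich lt] by (simp add: up_def)
qed (simp add: stake_eq)

context
  fixes z assumes z: "z \<in> states"
begin

interpretation cactus_path H "zeros n" up cpos cyc cl val "stake n \<xi>" z
  by (rule path_axioms[OF z])

lemma level_pt: "spos \<xi> j < n \<Longrightarrow> pt j = pre \<xi> (spos \<xi> j) n"
  unfolding pt_def by (rule pt_eq)

lemma level_less_m: "spos \<xi> j < n \<Longrightarrow> j < m"
proof (rule ccontr)
  assume j: "spos \<xi> j < n" and "\<not> j < m"
  then have "spos \<xi> m < n" using spos_mono[OF rich] by (metis leD le_less_trans leI strict_mono_less_eq)
  then have "nz (pt m)" using level_pt pre_nz[OF rich] by simp
  then show False using pt_m by simp
qed

lemma level_card_below: "spos \<xi> j < n \<Longrightarrow> card (below (pt j)) = dsz (Suc (spos \<xi> j))"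
  using card_below[OF pt_in[OF level_less_m]] level_pt fo_pre[OF rich] by simp

lemma child_pt: "spos \<xi> (Suc j) < n \<Longrightarrow> child (pt (Suc j)) = even (spos \<xi> j)"
proof -
  assume *: "spos \<xi> (Suc j) < n"
  have lt: "spos \<xi> j < n" using * spos_Suc(1)[OF rich, of j] by linarith
  have "pt j \<in> V" using pt_in[OF level_less_m[OF lt]] .
  then have "child (up (pt j)) = par (pt j)" using child_up by simp
  then show ?thesis using par_pre[OF rich lt] level_pt[OF lt] by (simp add: pt_Suc)
qed

lemma level_Kj: "spos \<xi> (Suc j) < n \<Longrightarrow> Kj j = SK \<xi> j"
proof -
  assume *: "spos \<xi> (Suc j) < n"
  have "Kj j = len (child (pt (Suc j))) (pt (Suc j))" by (simp only: Kj_def cl_def)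
  also have "\<dots> = len (even (spos \<xi> j)) (pt (Suc j))" by (simp only: child_pt[OF *])
  also have "\<dots> = len (even (spos \<xi> j)) (base (even (spos \<xi> j)) (pre \<xi> (spos \<xi> j) n))"
    by (simp only: level_pt[OF *] level_base[OF rich *])
  also have "\<dots> = SK \<xi> j" by (simp only: len_base level_len[OF rich *])
  finally show ?thesis .
qed

lemma level_Ij: "spos \<xi> (Suc j) < n \<Longrightarrow> Ij j = SI \<xi> j"
proof -
  assume *: "spos \<xi> (Suc j) < n"
  then have lt: "spos \<xi> j < n" using spos_Suc(1)[OF rich, of j] by linarith
  show ?thesis using level_pos[OF rich *] by (simp add: Ij_def cpos_def level_pt[OF lt] par_pre[OF rich lt])
qed

lemma level_SD': "spos \<xi> (Suc j) < n \<Longrightarrow> 0 < i \<Longrightarrow> i < SK \<xi> j \<Longrightarrow> card (below (cyc (pt (Suc j)) i)) = SD \<xi> j i"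
proof -
  assume *: "spos \<xi> (Suc j) < n" and i: "0 < i" "i < SK \<xi> j"
  have k: "i < cl (pt (Suc j))" using i(2) level_Kj[OF *] unfolding Kj_def by simp
  have V: "cyc (pt (Suc j)) i \<in> V"
    by (rule cyc_in[OF pt_in_verts[OF less_imp_le[OF level_less_m[OF *]]] i(1) k])
  have "cyc (pt (Suc j)) i = mk (even (spos \<xi> j)) (pt (Suc j)) i"
    unfolding cyc_def child_pt[OF *] ..
  also have "\<dots> = mk (even (spos \<xi> j)) (pre \<xi> (spos \<xi> j) n) i"
    unfolding level_pt[OF *] level_base[OF rich *, symmetric] by simp
  finally show ?thesis using card_below[OF V] level_SD[OF rich *, of i] by simp
qed

lemma level_chips:
  assumes "spos \<xi> j < n" shows "Nj j = chips (SK \<xi>) (SI \<xi>) Zj j"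
  unfolding Nj_def
proof (rule chips_cong)
  fix l assume "l < j"
  then have "spos \<xi> (Suc l) < n" using assms spos_mono[OF rich] by (metis Suc_leI le_less_trans strict_mono_less_eq)
  then show "Kj l = SK \<xi> l \<and> Ij l = SI \<xi> l \<and> Zj l = Zj l" using level_Kj level_Ij by simp
qed

lemma level_mass_iff:
  assumes n: "spos \<xi> (Suc (Suc j)) < n" and M: "dsz (Suc (spos \<xi> j)) \<le> M" "M < dsz (Suc (spos \<xi> (Suc j)))"
  shows "mass = M \<longleftrightarrow> stop_event \<xi> j M Zj"
proof -
  have lt: "spos \<xi> (Suc j) < n" "spos \<xi> j < n"
    using n spos_Suc(1)[OF rich, of j] spos_Suc(1)[OF rich, of "Suc j"] by linarith+
  have "mj j = (\<Sum>i | 0 < i \<and> i < SK \<xi> j \<and>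
        0 < profile (chips (SK \<xi>) (SI \<xi>) Zj j) (int (SK \<xi> j)) (int (SI \<xi> j)) (int (Zj j)) (int i). SD \<xi> j i)"
    unfolding mj_def wj_def level_chips[OF lt(2)] level_Kj[OF lt(1)] level_Ij[OF lt(1)]
    by (rule sum.cong[OF HOL.refl], rule level_SD'[OF lt(1)]) simp_all
  moreover have "mass = M \<longleftrightarrow> Nj (Suc j) \<noteq> 0 \<and> Nj (Suc (Suc j)) = 0 \<and> mj j = M"
    by (rule mass_eq_iff[OF level_less_m[OF lt(1)]]) (simp_all only: level_card_below[OF lt(1)] level_card_below[OF lt(2)] M)
  ultimately show ?thesis by (simp only: stop_event_def level_chips[OF lt(1)] level_chips[OF n])
qed

lemma level_mass_eq_0_iff: "spos \<xi> 1 < n \<Longrightarrow> mass = 0 \<longleftrightarrow> chips (SK \<xi>) (SI \<xi>) Zj 1 = 0"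
  using mass_eq_0_iff level_chips[of 1] by simp

lemma level_mass_gap: "0 < M \<Longrightarrow> M < dsz (Suc (spos \<xi> 0)) \<Longrightarrow> mass \<noteq> M"
  using mass_less_card_v0 level_card_below[OF n_gt] by auto

lemma level_Zj: "Zj l = z ((up ^^ Suc l) (stake n \<xi>))"
  by (simp add: Zj_def pt_def)

lemma Mav_n_config: "Mav_n \<xi> n (config z) = mass"
  unfolding Mav_n_def H_graph_eq[OF nz_stake] H_def[symmetric] ..

end

text \<open>The bijection with cycle states turns the uniform measure on recurrent configurations
  into a product measure. The event reads only \<open>r\<close> coordinates, at distinct cycles of
  the path, so their joint law is again a product.\<close>

lemma Mav_prob_eq:
  assumes n: "spos \<xi> r < n"
    and Q: "\<And>z. z \<in> states \<Longrightarrow> Mav_n \<xi> n (config z) = M \<longleftrightarrow> Q (\<lambda>l. z ((up ^^ Suc l) (stake n \<xi>)))"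
    and Q_cong: "\<And>Z Z'. (\<And>l. l < r \<Longrightarrow> Z l = Z' l) \<Longrightarrow> Q Z = Q Z'"
  shows "Mav_prob \<xi> n M = measure_pmf.prob (unif (SK \<xi>) r) {Z. Q Z}"
proof -
  let ?h = "\<lambda>l. (up ^^ Suc l) (stake n \<xi>)"
  let ?g = "\<lambda>z l. if l < r then z (?h l) else (0 :: nat)"
  obtain z0 where z0: "z0 \<in> states" using finite_states by blast
  interpret path: cactus_path H "zeros n" up cpos cyc cl val "stake n \<xi>" z0
    by (rule path_axioms[OF z0])
  have pt: "path.pt (Suc l) = ?h l" for l by (simp only: path.pt_def)
  have rm: "r < path.m" by (rule level_less_m[OF z0 n])
  have Rec_pmf: "pmf_of_set Rec = map_pmf config (pmf_of_set states)"
    using bij_betw_config finite_states by (subst map_pmf_of_set_bij_betw) auto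
  have "Mav_prob \<xi> n M = measure_pmf.prob (pmf_of_set states) {z. Mav_n \<xi> n (config z) = M}"
    unfolding Mav_prob_def Rec_n_eq Rec_pmf by (simp add: vimage_def)
  also have "\<dots> = measure_pmf.prob (pmf_of_set states) (?g -` {Z. Q Z})"
  proof (rule measure_pmf.finite_measure_eq_AE)
    have "Mav_n \<xi> n (config z) = M \<longleftrightarrow> Q (?g z)" if "z \<in> states" for z
      unfolding Q[OF that] by (rule Q_cong) auto
    then show "AE z in pmf_of_set states. (z \<in> {z. Mav_n \<xi> n (config z) = M}) = (z \<in> ?g -` {Z. Q Z})"
      using finite_states by (simp add: AE_measure_pmf_iff)
  qed auto
  also have "\<dots> = measure_pmf.prob (map_pmf ?g (pmf_of_set states)) {Z. Q Z}" by simp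
  also have "pmf_of_set states = Pi_pmf (verts H) 0 (\<lambda>y. pmf_of_set {..<cl y})"
    unfolding states_def by (rule Pi_pmf_of_set[symmetric]) (use finite_verts k_pos in \<open>auto simp: lessThan_empty_iff\<close>)
  also have "map_pmf ?g \<dots> = Pi_pmf {..<r} 0 (\<lambda>l. pmf_of_set {..<cl (?h l)})"
  proof (rule map_pmf_Pi_pmf_reindex)
    show "finite (verts H)" by (rule finite_verts)
    show "inj_on ?h {..<r}"
    proof (rule inj_onI)
      fix x y assume "x \<in> {..<r}" "y \<in> {..<r}" "?h x = ?h y"
      then show "x = y" using path.pt_inj[of "Suc x" "Suc y"] rm unfolding pt by simp
    qed
    show "?h ` {..<r} \<subseteq> verts H"
    proof
      fix y assume "y \<in> ?h ` {..<r}"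
      then obtain l where "l < r" "y = ?h l" by blast
      then show "y \<in> verts H" using path.pt_in_verts[of "Suc l"] rm unfolding pt by simp
    qed
  qed
  also have "\<dots> = unif (SK \<xi>) r"
    unfolding unif_def
  proof (rule Pi_pmf_cong)
    fix l assume "l \<in> {..<r}"
    then have "spos \<xi> (Suc l) < n" using n spos_mono[OF rich] by (metis Suc_leI le_less_trans lessThan_iff strict_mono_less_eq)
    from level_Kj[OF z0 this] show "pmf_of_set {..<cl (?h l)} = pmf_of_set {..<SK \<xi> l}"
      by (simp only: path.Kj_def pt)
  qed simp_all
  finally show ?thesis .
qed

lemma Mav_prob_0:
  assumes "spos \<xi> 1 < n"
  shows "Mav_prob \<xi> n 0 = measure_pmf.prob (unif (SK \<xi>) 1) {Z. chips (SK \<xi>) (SI \<xi>) Z 1 = 0}"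
  by (rule Mav_prob_eq[OF assms]) (simp_all add: Mav_n_config level_mass_eq_0_iff[OF _ assms] level_Zj)

lemma Mav_prob_gap:
  assumes "0 < M" "M < dsz (Suc (spos \<xi> 0))"
  shows "Mav_prob \<xi> n M = 0"
  using Mav_prob_eq[OF n_gt, of M "\<lambda>_. False"] level_mass_gap[OF _ assms] by (simp add: Mav_n_config)

lemma Mav_prob_pos:
  assumes n: "spos \<xi> (Suc (Suc j)) < n" and M: "dsz (Suc (spos \<xi> j)) \<le> M" "M < dsz (Suc (spos \<xi> (Suc j)))"
  shows "Mav_prob \<xi> n M = measure_pmf.prob (unif (SK \<xi>) (Suc (Suc j))) {Z. stop_event \<xi> j M Z}"
proof (rule Mav_prob_eq[OF n])
  show "Mav_n \<xi> n (config z) = M \<longleftrightarrow> stop_event \<xi> j M (\<lambda>l. z ((up ^^ Suc l) (stake n \<xi>)))" if "z \<in> states" for z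
  proof -
    have "cactus_path.Zj up (stake n \<xi>) z = (\<lambda>l. z ((up ^^ Suc l) (stake n \<xi>)))"
      by (rule ext) (rule level_Zj[OF that])
    then show ?thesis using level_mass_iff[OF that n M] by (simp only: Mav_n_config[OF that])
  qed
  show "stop_event \<xi> j M Z = stop_event \<xi> j M Z'" if "\<And>l. l < Suc (Suc j) \<Longrightarrow> Z l = Z' l" for Z Z'
  proof -
    have c: "l \<le> Suc (Suc j) \<Longrightarrow> chips (SK \<xi>) (SI \<xi>) Z l = chips (SK \<xi>) (SI \<xi>) Z' l" for l
      by (rule chips_cong) (simp add: that)
    have "chips (SK \<xi>) (SI \<xi>) Z (Suc (Suc j)) = chips (SK \<xi>) (SI \<xi>) Z' (Suc (Suc j))"
      "chips (SK \<xi>) (SI \<xi>) Z (Suc j) = chips (SK \<xi>) (SI \<xi>) Z' (Suc j)"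
      "chips (SK \<xi>) (SI \<xi>) Z j = chips (SK \<xi>) (SI \<xi>) Z' j" "Z j = Z' j"
      by (rule c; simp)+ (simp add: that)
    then show ?thesis by (simp only: stop_event_def)
  qed
qed

lemma realized_stop_event:
  assumes n: "spos \<xi> (Suc (Suc j)) < n" and M: "dsz (Suc (spos \<xi> j)) \<le> M" "M < dsz (Suc (spos \<xi> (Suc j)))"
    and c: "c \<in> Rec_n \<xi> n" "Mav_n \<xi> n c = M"
  obtains Z where "stop_event \<xi> j M Z" "Z j < SK \<xi> j"
proof -
  obtain z where z: "z \<in> states" "c = config z" using c(1) Rec_config unfolding Rec_n_eq by blast
  interpret path: cactus_path H "zeros n" up cpos cyc cl val "stake n \<xi>" z
    by (rule path_axioms[OF z(1)])
  have lt: "spos \<xi> (Suc j) < n" "spos \<xi> j < n"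
    using n spos_Suc(1)[OF rich, of j] spos_Suc(1)[OF rich, of "Suc j"] by linarith+
  have "path.Zj j < SK \<xi> j"
    using path.IK(3)[OF level_less_m[OF z(1) lt(2)]] unfolding level_Kj[OF z(1) lt(1)] .
  moreover have "stop_event \<xi> j M path.Zj"
    using c(2) unfolding z(2) Mav_n_config[OF z(1)] level_mass_iff[OF z(1) n M] .
  ultimately show ?thesis by (rule that[rotated])
qed

end

section \<open>The limiting mass distribution\<close>

lemma chips_upd: "i \<le> j \<Longrightarrow> chips K I (Z(j := y)) i = chips K I Z i"
  by (rule chips_cong) auto

declare chips.simps(2) [simp del]

lemma dsz_pos: "0 < dsz (Suc t)"
  using three_dsz[of t] by (cases "dsz (Suc t)") auto

lemma dsz_le: "dsz (Suc t) \<le> 2 ^ Suc t"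
proof -
  have "3 * dsz (Suc t) \<le> 2 ^ Suc t + 2" using three_dsz[of t] by auto
  moreover have "(2 :: nat) \<le> 2 ^ Suc t" by simp
  ultimately show ?thesis by linarith
qed

lemma dsz_ge: "2 ^ Suc t \<le> 3 * dsz (Suc t)"
  using three_dsz[of t] by simp

context
  fixes \<xi> assumes rich: "rich \<xi>"
begin

abbreviation ch where "ch \<equiv> chips (SK \<xi>) (SI \<xi>)"
abbreviation pr where "pr j \<equiv> measure_pmf.prob (unif (SK \<xi>) j)"

lemma SKp: "0 < SK \<xi> j" by (simp add: SK_def)

lemma SI_mod: "SI \<xi> j mod SK \<xi> j = SI \<xi> j" "2 * SI \<xi> j mod SK \<xi> j \<noteq> SI \<xi> j"
proof -
  note I = SI_less[OF rich, of j]
  show "SI \<xi> j mod SK \<xi> j = SI \<xi> j" using I by simp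
  show "2 * SI \<xi> j mod SK \<xi> j \<noteq> SI \<xi> j"
  proof (cases "2 * SI \<xi> j < SK \<xi> j")
    case False
    then have "2 * SI \<xi> j mod SK \<xi> j = 2 * SI \<xi> j - SK \<xi> j" using I by (simp add: mod_if)
    then show ?thesis using I by simp
  qed (use I in simp)
qed

section \<open>Persistence of a single chip\<close>

lemma ch_Suc_eq_1_iff:
  "ch Z (Suc j) = 1 \<longleftrightarrow> ch Z j = 1 \<and> Z j \<noteq> 0 \<and> Z j \<noteq> SI \<xi> j \<or>
     ch Z j = 2 \<and> Z j \<noteq> 0 \<and> Z j = 2 * SI \<xi> j mod SK \<xi> j"
proof -
  have I: "0 < SI \<xi> j" by (rule SI_less(2)[OF rich])
  consider "ch Z j = 0" | "ch Z j = 1" | "ch Z j = 2" | "3 \<le> ch Z j" by linarith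
  then show ?thesis
  proof cases
    case 2
    then show ?thesis using I SI_mod(1)[of j] by (auto simp: chips.simps(2) of_bool_def)
  next
    case 3
    then show ?thesis by (auto simp: chips.simps(2) of_bool_def)
  next
    case 4
    then have "2 \<le> ch Z (Suc j)" by (auto simp: chips.simps(2) of_bool_def)
    then show ?thesis using 4 by auto
  qed (auto simp: chips.simps(2))
qed

lemma pr_ch_step:
  "pr (Suc j) {Z. ch Z j = s \<and> Z j \<in> B} = pr j {Z. ch Z j = s} * (card ({..<SK \<xi> j} \<inter> B) / SK \<xi> j)"
  by (subst unif_Suc) (simp_all add: chips_upd prob_pmf_of_lessThan[OF SKp] del: times_divide_eq_right)

lemma pr_1_step: "pr j {Z. ch Z j = 1} * (1 - 2 / SK \<xi> j) \<le> pr (Suc j) {Z. ch Z (Suc j) = 1}"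
proof -
  have "SK \<xi> j - 2 \<le> card ({..<SK \<xi> j} - {0, SI \<xi> j})"
    using diff_card_le_card_Diff[of "{0, SI \<xi> j}" "{..<SK \<xi> j}"] SI_less(2)[OF rich, of j] by simp
  then have "real (SK \<xi> j) - 2 \<le> card ({..<SK \<xi> j} \<inter> - {0, SI \<xi> j})"
    unfolding Diff_eq[symmetric] by linarith
  then have "1 - 2 / real (SK \<xi> j) \<le> card ({..<SK \<xi> j} \<inter> - {0, SI \<xi> j}) / SK \<xi> j"
    using SKp[of j] by (simp add: divide_simps)
  then have "pr j {Z. ch Z j = 1} * (1 - 2 / SK \<xi> j) \<le> pr (Suc j) {Z. ch Z j = 1 \<and> Z j \<in> - {0, SI \<xi> j}}"
    unfolding pr_ch_step by (intro mult_left_mono) auto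
  also have "\<dots> \<le> pr (Suc j) {Z. ch Z (Suc j) = 1}"
    by (rule measure_pmf.finite_measure_mono) (auto simp: ch_Suc_eq_1_iff[unfolded One_nat_def])
  finally show ?thesis .
qed

lemma pr_ch_step_pos:
  assumes "0 < pr j {Z. ch Z j = s}" "x < SK \<xi> j" "\<And>Z. ch Z j = s \<Longrightarrow> Z j = x \<Longrightarrow> ch Z (Suc j) = s'"
  shows "0 < pr (Suc j) {Z. ch Z (Suc j) = s'}"
proof -
  have "0 < pr (Suc j) {Z. ch Z j = s \<and> Z j \<in> {x}}"
    unfolding pr_ch_step using assms(1,2) SKp[of j] by (auto simp: Int_insert_right)
  also have "\<dots> \<le> pr (Suc j) {Z. ch Z (Suc j) = s'}"
    by (rule measure_pmf.finite_measure_mono) (use assms(3) in auto)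
  finally show ?thesis .
qed

text \<open>State 0 of the first cycle doubles the chip. Afterwards the state \<open>SI\<close>
  preserves two chips, being neither 0 nor \<open>2 * SI mod SK\<close>; this works on cycles of
  length 2 as well, where a single chip cannot persist.\<close>

lemma pr_2_pos: "0 < pr (Suc j) {Z. ch Z (Suc j) = 2}"
proof (induction j)
  case 0
  show ?case
    by (rule pr_ch_step_pos[where s = 1 and x = 0])
      (use SKp SI_less[OF rich, of 0] in \<open>auto simp: chips.simps(2) of_bool_def\<close>)
next
  case (Suc j)
  show ?case
    by (rule pr_ch_step_pos[OF Suc, where x = "SI \<xi> (Suc j)"])
      (use SI_less[OF rich, of "Suc j"] SI_mod(2)[of "Suc j"] in
        \<open>auto simp: chips.simps(2)[of _ _ _ "Suc j"] of_bool_def\<close>)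
qed

text \<open>Two chips become one in the state \<open>2 * SI mod SK\<close>, provided that it is not
  0; a gap between the two records guarantees this.\<close>

lemma pr_1_pos:
  assumes "spos \<xi> (Suc (Suc j)) \<noteq> Suc (spos \<xi> (Suc j))"
  shows "0 < pr (Suc (Suc j)) {Z. ch Z (Suc (Suc j)) = 1}"
  by (rule pr_ch_step_pos[OF pr_2_pos, where x = "2 * SI \<xi> (Suc j) mod SK \<xi> (Suc j)"])
    (use SKp[of "Suc j"] two_SI[OF rich assms] in \<open>auto simp: ch_Suc_eq_1_iff[unfolded One_nat_def]\<close>)

lemma SK_ge: "sqrt 2 ^ j \<le> SK \<xi> j"
proof -
  have "sqrt 2 ^ j \<le> sqrt 2 ^ (2 * ((spos \<xi> (Suc j) + 1) div 2))"
    by (rule power_increasing) (use le_spos[OF rich, of "Suc j"] in \<open>presburger, simp\<close>)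
  also have "\<dots> = SK \<xi> j" by (simp add: SK_def power_mult)
  finally show ?thesis .
qed

text \<open>The loss rates \<open>2 / SK\<close> are summable, as the lengths grow geometrically.
  From an index on where the remaining losses sum to less than 1/2 and the probability is positive,
  a product of factors \<open>1 - a\<close> is at least 1 minus the sum of the
  \<open>a\<close>.\<close>

lemma pr_1_bounded_below:
  assumes gaps: "\<And>J. \<exists>j\<ge>J. spos \<xi> (Suc j) \<noteq> Suc (spos \<xi> j)"
  shows "\<exists>c>0. \<exists>J. \<forall>j\<ge>J. c \<le> pr j {Z. ch Z j = 1}"
proof -
  define a where "a = (\<lambda>l. 2 / real (SK \<xi> l))"
  have a_nonneg: "0 \<le> a l" for l by (simp add: a_def)
  have "summable (\<lambda>l. 2 * (1 / sqrt 2) ^ l)"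
    by (intro summable_mult summable_geometric) simp
  then have "summable a"
  proof (rule summable_comparison_test'[where N = 0])
    fix l
    have "0 < sqrt 2 ^ l" by simp
    then have "2 / real (SK \<xi> l) \<le> 2 / sqrt 2 ^ l" using SK_ge[of l] SKp[of l] by (intro divide_left_mono) auto
    then show "norm (a l) \<le> 2 * (1 / sqrt 2) ^ l" by (simp add: a_def power_divide)
  qed
  then obtain L where L: "\<And>n. n \<ge> L \<Longrightarrow> norm (\<Sum>i. a (i + n)) < 1 / 2"
    using suminf_exist_split[of "1/2" a] by auto
  have part: "(\<Sum>i<d. a (i + n)) < 1 / 2" if "n \<ge> L" for d n
  proof -
    have "(\<Sum>i<d. a (i + n)) \<le> (\<Sum>i. a (i + n))"
      using \<open>summable a\<close> a_nonneg by (intro sum_le_suminf) (auto simp: summable_iff_shift)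
    then show ?thesis using L[OF that] by simp
  qed
  obtain j where j: "j \<ge> Suc L" "spos \<xi> (Suc j) \<noteq> Suc (spos \<xi> j)" using gaps by blast
  define J where "J = Suc j"
  have JL: "J \<ge> L" using j by (simp add: J_def)
  have pos: "0 < pr J {Z. ch Z J = 1}"
    using pr_1_pos[of "j - 1"] j by (cases j) (auto simp: J_def)
  have "pr J {Z. ch Z J = 1} * (1 - (\<Sum>i<d. a (i + J))) \<le> pr (d + J) {Z. ch Z (d + J) = 1}" for d
  proof (induction d)
    case (Suc d)
    have a1: "0 \<le> 1 - a (d + J)" using part[of "d + J" 1] JL by simp
    have S: "0 \<le> (\<Sum>i<d. a (i + J))" using a_nonneg by (intro sum_nonneg)
    have "pr J {Z. ch Z J = 1} * (1 - (\<Sum>i<Suc d. a (i + J)))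
        \<le> pr J {Z. ch Z J = 1} * ((1 - (\<Sum>i<d. a (i + J))) * (1 - a (d + J)))"
      using mult_nonneg_nonneg[OF S a_nonneg[of "d + J"]]
      by (intro mult_left_mono) (auto simp: algebra_simps)
    also have "\<dots> \<le> pr (d + J) {Z. ch Z (d + J) = 1} * (1 - a (d + J))"
      using mult_right_mono[OF Suc a1] by (simp add: mult.assoc)
    also have "\<dots> \<le> pr (Suc (d + J)) {Z. ch Z (Suc (d + J)) = 1}"
      unfolding a_def by (rule pr_1_step)
    finally show ?case by simp
  qed simp
  moreover have "pr J {Z. ch Z J = 1} * (1 / 2) \<le> pr J {Z. ch Z J = 1} * (1 - (\<Sum>i<d. a (i + J)))" for d
    using part[OF JL, of d] by (intro mult_left_mono) auto
  ultimately have "pr J {Z. ch Z J = 1} * (1 / 2) \<le> pr (d + J) {Z. ch Z (d + J) = 1}" for d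
    by (meson order_trans)
  then have "pr J {Z. ch Z J = 1} / 2 \<le> pr j {Z. ch Z j = 1}" if "j \<ge> J" for j
    using that le_Suc_ex[OF that] by (auto simp: add.commute)
  then show ?thesis using pos by (intro exI[of _ "pr J {Z. ch Z J = 1} / 2"]) auto
qed

section \<open>States that produce a given mass\<close>

definition tsum :: "nat \<Rightarrow> nat \<Rightarrow> nat" where
  "tsum j z = (\<Sum>i | 0 < i \<and> i < SK \<xi> j \<and> 0 < tent (int (SK \<xi> j)) (int (SI \<xi> j)) (int z) (int i). SD \<xi> j i)"

definition stops :: "nat \<Rightarrow> nat \<Rightarrow> nat set" where
  "stops j M = {z. z < SK \<xi> j \<and> z \<noteq> 0 \<and> z \<noteq> SI \<xi> j \<and> tsum j z = M}"

lemma SD_pos: "0 < SD \<xi> j i"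
proof -
  have "0 < fo (mk (even (spos \<xi> j)) (seg \<xi> j @ [True]) i)"
    by (rule fo_pos[OF seg_hit(5)[OF rich]])
  then show ?thesis unfolding SD_def pre_seg[OF rich] using dsz_pos
    by (cases "fo (mk (even (spos \<xi> j)) (seg \<xi> j @ [True]) i)") auto
qed

lemma tsum_eq:
  assumes "z < SK \<xi> j"
  shows "z < SI \<xi> j \<Longrightarrow> tsum j z = (\<Sum>i\<in>{z<..<SK \<xi> j}. SD \<xi> j i)"
    "SI \<xi> j < z \<Longrightarrow> tsum j z = (\<Sum>i\<in>{0<..<z}. SD \<xi> j i)"
  unfolding tsum_def
  by (rule sum.cong; use assms SI_less[OF rich, of j] in \<open>auto simp: tent_pos_iff\<close>)+

text \<open>On either side of the entrance the fired segment grows strictly as the special position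
  moves away from it, and every subtree is nonempty. So each side contributes at most one
  state.\<close>

lemma card_stops: "finite (stops j M)" "card (stops j M) \<le> 2"
proof -
  define A B where "A = {z \<in> stops j M. z < SI \<xi> j}" and "B = {z \<in> stops j M. SI \<xi> j < z}"
  have fin: "finite (stops j M)" by (rule finite_subset[of _ "{..<SK \<xi> j}"]) (auto simp: stops_def)
  have "\<not> z < z'" if "z \<in> A" "z' \<in> A" for z z'
  proof
    assume "z < z'"
    have *: "z' < SK \<xi> j" "z < SK \<xi> j" "z' < SI \<xi> j" "z < SI \<xi> j" using that by (auto simp: A_def stops_def)
    have "tsum j z' < tsum j z"
      unfolding tsum_eq(1)[OF *(1,3)] tsum_eq(1)[OF *(2,4)]
      by (rule sum_strict_mono2[where b = z']) (use \<open>z < z'\<close> *(1) SD_pos in auto)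
    then show False using that by (auto simp: A_def stops_def)
  qed
  then have "card A \<le> Suc 0" using fin
    by (subst card_le_Suc0_iff_eq) (auto simp: A_def, metis linorder_neqE_nat)
  have "\<not> z < z'" if "z \<in> B" "z' \<in> B" for z z'
  proof
    assume "z < z'"
    have *: "z' < SK \<xi> j" "z < SK \<xi> j" "SI \<xi> j < z'" "SI \<xi> j < z" using that by (auto simp: B_def stops_def)
    have "tsum j z < tsum j z'"
      unfolding tsum_eq(2)[OF *(1,3)] tsum_eq(2)[OF *(2,4)]
      by (rule sum_strict_mono2[where b = z]) (use \<open>z < z'\<close> *(4) SD_pos in auto)
    then show False using that by (auto simp: B_def stops_def)
  qed
  then have "card B \<le> Suc 0" using fin
    by (subst card_le_Suc0_iff_eq) (auto simp: B_def, metis linorder_neqE_nat)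
  have "stops j M = A \<union> B" by (auto simp: A_def B_def stops_def)
  then show "finite (stops j M)" "card (stops j M) \<le> 2"
    using fin card_Un_le[of A B] \<open>card A \<le> Suc 0\<close> \<open>card B \<le> Suc 0\<close> by auto
qed

lemma ch_stop_iff:
  "ch Z (Suc j) \<noteq> 0 \<and> ch Z (Suc (Suc j)) = 0 \<longleftrightarrow> ch Z (Suc j) = 1 \<and> Z (Suc j) = SI \<xi> (Suc j)"
  using chips_Suc_eq_0_iff[of "SI \<xi>" "Suc j" "SK \<xi>" Z, OF SI_less(2,1)[OF rich]] by auto

text \<open>A single outgoing chip may also stem from two incoming ones. Then the second finds the
  special position at the entrance and fires nothing, so the profile is again that of one
  chip.\<close>

lemma stop_event_stops:
  assumes "stop_event \<xi> j M Z" "Z j < SK \<xi> j"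
  shows "Z (Suc j) = SI \<xi> (Suc j) \<and> Z j \<in> stops j M"
proof -
  let ?N = "ch Z j" and ?K = "int (SK \<xi> j)" and ?I = "int (SI \<xi> j)"
  have 1: "ch Z (Suc j) = 1" "Z (Suc j) = SI \<xi> (Suc j)" and
    sum: "(\<Sum>i | 0 < i \<and> i < SK \<xi> j \<and> 0 < profile ?N ?K ?I (int (Z j)) (int i). SD \<xi> j i) = M"
    using assms(1) ch_stop_iff unfolding stop_event_def by auto
  have I: "0 < ?I" "?I < ?K" "0 \<le> int (Z j)" "int (Z j) < ?K" using SI_less[OF rich, of j] assms(2) by auto
  consider "?N = 1" "Z j \<noteq> 0" "Z j \<noteq> SI \<xi> j" | "?N = 2" "Z j \<noteq> 0" "Z j = 2 * SI \<xi> j mod SK \<xi> j"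
    using 1(1) unfolding ch_Suc_eq_1_iff by blast
  then have "Z j \<noteq> 0 \<and> Z j \<noteq> SI \<xi> j \<and> (\<forall>x. profile ?N ?K ?I (int (Z j)) x = tent ?K ?I (int (Z j)) x)"
  proof cases
    case 1
    then show ?thesis using profile_1_eq_tent[OF I] by simp
  next
    case 2
    have "(int (Z j) - ?I) mod ?K = (2 * ?I - ?I) mod ?K"
      unfolding 2(3) by (simp add: of_nat_mod mod_diff_left_eq)
    then have "(int (Z j) - ?I) mod ?K = ?I" using I by simp
    moreover have "{..<2 :: nat} = {0, 1}" by auto
    ultimately have "profile 2 ?K ?I (int (Z j)) x = tent ?K ?I (int (Z j)) x" for x
      using I by (simp add: profile_def tent_def)
    then show ?thesis using 2 SI_mod(2) by simp
  qed
  then show ?thesis using 1(2) sum assms(2) by (simp add: stops_def tsum_def)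
qed

lemma stops_stop_event:
  assumes "ch Z j = 1" "Z j \<in> stops j M" "Z (Suc j) = SI \<xi> (Suc j)"
  shows "stop_event \<xi> j M Z"
proof -
  have z: "Z j < SK \<xi> j" "Z j \<noteq> 0" "Z j \<noteq> SI \<xi> j" "tsum j (Z j) = M" using assms(2) by (auto simp: stops_def)
  have "ch Z (Suc j) = 1" unfolding ch_Suc_eq_1_iff using assms(1) z by simp
  moreover from this have "ch Z (Suc j) \<noteq> 0 \<and> ch Z (Suc (Suc j)) = 0" unfolding ch_stop_iff using assms(3) by simp
  moreover have "profile (ch Z j) (int (SK \<xi> j)) (int (SI \<xi> j)) (int (Z j)) x = tent (int (SK \<xi> j)) (int (SI \<xi> j)) (int (Z j)) x" for x
    unfolding assms(1) using profile_1_eq_tent[of "int (SI \<xi> j)" "int (SK \<xi> j)" "int (Z j)"] SI_less[OF rich, of j] z(1) by simp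
  ultimately show ?thesis using z(4) unfolding stop_event_def tsum_def by simp
qed

lemma pr_stop_event_le: "pr (Suc (Suc j)) {Z. stop_event \<xi> j M Z} \<le> 2 / (SK \<xi> j * SK \<xi> (Suc j))"
proof -
  let ?B = "{z. z < SK \<xi> j \<longrightarrow> z \<in> stops j M}"
  have "pr (Suc (Suc j)) {Z. stop_event \<xi> j M Z} \<le> pr (Suc (Suc j)) {Z. (True \<and> Z j \<in> ?B) \<and> Z (Suc j) \<in> {SI \<xi> (Suc j)}}"
  proof (rule measure_pmf.finite_measure_mono)
    show "{Z. stop_event \<xi> j M Z} \<subseteq> {Z. (True \<and> Z j \<in> ?B) \<and> Z (Suc j) \<in> {SI \<xi> (Suc j)}}"
    proof
      fix Z assume "Z \<in> {Z. stop_event \<xi> j M Z}"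
      then have Z: "stop_event \<xi> j M Z" by simp
      then have "Z (Suc j) = SI \<xi> (Suc j)" using ch_stop_iff unfolding stop_event_def by blast
      then show "Z \<in> {Z. (True \<and> Z j \<in> ?B) \<and> Z (Suc j) \<in> {SI \<xi> (Suc j)}}"
        using stop_event_stops[OF Z] by simp
    qed
  qed simp
  also have "\<dots> = pr (Suc j) {Z. True \<and> Z j \<in> ?B} * measure_pmf.prob (pmf_of_set {..<SK \<xi> (Suc j)}) {SI \<xi> (Suc j)}"
    by (rule unif_Suc) simp
  also have "pr (Suc j) {Z. True \<and> Z j \<in> ?B} = pr j {Z. True} * measure_pmf.prob (pmf_of_set {..<SK \<xi> j}) ?B"
    by (rule unif_Suc) simp
  also have "\<dots> = card (stops j M) / SK \<xi> j"
  proof -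
    have "{..<SK \<xi> j} \<inter> ?B = stops j M" by (auto simp: stops_def)
    then show ?thesis unfolding prob_pmf_of_lessThan[OF SKp] by simp
  qed
  also have "measure_pmf.prob (pmf_of_set {..<SK \<xi> (Suc j)}) {SI \<xi> (Suc j)} = 1 / SK \<xi> (Suc j)"
    using SI_less[OF rich, of "Suc j"] by (simp add: prob_pmf_of_lessThan[OF SKp] Int_insert_right)
  also have "card (stops j M) / SK \<xi> j * (1 / SK \<xi> (Suc j)) \<le> 2 / SK \<xi> j * (1 / SK \<xi> (Suc j))"
    using card_stops(2)[of j M] by (intro mult_right_mono divide_right_mono) auto
  finally show ?thesis by simp
qed

text \<open>A realizable mass has a stopping state \<open>z\<close>. One arriving chip, the state
  \<open>z\<close>, and then the entrance as the state of the next cycle is an event of the stated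
  probability that produces the mass.\<close>

lemma pr_stop_event_ge:
  assumes "stop_event \<xi> j M Z" "Z j < SK \<xi> j"
  shows "pr j {Z. ch Z j = 1} / (SK \<xi> j * SK \<xi> (Suc j)) \<le> pr (Suc (Suc j)) {Z. stop_event \<xi> j M Z}"
proof -
  define z where "z = Z j"
  have z: "z \<in> stops j M" "z < SK \<xi> j" using stop_event_stops[OF assms] assms(2) by (auto simp: z_def)
  have "pr j {Z. ch Z j = 1} / (SK \<xi> j * SK \<xi> (Suc j)) =
      pr (Suc j) {Z. ch Z j = 1 \<and> Z j \<in> {z}} * measure_pmf.prob (pmf_of_set {..<SK \<xi> (Suc j)}) {SI \<xi> (Suc j)}"
    unfolding pr_ch_step using SI_less[OF rich, of "Suc j"] z(2)
    by (simp add: prob_pmf_of_lessThan[OF SKp] Int_insert_right)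
  also have "\<dots> = pr (Suc (Suc j)) {Z. (ch Z j = 1 \<and> Z j \<in> {z}) \<and> Z (Suc j) \<in> {SI \<xi> (Suc j)}}"
    by (rule unif_Suc[symmetric]) (simp add: chips_upd)
  also have "\<dots> \<le> pr (Suc (Suc j)) {Z. stop_event \<xi> j M Z}"
  proof (rule measure_pmf.finite_measure_mono)
    show "{Z. (ch Z j = 1 \<and> Z j \<in> {z}) \<and> Z (Suc j) \<in> {SI \<xi> (Suc j)}} \<subseteq> {Z. stop_event \<xi> j M Z}"
      using stops_stop_event[of _ j M] z(1) by (intro subsetI CollectI) (metis (mono_tags, lifting) mem_Collect_eq singletonD)
  qed simp
  finally show ?thesis .
qed

text \<open>If the earlier record is \<open>t\<close>, the later one is at least
  \<open>t + 1\<close>, and (t + 1) div 2 + (t + 2) div 2 = t + 1.\<close>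

lemma SK_SK_ge: "2 ^ Suc (spos \<xi> (Suc j)) \<le> SK \<xi> j * SK \<xi> (Suc j)"
  unfolding SK_def power_add[symmetric] using spos_Suc(1)[OF rich, of "Suc j"]
  by (intro power_increasing) (presburger, simp)

lemma SK_SK_le: "SK \<xi> j * SK \<xi> (Suc j) \<le> 2 ^ Suc (spos \<xi> (Suc (Suc j)))"
  unfolding SK_def power_add[symmetric] using spos_Suc(1)[OF rich, of "Suc j"]
  by (intro power_increasing) (presburger, simp)

section \<open>The limiting probabilities and their exponent\<close>

definition stage :: "nat \<Rightarrow> nat" where "stage M = (LEAST j. M < dsz (Suc (spos \<xi> (Suc j))))"

lemma stage_less: "M < dsz (Suc (spos \<xi> (Suc (stage M))))"
  unfolding stage_def
proof (rule LeastI[of _ "3 * M"])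
  have "3 * M < spos \<xi> (Suc (3 * M))" using le_spos[OF rich, of "Suc (3 * M)"] by simp
  also have "\<dots> < 2 ^ Suc (spos \<xi> (Suc (3 * M)))" by (meson lessI less_exp less_trans)
  also have "\<dots> \<le> 3 * dsz (Suc (spos \<xi> (Suc (3 * M))))" by (rule dsz_ge)
  finally show "M < dsz (Suc (spos \<xi> (Suc (3 * M))))" by simp
qed

lemma stage_ge: "dsz (Suc (spos \<xi> 0)) \<le> M \<Longrightarrow> dsz (Suc (spos \<xi> (stage M))) \<le> M"
  using not_less_Least[of "stage M - 1" "\<lambda>j. M < dsz (Suc (spos \<xi> (Suc j)))"]
  by (cases "stage M") (auto simp: stage_def)

lemma stage_large:
  assumes "2 ^ Suc (spos \<xi> (Suc J)) \<le> M" shows "J < stage M"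
proof (rule ccontr)
  assume "\<not> J < stage M"
  then have "spos \<xi> (Suc (stage M)) \<le> spos \<xi> (Suc J)" using spos_mono[OF rich] by (simp add: strict_mono_less_eq)
  then have "(2 :: nat) ^ Suc (spos \<xi> (Suc (stage M))) \<le> 2 ^ Suc (spos \<xi> (Suc J))" by (intro power_increasing) auto
  with stage_less[of M] dsz_le[of "spos \<xi> (Suc (stage M))"] assms show False by linarith
qed

text \<open>Positive masses below the size of the starting subtree never occur, since a starting
  vertex that fires takes its whole subtree along.\<close>

definition qlim :: "nat \<Rightarrow> real" where
  "qlim M = (if M = 0 then pr 1 {Z. ch Z 1 = 0} else if M < dsz (Suc (spos \<xi> 0)) then 0
     else pr (Suc (Suc (stage M))) {Z. stop_event \<xi> (stage M) M Z})"

lemma rich_level: "spos \<xi> 0 < n \<Longrightarrow> rich_level n \<xi>"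
  by unfold_locales (use rich in auto)

lemma Mav_prob_eq_qlim:
  assumes n: "spos \<xi> (Suc (Suc (stage M))) < n"
  shows "Mav_prob \<xi> n M = qlim M"
proof -
  have lt: "spos \<xi> 0 < n" "spos \<xi> 1 < n"
    using n spos_mono[OF rich] by (metis One_nat_def Suc_le_mono le0 le_less_trans strict_mono_less_eq)+
  consider "M = 0" | "0 < M" "M < dsz (Suc (spos \<xi> 0))" | "dsz (Suc (spos \<xi> 0)) \<le> M" by linarith
  then show ?thesis
  proof cases
    case 1
    then show ?thesis using rich_level.Mav_prob_0[OF rich_level[OF lt(1)] lt(2)] by (simp only: qlim_def if_True simp_thms)
  next
    case 2
    then show ?thesis using rich_level.Mav_prob_gap[OF rich_level[OF lt(1)] 2] by (simp only: qlim_def if_True) simp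
  next
    case 3
    then have "M \<noteq> 0" using dsz_pos[of "spos \<xi> 0"] by linarith
    then show ?thesis
      using rich_level.Mav_prob_pos[OF rich_level[OF lt(1)] n stage_ge[OF 3] stage_less] 3 by (simp add: qlim_def)
  qed
qed

lemma Mav_prob_tendsto: "((\<lambda>n. Mav_prob \<xi> n M) \<longlongrightarrow> qlim M) (level_filter \<xi>)"
proof (rule tendsto_eventually)
  have "\<forall>\<^sub>F n in sequentially. Mav_prob \<xi> n M = qlim M"
    using eventually_gt_at_top[of "spos \<xi> (Suc (Suc (stage M)))"] by eventually_elim (rule Mav_prob_eq_qlim)
  then show "\<forall>\<^sub>F n in level_filter \<xi>. Mav_prob \<xi> n M = qlim M"
    unfolding level_filter_def by (rule filter_leD[OF inf_le1])
qed

lemma realizable_stop_event: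
  assumes "M \<in> realizable_masses \<xi>" "dsz (Suc (spos \<xi> 0)) \<le> M"
  shows "\<exists>Z. stop_event \<xi> (stage M) M Z \<and> Z (stage M) < SK \<xi> (stage M)"
proof -
  have "\<forall>\<^sub>F n in level_filter \<xi>. spos \<xi> (Suc (Suc (stage M))) < n"
    unfolding level_filter_def by (rule filter_leD[OF inf_le1 eventually_gt_at_top])
  then have "\<exists>\<^sub>F n in level_filter \<xi>. (\<exists>c\<in>Rec_n \<xi> n. Mav_n \<xi> n c = M) \<and> spos \<xi> (Suc (Suc (stage M))) < n"
    using assms(1) unfolding realizable_masses_def by (intro frequently_eventually_frequently) auto
  then obtain n c where n: "spos \<xi> (Suc (Suc (stage M))) < n" "c \<in> Rec_n \<xi> n" "Mav_n \<xi> n c = M"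
    using frequently_ex by blast
  have "spos \<xi> 0 < n" using n(1) spos_mono[OF rich] by (metis le0 le_less_trans strict_mono_less_eq)
  from rich_level.realized_stop_event[OF rich_level[OF this] n(1) stage_ge[OF assms(2)] stage_less n(2,3)]
  show ?thesis by blast
qed

text \<open>With \<open>j\<close> the stage of \<open>M\<close>, the product of the lengths of
  cycles \<open>j\<close> and \<open>j + 1\<close> is at least \<open>M\<close>, which gives the
  upper bound. It is at most 2 ^ (s + 1) for the record \<open>s\<close> with index
  \<open>j + 2\<close>; \<open>growth\<close> compares this with the record of index
  \<open>j\<close>, where the power of 2 is at most \<open>3 * M\<close>. One half of
  \<open>\<epsilon>\<close> pays for the growth, the other for the constant 3.\<close>

lemma critical:
  assumes gaps: "\<And>J. \<exists>j\<ge>J. spos \<xi> (Suc j) \<noteq> Suc (spos \<xi> j)"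
    and growth: "\<And>\<epsilon>. 0 < \<epsilon> \<Longrightarrow> \<exists>J. \<forall>j\<ge>J. real (Suc (spos \<xi> (Suc (Suc j)))) \<le> (1 + \<epsilon>) * real (Suc (spos \<xi> j))"
  shows "critical_exponent (realizable_masses \<xi>) qlim 1"
proof -
  obtain c J0 where c: "0 < c" "\<And>j. j \<ge> J0 \<Longrightarrow> c \<le> pr j {Z. ch Z j = 1}"
    using pr_1_bounded_below[OF gaps] by blast
  show ?thesis
    unfolding critical_exponent_def
  proof (rule exI[of _ c], intro conjI c(1), rule exI[of _ 2], intro conjI allI impI)
    show "(0 :: real) < 2" by simp
    fix \<epsilon> :: real assume eps: "0 < \<epsilon>"
    obtain J1 where J1: "\<And>j. j \<ge> J1 \<Longrightarrow> real (Suc (spos \<xi> (Suc (Suc j)))) \<le> (1 + \<epsilon> / 2) * real (Suc (spos \<xi> j))"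
      using growth[of "\<epsilon> / 2"] eps by auto
    \<comment> \<open>Chosen so that \<open>M powr (\<epsilon> / 2)\<close> absorbs the factor
      \<open>3 powr (1 + \<epsilon> / 2)\<close>.\<close>
    obtain M1 :: nat where M1: "(3 powr (1 + \<epsilon> / 2)) powr (2 / \<epsilon>) \<le> M1" using real_arch_simple by blast
    define M0 where "M0 = Max {1, 2 ^ Suc (spos \<xi> (Suc J0)), 2 ^ Suc (spos \<xi> (Suc J1)), dsz (Suc (spos \<xi> 0)), M1}"
    have M0: "1 \<le> M0" "2 ^ Suc (spos \<xi> (Suc J0)) \<le> M0" "2 ^ Suc (spos \<xi> (Suc J1)) \<le> M0"
      "dsz (Suc (spos \<xi> 0)) \<le> M0" "M1 \<le> M0"
      unfolding M0_def by (intro Max_ge; simp)+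
    show "\<exists>M\<^sub>\<epsilon>\<ge>1. \<forall>M\<in>realizable_masses \<xi>. M > M\<^sub>\<epsilon> \<longrightarrow>
        c * real M powr (- 1 - \<epsilon>) \<le> qlim M \<and> qlim M \<le> 2 * real M powr (- 1 + \<epsilon>)"
    proof (rule exI[of _ M0], intro conjI M0(1) ballI impI)
      fix M assume M: "M \<in> realizable_masses \<xi>" "M0 < M"
      define j where "j = stage M"
      have ge: "dsz (Suc (spos \<xi> 0)) \<le> M" and Mpos: "1 \<le> real M" using M0 M(2) by auto
      have j: "J0 \<le> j" "J1 \<le> j" using stage_large[of J0 M] stage_large[of J1 M] M0 M(2) by (auto simp: j_def)
      have q: "qlim M = pr (Suc (Suc j)) {Z. stop_event \<xi> j M Z}"
        using ge Mpos by (simp add: qlim_def j_def)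
      obtain Z where Z: "stop_event \<xi> j M Z" "Z j < SK \<xi> j"
        using realizable_stop_event[OF M(1) ge] by (auto simp: j_def)
      have KK: "0 < real (SK \<xi> j * SK \<xi> (Suc j))" using SKp by simp
      show "qlim M \<le> 2 * real M powr (- 1 + \<epsilon>)"
      proof -
        have "M \<le> SK \<xi> j * SK \<xi> (Suc j)"
          using stage_less[of M] dsz_le[of "spos \<xi> (Suc j)"] SK_SK_ge[of j] unfolding j_def by linarith
        then have "real M \<le> real (SK \<xi> j * SK \<xi> (Suc j))" using of_nat_le_iff by blast
        then have "qlim M \<le> 2 / real M"
          unfolding q using pr_stop_event_le[of j M] Mpos KK
          by (elim order_trans) (intro divide_left_mono, auto)
        also have "\<dots> = 2 * real M powr (- 1)" using Mpos by (simp add: powr_minus_divide)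
        also have "\<dots> \<le> 2 * real M powr (- 1 + \<epsilon>)" using Mpos eps by (intro mult_left_mono powr_mono) auto
        finally show ?thesis .
      qed
      show "c * real M powr (- 1 - \<epsilon>) \<le> qlim M"
      proof -
        have "real (SK \<xi> j * SK \<xi> (Suc j)) \<le> real (2 ^ Suc (spos \<xi> (Suc (Suc j))))"
          using SK_SK_le[of j] of_nat_le_iff by blast
        also have "\<dots> = 2 powr real (Suc (spos \<xi> (Suc (Suc j))))" by (simp add: powr_realpow[symmetric] del: of_nat_Suc power_Suc)
        also have "\<dots> \<le> 2 powr ((1 + \<epsilon> / 2) * real (Suc (spos \<xi> j)))"
          using J1[OF j(2)] by (intro powr_mono) auto
        also have "\<dots> = (2 powr real (Suc (spos \<xi> j))) powr (1 + \<epsilon> / 2)" by (simp add: powr_powr mult.commute)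
        also have "2 powr real (Suc (spos \<xi> j)) = real (2 ^ Suc (spos \<xi> j))" by (simp add: powr_realpow[symmetric] del: of_nat_Suc power_Suc)
        also have "real (2 ^ Suc (spos \<xi> j)) powr (1 + \<epsilon> / 2) \<le> (3 * real M) powr (1 + \<epsilon> / 2)"
        proof (rule powr_mono2)
          have "2 ^ Suc (spos \<xi> j) \<le> 3 * M"
            using dsz_ge[of "spos \<xi> j"] stage_ge[OF ge] unfolding j_def by linarith
          then show "real (2 ^ Suc (spos \<xi> j)) \<le> 3 * real M" using of_nat_le_iff[of "2 ^ Suc (spos \<xi> j)" "3 * M", where 'a = real] by simp
        qed (use eps in auto)
        also have "\<dots> = 3 powr (1 + \<epsilon> / 2) * real M powr (1 + \<epsilon> / 2)" by (simp add: powr_mult)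
        also have "\<dots> \<le> real M powr (\<epsilon> / 2) * real M powr (1 + \<epsilon> / 2)"
        proof (rule mult_right_mono)
          have e: "(1 + \<epsilon> / 2) * (2 / \<epsilon>) * (\<epsilon> / 2) = 1 + \<epsilon> / 2" using eps by (simp add: field_simps)
          have "3 powr (1 + \<epsilon> / 2) = ((3 powr (1 + \<epsilon> / 2)) powr (2 / \<epsilon>)) powr (\<epsilon> / 2)"
            by (simp only: powr_powr e)
          also have "\<dots> \<le> real M powr (\<epsilon> / 2)"
            using M1 M0(5) M(2) eps by (intro powr_mono2) auto
          finally show "3 powr (1 + \<epsilon> / 2) \<le> real M powr (\<epsilon> / 2)" .
        qed simp
        also have "\<dots> = real M powr (1 + \<epsilon>)" by (simp add: powr_add[symmetric] add.commute)
        finally have KM: "real (SK \<xi> j * SK \<xi> (Suc j)) \<le> real M powr (1 + \<epsilon>)" .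
        have "c * real M powr (- 1 - \<epsilon>) = c / real M powr (1 + \<epsilon>)"
          using powr_minus_divide[of "real M" "1 + \<epsilon>"] by (simp add: algebra_simps)
        also have "\<dots> \<le> c / real (SK \<xi> j * SK \<xi> (Suc j))"
          using KM KK c(1) Mpos by (intro divide_left_mono mult_pos_pos) auto
        also have "\<dots> \<le> pr j {Z. ch Z j = 1} / real (SK \<xi> j * SK \<xi> (Suc j))"
          using c(2)[OF j(1)] KK by (intro divide_right_mono) auto
        also have "\<dots> \<le> qlim M" unfolding q by (rule pr_stop_event_ge[OF Z])
        finally show ?thesis .
      qed
    qed
  qed
qed

end

section \<open>Blocks of the finite Schreier graphs\<close>

definition linked :: "('a, 'b) pre_digraph \<Rightarrow> 'a \<Rightarrow> 'a \<Rightarrow> bool" where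
  "linked K = (nbr K)\<^sup>*\<^sup>*"

lemma linked_refl [simp]: "linked K u u"
  by (simp add: linked_def)

lemma linked_step: "linked K u v \<Longrightarrow> nbr K v w \<Longrightarrow> linked K u w"
  unfolding linked_def by (rule rtranclp.rtrancl_into_rtrancl)

lemma linked_sym_trans: "linked K v u \<Longrightarrow> linked K v w \<Longrightarrow> linked K u w"
  unfolding linked_def by (rule rtranclp_trans[OF nbr_rtranclp_sym])

lemma linked_induct [consumes 1, case_names base step]:
  assumes "linked K u v" "P u" "\<And>y z. linked K u y \<Longrightarrow> nbr K y z \<Longrightarrow> P y \<Longrightarrow> P z"
  shows "P v"
  using assms unfolding linked_def by (rule rtranclp_induct)

lemma connected_iff:
  assumes "wf_digraph K"
  shows "Digraph_Component.connected K \<longleftrightarrow> verts K \<noteq> {} \<and> (\<forall>u\<in>verts K. \<forall>v\<in>verts K. linked K u v)"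
proof -
  have "Digraph_Component.connected K \<longleftrightarrow> verts K \<noteq> {} \<and> (\<forall>u\<in>verts K. \<forall>v\<in>verts K. joined K u v)"
    unfolding Digraph_Component.connected_def strongly_connected_def joined_def with_proj_simps
      pverts_mk_symmetric by (rule HOL.refl)
  then show ?thesis unfolding joined_iff[OF assms] linked_def[symmetric] by auto
qed

lemma connectedI:
  assumes "wf_digraph K" "v \<in> verts K" "\<And>u. u \<in> verts K \<Longrightarrow> linked K v u"
  shows "Digraph_Component.connected K"
  unfolding connected_iff[OF assms(1)] using assms(2) linked_sym_trans[OF assms(3) assms(3)] by blast

text \<open>\<open>S\<close> is one side of \<open>v\<close>. The edges inside \<open>S\<close> and
  the remaining ones form the two parts; a walk from \<open>v\<close> can change sides only at
  \<open>v\<close>, so both parts are connected.\<close>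

lemma cut_vertex_not_two_connected:
  assumes wf: "wf_digraph K" and v: "v \<in> verts K" "v \<in> S"
    and sep: "\<And>e. e \<in> arcs K \<Longrightarrow> tail K e \<in> S \<and> head K e \<in> S \<or>
      tail K e \<in> - S \<union> {v} \<and> head K e \<in> - S \<union> {v}"
    and e1: "e1 \<in> arcs K" "tail K e1 \<in> S \<and> head K e1 \<in> S"
    and e2: "e2 \<in> arcs K" "\<not> (tail K e2 \<in> S \<and> head K e2 \<in> S)"
  shows "\<not> two_connected K"
proof
  assume two: "two_connected K"
  then have conn: "linked K v u" if "u \<in> verts K" for u
    using that v unfolding two_connected_def connected_iff[OF wf] by blast
  define H1 where "H1 = \<lparr>verts = verts K \<inter> S, arcs = {e \<in> arcs K. tail K e \<in> S \<and> head K e \<in> S},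
    tail = tail K, head = head K\<rparr>"
  define H2 where "H2 = \<lparr>verts = verts K \<inter> (- S \<union> {v}), arcs = {e \<in> arcs K. \<not> (tail K e \<in> S \<and> head K e \<in> S)},
    tail = tail K, head = head K\<rparr>"
  have wf1: "wf_digraph H1" by unfold_locales (use wf in \<open>auto simp: H1_def wf_digraph_def\<close>)
  have wf2: "wf_digraph H2" by unfold_locales (use wf sep in \<open>auto simp: H2_def wf_digraph_def\<close>)
  have sub: "subgraph H1 K" "subgraph H2 K"
    using wf wf1 wf2 by (auto simp: subgraph_def compatible_def H1_def H2_def)
  have reach: "(u \<in> S \<longrightarrow> linked H1 v u) \<and> (u \<in> - S \<union> {v} \<longrightarrow> linked H2 v u)" if "linked K v u" for u
    using that
  proof (induction rule: linked_induct)
    case (step y z)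
    obtain e where e: "e \<in> arcs K" "tail K e = y \<and> head K e = z \<or> tail K e = z \<and> head K e = y"
      using step(2) unfolding nbr_def by blast
    show ?case
    proof (cases "tail K e \<in> S \<and> head K e \<in> S")
      case True
      then have "e \<in> arcs H1" using e(1) by (simp add: H1_def)
      then have N: "nbr H1 y z" unfolding nbr_def using e(2) by (intro bexI[of _ e]) (simp_all add: H1_def)
      have YZ: "y \<in> S" "z \<in> S" using e(2) True by auto
      note T = N YZ
      have "linked H1 v y" using step(3) T(2) by blast
      then have "linked H1 v z" using T(1) by (rule linked_step)
      moreover have "linked H2 v z" if "z \<in> - S \<union> {v}"
      proof -
        have zv: "z = v" using that T(3) by blast
        show ?thesis unfolding zv by (rule linked_refl)
      qed
      ultimately show ?thesis by blast
    next
      case False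
      then have "e \<in> arcs H2" using e(1) by (simp add: H2_def)
      then have N: "nbr H2 y z" unfolding nbr_def using e(2) by (intro bexI[of _ e]) (simp_all add: H2_def)
      have ends: "tail K e \<in> - S \<union> {v} \<and> head K e \<in> - S \<union> {v}" using sep[OF e(1)] False by argo
      have YZ: "y \<in> - S \<union> {v}" using e(2) by (rule disjE) (use ends in \<open>simp_all only:\<close>)
      have "z \<in> - S \<union> {v}" using e(2) by (rule disjE) (use ends in \<open>simp_all only:\<close>)
      note YZ = YZ this
      note F = N YZ
      have "linked H2 v y" using step(3) F(2) by blast
      then have "linked H2 v z" using F(1) by (rule linked_step)
      moreover have "linked H1 v z" if "z \<in> S"
      proof -
        have zv: "z = v" using that F(3) by blast
        show ?thesis unfolding zv by (rule linked_refl)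
      qed
      ultimately show ?thesis by blast
    qed
  qed simp
  have c1: "Digraph_Component.connected H1"
  proof (rule connectedI[OF wf1])
    show "v \<in> verts H1" using v by (simp add: H1_def)
    show "linked H1 v u" if "u \<in> verts H1" for u
    proof -
      have "u \<in> verts K" "u \<in> S" using that by (auto simp: H1_def)
      then show ?thesis using reach[OF conn] by blast
    qed
  qed
  have c2: "Digraph_Component.connected H2"
  proof (rule connectedI[OF wf2])
    show "v \<in> verts H2" using v by (simp add: H2_def)
    show "linked H2 v u" if "u \<in> verts H2" for u
    proof -
      have "u \<in> verts K" "u \<in> - S \<union> {v}" using that by (auto simp: H2_def)
      then show ?thesis using reach[OF conn] by blast
    qed
  qed
  have "arcs H1 \<noteq> {}" "arcs H2 \<noteq> {}" using e1 e2 by (auto simp: H1_def H2_def)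
  moreover have "arcs H1 \<inter> arcs H2 = {}" "arcs H1 \<union> arcs H2 = arcs K"
    "verts H1 \<inter> verts H2 = {v}" "verts H1 \<union> verts H2 = verts K"
    using v by (auto simp: H1_def H2_def)
  ultimately have "\<exists>H1 H2 v. subgraph H1 K \<and> subgraph H2 K \<and> Digraph_Component.connected H1 \<and>
      Digraph_Component.connected H2 \<and> arcs H1 \<noteq> {} \<and> arcs H2 \<noteq> {} \<and> arcs H1 \<inter> arcs H2 = {} \<and>
      arcs H1 \<union> arcs H2 = arcs K \<and> verts H1 \<inter> verts H2 = {v} \<and> verts H1 \<union> verts H2 = verts K"
    using sub c1 c2 by (intro exI[of _ H1] exI[of _ H2] exI[of _ v] conjI)
  then show False using two unfolding two_connected_def by metis
qed

section \<open>Degrees and the 2-connectedness of cycles\<close>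

lemma handshake:
  assumes "wf_digraph K" "finite (verts K)" "finite (arcs K)"
  shows "(\<Sum>v\<in>verts K. degree K v) = 2 * card (arcs K)"
proof -
  have "(\<Sum>v\<in>verts K. card {e. e \<in> arcs K \<and> f e = v}) = card (arcs K)" if "f ` arcs K \<subseteq> verts K" for f
    using sum.group[OF assms(3,2) that, of "\<lambda>_. 1 :: nat"] by simp
  note count = this
  have "head K ` arcs K \<subseteq> verts K" "tail K ` arcs K \<subseteq> verts K"
    using assms(1) by (auto simp: wf_digraph_def)
  from count[OF this(1)] count[OF this(2)] show ?thesis
    unfolding degree_def in_degree_def out_degree_def in_arcs_def out_arcs_def
    by (simp add: sum.distrib)
qed

lemma connected_arc_at:
  assumes wf: "wf_digraph K" and "Digraph_Component.connected K" "arcs K \<noteq> {}" "v \<in> verts K"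
  shows "in_arcs K v \<noteq> {} \<or> out_arcs K v \<noteq> {}"
proof -
  obtain e where e: "e \<in> arcs K" using assms(3) by blast
  then have "linked K v (tail K e)"
    using assms(2,4) wf_digraph.tail_in_verts[OF wf e] unfolding connected_iff[OF wf] by blast
  then have "v = tail K e \<or> (\<exists>y. nbr K v y)"
    unfolding linked_def by (rule converse_rtranclpE) blast+
  then show ?thesis using e by (auto simp: nbr_def in_arcs_def out_arcs_def)
qed

text \<open>In a splitting at \<open>v\<close> each part has degree 1 at \<open>v\<close> and degree
  2 elsewhere, an odd sum, contrary to the handshake lemma.\<close>

lemma is_cycle_two_connected:
  assumes wf: "wf_digraph C" and fin: "finite (verts C)" and cyc: "is_cycle C"
  shows "two_connected C"
  unfolding two_connected_def
proof (intro conjI notI)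
  show "Digraph_Component.connected C" using cyc by (simp add: is_cycle_def)
  have fina: "finite (arcs C)" using cyc by (simp add: is_cycle_def)
  assume "\<exists>H1 H2 v. subgraph H1 C \<and> subgraph H2 C \<and> Digraph_Component.connected H1 \<and> Digraph_Component.connected H2 \<and>
    arcs H1 \<noteq> {} \<and> arcs H2 \<noteq> {} \<and> arcs H1 \<inter> arcs H2 = {} \<and> arcs H1 \<union> arcs H2 = arcs C \<and>
    verts H1 \<inter> verts H2 = {v} \<and> verts H1 \<union> verts H2 = verts C"
  then obtain H1 H2 v where H: "subgraph H1 C" "subgraph H2 C" "Digraph_Component.connected H1" "Digraph_Component.connected H2"
    "arcs H1 \<noteq> {}" "arcs H2 \<noteq> {}" "arcs H1 \<inter> arcs H2 = {}" "arcs H1 \<union> arcs H2 = arcs C"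
    "verts H1 \<inter> verts H2 = {v}" "verts H1 \<union> verts H2 = verts C" by blast
  have wfs: "wf_digraph H1" "wf_digraph H2" and
    proj: "tail H1 = tail C" "tail H2 = tail C" "head H1 = head C" "head H2 = head C"
    using H(1,2) by (auto simp: subgraph_def compatible_def)
  have fin1: "finite (verts H1)" "finite (arcs H1)" and fin2: "finite (arcs H2)"
    using finite_subset[OF _ fin, of "verts H1"] finite_subset[OF _ fina, of "arcs H1"]
      finite_subset[OF _ fina, of "arcs H2"] H(8,10) by auto
  have split: "in_arcs C u = in_arcs H1 u \<union> in_arcs H2 u" "out_arcs C u = out_arcs H1 u \<union> out_arcs H2 u"
    "in_arcs H1 u \<inter> in_arcs H2 u = {}" "out_arcs H1 u \<inter> out_arcs H2 u = {}" for u
    using H(7) H(8)[symmetric] by (auto simp: in_arcs_def out_arcs_def proj)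
  have fin_arcs: "finite (in_arcs H1 u)" "finite (in_arcs H2 u)" "finite (out_arcs H1 u)" "finite (out_arcs H2 u)" for u
    using fin1 fin2 by (auto simp: in_arcs_def out_arcs_def)
  have deg: "degree C u = degree H1 u + degree H2 u" for u
    unfolding degree_def in_degree_def out_degree_def split(1,2)
    by (simp add: card_Un_disjoint split(3,4) fin_arcs)
  have pos: "0 < degree H1 v" "0 < degree H2 v"
    using connected_arc_at[OF wfs(1) H(3,5), of v] connected_arc_at[OF wfs(2) H(4,6), of v] H(9) fin_arcs[of v]
    by (auto simp: degree_def in_degree_def out_degree_def card_gt_0_iff)
  have v: "v \<in> verts H1" "v \<in> verts C" using H(9,10) by auto
  have "degree C v = 2" using cyc v(2) by (simp add: is_cycle_def)
  then have d1: "degree H1 v = 1" using deg[of v] pos by linarith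
  have d2: "degree H1 u = 2" if "u \<in> verts H1 - {v}" for u
  proof -
    have "u \<notin> verts H2" using that H(9) by blast
    then have "in_arcs H2 u = {}" "out_arcs H2 u = {}"
      using wfs(2) by (auto simp: in_arcs_def out_arcs_def wf_digraph_def)
    then have "degree H2 u = 0" by (simp add: degree_def in_degree_def out_degree_def)
    moreover have "degree C u = 2" using cyc that H(10) by (auto simp: is_cycle_def)
    ultimately show ?thesis using deg[of u] by simp
  qed
  have "2 * card (arcs H1) = (\<Sum>u\<in>verts H1. degree H1 u)" using handshake[OF wfs(1) fin1] by simp
  also have "\<dots> = degree H1 v + (\<Sum>u\<in>verts H1 - {v}. degree H1 u)" using fin1(1) v(1) by (rule sum.remove)
  also have "(\<Sum>u\<in>verts H1 - {v}. degree H1 u) = 2 * card (verts H1 - {v})" using d2 by simp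
  finally have "2 * card (arcs H1) = 1 + 2 * card (verts H1 - {v})" using d1 by simp
  then show False by presburger
qed

section \<open>The blocks are the generator cycles\<close>

definition orbit_cycle :: "nat \<Rightarrow> bool \<Rightarrow> bool list \<Rightarrow> bool list basilica_graph" where
  "orbit_cycle n \<sigma> b = \<lparr>verts = {w. length w = n \<and> base \<sigma> w = b}, arcs = {w. length w = n \<and> base \<sigma> w = b} \<times> {gen \<sigma>},
     tail = fst, head = head (Gamma_fin n)\<rparr>"

lemma head_Gamma: "head (Gamma_fin n) e = snd e (fst e)"
  by (cases e) simp

lemma orbit_cycle_simps [simp]:
  "verts (orbit_cycle n \<sigma> b) = {w. length w = n \<and> base \<sigma> w = b}"
  "arcs (orbit_cycle n \<sigma> b) = {w. length w = n \<and> base \<sigma> w = b} \<times> {gen \<sigma>}"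
  "tail (orbit_cycle n \<sigma> b) = fst" "head (orbit_cycle n \<sigma> b) = head (Gamma_fin n)"
  by (simp_all add: orbit_cycle_def)

lemma wf_orbit_cycle: "wf_digraph (orbit_cycle n \<sigma> b)"
  by unfold_locales (auto simp: head_Gamma)

lemma orbit_cycle_subgraph: "subgraph (orbit_cycle n \<sigma> b) (Gamma_fin n)"
  by (auto simp: subgraph_def compatible_def wf_Gamma_fin wf_orbit_cycle)

lemma funpow_gen_mk: "(gen \<sigma> ^^ d) (mk \<sigma> y (i + d)) = mk \<sigma> y i"
  by (induction d) (simp_all add: funpow_swap1)

lemma orbit_funpow:
  assumes "base \<sigma> w = base \<sigma> v" shows "\<exists>d. w = (gen \<sigma> ^^ d) v"
proof -
  define j where "j = pos \<sigma> w"
  \<comment> \<open>The generator lowers positions, so reaching \<open>j\<close> may require turns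
    around the cycle. The surplus makes \<open>j + d\<close> congruent to
    \<open>pos \<sigma> v\<close> without leaving the natural numbers.\<close>
  define d where "d = pos \<sigma> v + (len \<sigma> v * j - j)"
  have "1 \<le> len \<sigma> v" using len_pos[of \<sigma> v] by linarith
  from mult_le_mono1[OF this, of j] have "j \<le> len \<sigma> v * j" by simp
  then have "j + d = pos \<sigma> v + len \<sigma> v * j" unfolding d_def by linarith
  then have "mk \<sigma> v (j + d) = mk \<sigma> v (pos \<sigma> v)"
    using mk_mod[of \<sigma> v "j + d"] mk_mod[of \<sigma> v "pos \<sigma> v"] by simp
  then have "mk \<sigma> v (j + d) = v" by simp
  then have "(gen \<sigma> ^^ d) v = mk \<sigma> v j" by (metis funpow_gen_mk)
  also have "\<dots> = w" using assms unfolding j_def by (metis mk_base mk_pos)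
  finally show ?thesis by metis
qed

lemma orbit_cycle_connected:
  assumes "length y = n" shows "Digraph_Component.connected (orbit_cycle n \<sigma> (base \<sigma> y))"
proof (rule connectedI[OF wf_orbit_cycle])
  show "y \<in> verts (orbit_cycle n \<sigma> (base \<sigma> y))" using assms by simp
  fix u assume "u \<in> verts (orbit_cycle n \<sigma> (base \<sigma> y))"
  then obtain d where d: "u = (gen \<sigma> ^^ d) y" using orbit_funpow[of \<sigma> u y] by auto
  have "linked (orbit_cycle n \<sigma> (base \<sigma> y)) y ((gen \<sigma> ^^ d) y) \<and> base \<sigma> ((gen \<sigma> ^^ d) y) = base \<sigma> y \<and> length ((gen \<sigma> ^^ d) y) = n"
  proof (induction d)
    case (Suc d)
    then have "nbr (orbit_cycle n \<sigma> (base \<sigma> y)) ((gen \<sigma> ^^ d) y) ((gen \<sigma> ^^ Suc d) y)"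
      by (auto simp: nbr_def head_Gamma)
    with Suc show ?case by (auto intro: linked_step)
  qed (use assms in simp)
  then show "linked (orbit_cycle n \<sigma> (base \<sigma> y)) y u" using d by simp
qed

text \<open>Iterating the generator from \<open>v\<close> stays in \<open>H1\<close>: passing to an
  arc of \<open>H2\<close> requires a common vertex, which can only be \<open>v\<close>, and the arc
  at \<open>v\<close> belongs to \<open>H1\<close>.\<close>

lemma orbit_cycle_no_split:
  assumes H: "subgraph H1 (orbit_cycle n \<sigma> b)" "subgraph H2 (orbit_cycle n \<sigma> b)" "arcs H2 \<noteq> {}"
    "arcs H1 \<inter> arcs H2 = {}" "arcs H1 \<union> arcs H2 = arcs (orbit_cycle n \<sigma> b)"
    "verts H1 \<inter> verts H2 = {v}" "(v, gen \<sigma>) \<in> arcs H1"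
  shows False
proof -
  have wfs: "wf_digraph H1" "wf_digraph H2" and
    proj: "tail H1 = fst" "tail H2 = fst" "head H1 = head (Gamma_fin n)"
    using H(1,2) by (auto simp: subgraph_def compatible_def)
  have v: "length v = n" "base \<sigma> v = b" using H(5,7) by auto
  have all: "((gen \<sigma> ^^ i) v, gen \<sigma>) \<in> arcs H1" for i
  proof (induction i)
    case (Suc i)
    define x where "x = (gen \<sigma> ^^ Suc i) v"
    have "x \<in> verts H1"
      using wf_digraph.head_in_verts[OF wfs(1) Suc] by (simp add: proj head_Gamma x_def)
    have "(x, gen \<sigma>) \<in> arcs H1 \<union> arcs H2"
    proof -
      have "(gen \<sigma> ^^ i) v \<in> verts (orbit_cycle n \<sigma> b)" using Suc H(5) by auto
      then show ?thesis unfolding H(5) by (simp add: x_def)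
    qed
    moreover have "(x, gen \<sigma>) \<in> arcs H1" if "(x, gen \<sigma>) \<in> arcs H2"
    proof -
      have "x \<in> verts H2" using wf_digraph.tail_in_verts[OF wfs(2) that] by (simp add: proj)
      then have "x = v" using \<open>x \<in> verts H1\<close> H(6) by blast
      then show ?thesis using H(7) by simp
    qed
    ultimately show ?case by (auto simp: x_def)
  qed (use H in simp)
  have "arcs H2 \<subseteq> arcs (orbit_cycle n \<sigma> b)" using H(5) by blast
  then obtain w where "(w, gen \<sigma>) \<in> arcs H2" using H(3) by fastforce
  moreover from this have "base \<sigma> w = base \<sigma> v" using H(5) v by auto
  then obtain d where "w = (gen \<sigma> ^^ d) v" using orbit_funpow by blast
  ultimately show False using all[of d] H(4) by auto
qed

lemma orbit_cycle_two_connected: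
  assumes "length y = n" shows "two_connected (orbit_cycle n \<sigma> (base \<sigma> y))"
  unfolding two_connected_def
proof (rule conjI[OF orbit_cycle_connected[OF assms]], rule notI)
  let ?C = "orbit_cycle n \<sigma> (base \<sigma> y)"
  assume "\<exists>H1 H2 v. subgraph H1 ?C \<and> subgraph H2 ?C \<and> Digraph_Component.connected H1 \<and> Digraph_Component.connected H2 \<and>
    arcs H1 \<noteq> {} \<and> arcs H2 \<noteq> {} \<and> arcs H1 \<inter> arcs H2 = {} \<and> arcs H1 \<union> arcs H2 = arcs ?C \<and>
    verts H1 \<inter> verts H2 = {v} \<and> verts H1 \<union> verts H2 = verts ?C"
  then obtain H1 H2 v where H: "subgraph H1 ?C" "subgraph H2 ?C" "arcs H1 \<noteq> {}" "arcs H2 \<noteq> {}"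
    "arcs H1 \<inter> arcs H2 = {}" "arcs H1 \<union> arcs H2 = arcs ?C"
    "verts H1 \<inter> verts H2 = {v}" "verts H1 \<union> verts H2 = verts ?C"
    by (elim exE conjE) (rule that)
  have "v \<in> verts ?C" using H(7,8) by blast
  then have "(v, gen \<sigma>) \<in> arcs H1 \<union> arcs H2" unfolding H(6) by simp
  then show False
  proof
    assume "(v, gen \<sigma>) \<in> arcs H1"
    then show False by (rule orbit_cycle_no_split[OF H(1,2,4,5,6,7)])
  next
    assume v: "(v, gen \<sigma>) \<in> arcs H2"
    have "arcs H2 \<inter> arcs H1 = {}" "arcs H2 \<union> arcs H1 = arcs ?C" "verts H2 \<inter> verts H1 = {v}"
      using H(5,6,7) by (simp_all only: Int_commute Un_commute)
    then show False using v by (rule orbit_cycle_no_split[OF H(2,1,3)])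
  qed
qed

lemma desc_orbit:
  assumes "desc v y" "y \<noteq> v" "base \<sigma> y' = base \<sigma> y"
  shows "desc v y'"
proof -
  have nzy: "nz y" "nz v" using desc_nz[OF assms(1)] by auto
  have b: "desc v (base \<sigma> y)"
  proof (cases "\<sigma> = par y")
    case True
    then show ?thesis using desc_base_iff[OF nzy(1) assms(2)] assms(1) by simp
  next
    case False
    then have "base \<sigma> y = y" using base_nonzero_iff[OF nzy(1)] by simp
    then show ?thesis using assms(1) by simp
  qed
  show ?thesis
  proof (cases "base \<sigma> y' = y'")
    case True
    then show ?thesis using b assms(3) by simp
  next
    case False
    then have "nz y'" using base_zero by blast
    then have "par y' = \<sigma>" using False base_nonzero_iff[of y' \<sigma>] by auto
    then show ?thesis using desc_base_iff[OF \<open>nz y'\<close>, of v] desc_self[OF nzy(2)] b assms(3) by (cases "y' = v") auto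
  qed
qed

lemma not_desc_parent_orbit:
  assumes "nz v" "base (par v) y = base (par v) v" "y \<noteq> v"
  shows "\<not> desc v y"
proof
  assume d: "desc v y"
  have less: "val (base (par v) v) < val v" by (rule val_base_less) (use assms(1) base_eq_par_iff in blast)
  have nzy: "nz y" using desc_nz[OF d] by simp
  have "desc v (base (par v) y)"
  proof (cases "par y = par v")
    case True
    then show ?thesis using desc_base_iff[OF nzy assms(3)] d by simp
  next
    case False
    then have "base (par v) y = y" using base_nonzero_iff[OF nzy, of "par v"] by auto
    then show ?thesis using d by simp
  qed
  then show False using desc_val less assms(2) by fastforce
qed

text \<open>The part of the graph reached from \<open>v\<close> through its cycle of type
  \<open>side_type v\<close>, with \<open>v\<close> included. The zero word has no parent cycle, and
  its side of type \<open>True\<close> is taken by convention.\<close>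

definition side :: "bool list \<Rightarrow> bool list set" where
  "side v = (if nz v then {y. desc v y} else {y. nz y \<longrightarrow> lt y})"

definition side_type :: "bool list \<Rightarrow> bool" where
  "side_type v = (if nz v then \<not> par v else True)"

lemma side_closed:
  assumes "y \<in> side v" "y \<noteq> v" "length y = length v" "base \<sigma> y' = base \<sigma> y"
  shows "y' \<in> side v"
proof (cases "nz v")
  case True
  then show ?thesis using desc_orbit[of v y \<sigma> y'] assms by (simp add: side_def)
next
  case False
  then have nzy: "nz y" using assms(2,3) not_nz_iff by metis
  then have "lt y" using assms(1) False by (simp add: side_def)
  have "lt y'" if "nz y'"
  proof (cases "nz (base \<sigma> y)")
    case True
    then have "lt y' = lt y" using lt_base[of \<sigma> y] lt_base[of \<sigma> y'] assms(4) by simp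
    then show ?thesis using \<open>lt y\<close> by simp
  next
    case False
    then have "lt y' = lt y" using lt_base_zero[OF nzy, of \<sigma>] lt_base_zero[OF that, of \<sigma>] assms(4) by simp
    then show ?thesis using \<open>lt y\<close> by simp
  qed
  then show ?thesis using False by (simp add: side_def)
qed

lemma side_self: "v \<in> side v"
  by (simp add: side_def desc_self)

lemma side_inside:
  assumes "base (side_type v) y = base (side_type v) v" shows "y \<in> side v"
proof (cases "nz v")
  case True
  have b: "base (\<not> par v) v = v" by (rule base_not_par[OF True])
  show ?thesis
  proof (cases "y = v")
    case False
    then have "base (\<not> par v) y \<noteq> y" using assms True b by (simp add: side_type_def)
    moreover from this have nzy: "nz y" using base_zero by blast
    ultimately have "par y = (\<not> par v)" using base_nonzero_iff[of y "\<not> par v"] by auto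
    then show ?thesis using desc_base_iff[OF nzy False] assms True b desc_self[OF True] by (simp add: side_def side_type_def)
  qed (simp add: side_self)
next
  case False
  then show ?thesis using lt_base_zero[of y True] assms base_zero[OF False] by (auto simp: side_def side_type_def)
qed

lemma gen_zeros_neq: "2 \<le> n \<Longrightarrow> gen \<sigma> (zeros n) \<noteq> zeros n"
  by (cases \<sigma>; cases n rule: nat.exhaust; cases "n - 1") auto

text \<open>Excludes loops of the other type at \<open>v\<close>, which would lie inside the side.
  In length 1 there is such a loop: the generator a fixes the word 0.\<close>

lemma gen_neq:
  assumes "2 \<le> length v" "nz v \<Longrightarrow> \<sigma> = par v" shows "gen \<sigma> v \<noteq> v"
proof (cases "nz v")
  case True
  then show ?thesis using val_gen_less[OF True] assms by auto
next
  case False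
  then show ?thesis using gen_zeros_neq[OF assms(1)] not_nz_iff by metis
qed

lemma side_outside:
  assumes "base (\<not> side_type v) y = base (\<not> side_type v) v" "y \<noteq> v" "length y = length v"
  shows "y \<notin> side v"
proof (cases "nz v")
  case True
  then show ?thesis using not_desc_parent_orbit[OF True _ assms(2)] assms(1) by (simp add: side_def side_type_def)
next
  case False
  then have "nz y" using assms(2,3) not_nz_iff by metis
  moreover have "\<not> nz (base False y)" using assms(1) False base_zero[OF False] by (simp add: side_type_def)
  ultimately have "lt y = False" by (rule lt_base_zero)
  then show ?thesis using False \<open>nz y\<close> by (simp add: side_def)
qed

text \<open>\<open>v\<close> separates its two cycles, so edges of both types at \<open>v\<close>
  would make it a cut vertex of \<open>K\<close>.\<close>

lemma no_mixed_vertex: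
  assumes n: "2 \<le> n" and K: "subgraph K (Gamma_fin n)" "two_connected K"
    and e: "(x, gen \<sigma>) \<in> arcs K" "(x', gen (\<not> \<sigma>)) \<in> arcs K"
    and v: "x = v \<or> gen \<sigma> x = v" "x' = v \<or> gen (\<not> \<sigma>) x' = v"
  shows False
proof -
  have wf: "wf_digraph K" and tK: "tail K = fst" and hK: "head K = head (Gamma_fin n)"
    and sub: "verts K \<subseteq> {w. length w = n}" "arcs K \<subseteq> {w. length w = n} \<times> range gen"
    using K(1) by (auto simp: subgraph_def compatible_def)
  have "head K e = snd e (fst e)" for e unfolding hK by (rule head_Gamma)
  note proj = tK this
  have main: False if e: "(x, gen (side_type v)) \<in> arcs K" "(x', gen (\<not> side_type v)) \<in> arcs K"
    and vx: "x = v \<or> gen (side_type v) x = v" "x' = v \<or> gen (\<not> side_type v) x' = v" for x x'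
  proof -
    have lens: "length x = n" "length x' = n" using e sub by auto
    then have lv: "length v = n" using vx(1) by (metis length_gen)
    have vK: "v \<in> verts K"
      using vx(1) wf_digraph.tail_in_verts[OF wf e(1)] wf_digraph.head_in_verts[OF wf e(1)] by (auto simp: proj)
    have "\<not> two_connected K"
    proof (rule cut_vertex_not_two_connected[OF wf vK side_self])
      show "(x, gen (side_type v)) \<in> arcs K" "(x', gen (\<not> side_type v)) \<in> arcs K" by fact+
      have "base (side_type v) x = base (side_type v) v" using vx(1) by (metis base_gen)
      moreover from this have "base (side_type v) (gen (side_type v) x) = base (side_type v) v" by simp
      ultimately show "tail K (x, gen (side_type v)) \<in> side v \<and> head K (x, gen (side_type v)) \<in> side v"
        using side_inside by (simp add: proj)
      show "\<not> (tail K (x', gen (\<not> side_type v)) \<in> side v \<and> head K (x', gen (\<not> side_type v)) \<in> side v)"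
      proof -
        have ty: "nz v \<Longrightarrow> (\<not> side_type v) = par v" by (simp add: side_type_def)
        have b1: "base (\<not> side_type v) x' = base (\<not> side_type v) v" using vx(2) by (metis base_gen)
        then have "base (\<not> side_type v) (gen (\<not> side_type v) x') = base (\<not> side_type v) v" by simp
        note b = b1 this
        have "gen (\<not> side_type v) v \<noteq> v" by (rule gen_neq) (use n lv ty in auto)
        then have "x' \<noteq> v \<or> gen (\<not> side_type v) x' \<noteq> v" by auto
        then show ?thesis using side_outside[OF b(1)] side_outside[OF b(2)] lens lv by (auto simp: proj)
      qed
    next
      fix e assume "e \<in> arcs K"
      then obtain w \<rho> where e: "e = (w, gen \<rho>)" "length w = n" using sub(2) by auto
      show "tail K e \<in> side v \<and> head K e \<in> side v \<or> tail K e \<in> - side v \<union> {v} \<and> head K e \<in> - side v \<union> {v}"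
        using side_closed[of w v \<rho> "gen \<rho> w"] side_closed[of "gen \<rho> w" v \<rho> w] e lv
        by (auto simp: proj)
    qed
    then show False using K(2) by simp
  qed
  show False
  proof (cases "\<sigma> = side_type v")
    case True
    then show ?thesis using main[of x x'] e v by simp
  next
    case False
    then have "\<sigma> = (\<not> side_type v)" by auto
    then show ?thesis using main[of x' x] e v by simp
  qed
qed

text \<open>The type of the edges cannot change along a walk, so by connectedness there is only one
  type, and \<open>K\<close> stays in one orbit of that generator.\<close>

lemma two_connected_in_orbit_cycle:
  assumes n: "2 \<le> n" and K: "subgraph K (Gamma_fin n)" "two_connected K"
  shows "\<exists>\<sigma> y. length y = n \<and> subgraph K (orbit_cycle n \<sigma> (base \<sigma> y))"
proof -
  have wf: "wf_digraph K" and tK: "tail K = fst" and hK: "head K = head (Gamma_fin n)"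
    and sub: "verts K \<subseteq> {w. length w = n}" "arcs K \<subseteq> {w. length w = n} \<times> range gen"
    using K(1) by (auto simp: subgraph_def compatible_def)
  have "head K e = snd e (fst e)" for e unfolding hK by (rule head_Gamma)
  note proj = tK this hK
  have conn: "verts K \<noteq> {}" "\<And>u v. u \<in> verts K \<Longrightarrow> v \<in> verts K \<Longrightarrow> linked K u v"
    using K(2) unfolding two_connected_def connected_iff[OF wf] by auto
  have "\<exists>\<sigma> y. length y = n \<and> verts K \<subseteq> {w. base \<sigma> w = base \<sigma> y} \<and> arcs K \<subseteq> UNIV \<times> {gen \<sigma>}"
  proof (cases "arcs K = {}")
    case True
    obtain y where y: "y \<in> verts K" using conn by blast
    have "u = y" if "u \<in> verts K" for u
      using conn(2)[OF y that] unfolding linked_def by (rule rtranclp.cases) (simp_all add: nbr_def True)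
    note single = this
    \<comment> \<open>Without edges \<open>K\<close> is a single vertex, and either type would
      do.\<close>
    have "verts K \<subseteq> {w. base True w = base True y}"
    proof
      fix w assume "w \<in> verts K"
      then have "w = y" by (rule single)
      then show "w \<in> {w. base True w = base True y}" by simp
    qed
    moreover have "length y = n" using y sub(1) by blast
    moreover have "arcs K \<subseteq> UNIV \<times> {gen True}" unfolding True by simp
    ultimately show ?thesis by blast
  next
    case False
    then obtain y \<sigma> where e0: "(y, gen \<sigma>) \<in> arcs K" using sub(2) by fast
    have inv: "base \<sigma> u = base \<sigma> y \<and> (\<exists>x. (x, gen \<sigma>) \<in> arcs K \<and> (x = u \<or> gen \<sigma> x = u))" if "linked K y u" for u
      using that
    proof (induction rule: linked_induct)
      case base
      then show ?case using e0 by blast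
    next
      case (step u u')
      obtain x \<rho> where x: "(x, gen \<rho>) \<in> arcs K" "x = u \<and> gen \<rho> x = u' \<or> x = u' \<and> gen \<rho> x = u"
        using step(2) sub(2) by (fastforce simp: nbr_def proj)
      have "\<rho> = \<sigma>"
      proof (rule ccontr)
        assume "\<rho> \<noteq> \<sigma>"
        then have "\<rho> = (\<not> \<sigma>)" by auto
        then have x1: "(x, gen (\<not> \<sigma>)) \<in> arcs K" "x = u \<or> gen (\<not> \<sigma>) x = u" using x by auto
        obtain x' where x': "(x', gen \<sigma>) \<in> arcs K" "x' = u \<or> gen \<sigma> x' = u" using step(3) by blast
        show False by (rule no_mixed_vertex[OF n K x'(1) x1(1) x'(2) x1(2)])
      qed
      have xs: "(x, gen \<sigma>) \<in> arcs K" "x = u \<and> gen \<sigma> x = u' \<or> x = u' \<and> gen \<sigma> x = u"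
        using x unfolding \<open>\<rho> = \<sigma>\<close> .
      have "base \<sigma> u' = base \<sigma> u" using xs(2) by (metis base_gen)
      moreover have "x = u' \<or> gen \<sigma> x = u'" using xs(2) by metis
      ultimately show ?case using step(3) xs(1) by (intro conjI exI[of _ x]) simp_all
    qed
    have y: "y \<in> verts K" using wf_digraph.tail_in_verts[OF wf e0] by (simp add: proj)
    have "\<rho> = \<sigma>" if "(w, gen \<rho>) \<in> arcs K" for w \<rho>
    proof (rule ccontr)
      assume "\<rho> \<noteq> \<sigma>"
      then have "\<rho> = (\<not> \<sigma>)" by auto
      have "w \<in> verts K" using wf_digraph.tail_in_verts[OF wf that] by (simp add: proj)
      from inv[OF conn(2)[OF y this]] obtain x where x: "(x, gen \<sigma>) \<in> arcs K" "x = w \<or> gen \<sigma> x = w"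
        by (elim conjE exE) (rule that)
      have w: "(w, gen (\<not> \<sigma>)) \<in> arcs K" using that unfolding \<open>\<rho> = (\<not> \<sigma>)\<close> .
      show False by (rule no_mixed_vertex[OF n K x(1) w x(2)]) simp
    qed
    note type = this
    have "arcs K \<subseteq> UNIV \<times> {gen \<sigma>}"
    proof
      fix e assume e: "e \<in> arcs K"
      then have "e \<in> {w. length w = n} \<times> range gen" using sub(2) by blast
      then obtain w \<rho> where "e = (w, gen \<rho>)" by blast
      then show "e \<in> UNIV \<times> {gen \<sigma>}" using type[of w \<rho>] e by simp
    qed
    moreover have "verts K \<subseteq> {w. base \<sigma> w = base \<sigma> y}" using inv[OF conn(2)[OF y]] by auto
    moreover have "length y = n" using y sub(1) by blast
    ultimately show ?thesis by blast
  qed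
  then obtain \<sigma> y where y: "length y = n" "verts K \<subseteq> {w. base \<sigma> w = base \<sigma> y}" "arcs K \<subseteq> UNIV \<times> {gen \<sigma>}" by blast
  have "fst e \<in> verts K" if "e \<in> arcs K" for e using wf_digraph.tail_in_verts[OF wf that] by (simp add: proj)
  then have "subgraph K (orbit_cycle n \<sigma> (base \<sigma> y))"
    using y sub(1) wf wf_orbit_cycle proj by (fastforce simp: subgraph_def compatible_def)
  then show ?thesis using y(1) by blast
qed

lemma subgraph_antisym:
  fixes K L :: "('a, 'b) pre_digraph"
  shows "subgraph K L \<Longrightarrow> subgraph L K \<Longrightarrow> K = L"
  by (rule pre_digraph.equality) (auto simp: subgraph_def compatible_def)

lemma orbit_cycle_subgraph_eq:
  assumes "length y = n" "subgraph (orbit_cycle n \<sigma> (base \<sigma> y)) (orbit_cycle n \<rho> b)"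
  shows "orbit_cycle n \<sigma> (base \<sigma> y) = orbit_cycle n \<rho> b"
proof -
  have "(y, gen \<sigma>) \<in> arcs (orbit_cycle n \<rho> b)" using assms by (auto simp: subgraph_def)
  then show ?thesis by auto
qed

lemma is_block_iff:
  assumes n: "2 \<le> n"
  shows "is_block (Gamma_fin n) B \<longleftrightarrow> (\<exists>\<sigma> y. length y = n \<and> B = orbit_cycle n \<sigma> (base \<sigma> y))"
proof
  assume B: "is_block (Gamma_fin n) B"
  then have "subgraph B (Gamma_fin n)" "two_connected B"
    by (auto simp: is_block_def pre_digraph.max_subgraph_def)
  from two_connected_in_orbit_cycle[OF n this] obtain \<sigma> y where
    y: "length y = n" "subgraph B (orbit_cycle n \<sigma> (base \<sigma> y))" by blast
  then have "B = orbit_cycle n \<sigma> (base \<sigma> y)"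
    using B orbit_cycle_subgraph orbit_cycle_two_connected[OF y(1)]
    unfolding is_block_def pre_digraph.max_subgraph_def by metis
  then show "\<exists>\<sigma> y. length y = n \<and> B = orbit_cycle n \<sigma> (base \<sigma> y)" using y(1) by blast
next
  assume "\<exists>\<sigma> y. length y = n \<and> B = orbit_cycle n \<sigma> (base \<sigma> y)"
  then obtain \<sigma> y where y: "length y = n" "B = orbit_cycle n \<sigma> (base \<sigma> y)" by blast
  show "is_block (Gamma_fin n) B"
    unfolding is_block_def pre_digraph.max_subgraph_def
  proof (intro conjI allI impI notI)
    show "subgraph B (Gamma_fin n)" "two_connected B"
      using y orbit_cycle_subgraph orbit_cycle_two_connected by auto
    fix K assume K: "K \<noteq> B \<and> subgraph B K" "subgraph K (Gamma_fin n) \<and> two_connected K"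
    obtain \<rho> x where x: "length x = n" "subgraph K (orbit_cycle n \<rho> (base \<rho> x))"
      using two_connected_in_orbit_cycle[OF n] K(2) by blast
    have "subgraph B (orbit_cycle n \<rho> (base \<rho> x))" using K(1) x(2) by (auto simp: subgraph_def compatible_def)
    then have "B = orbit_cycle n \<rho> (base \<rho> x)" unfolding y(2) by (rule orbit_cycle_subgraph_eq[OF y(1)])
    then show False using K(1) x(2) subgraph_antisym by blast
  qed
qed

lemma in_out_arcs_orbit_cycle:
  assumes "w \<in> verts (orbit_cycle n \<sigma> b)"
  shows "out_arcs (orbit_cycle n \<sigma> b) w = {(w, gen \<sigma>)}" "in_arcs (orbit_cycle n \<sigma> b) w = {(genI \<sigma> w, gen \<sigma>)}"
proof -
  have w: "length w = n" "base \<sigma> w = b" using assms by auto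
  have "e \<in> out_arcs (orbit_cycle n \<sigma> b) w \<longleftrightarrow> e = (w, gen \<sigma>)" for e
    using w by (cases e) (auto simp: out_arcs_def)
  then show "out_arcs (orbit_cycle n \<sigma> b) w = {(w, gen \<sigma>)}" by blast
  have "e \<in> in_arcs (orbit_cycle n \<sigma> b) w \<longleftrightarrow> e = (genI \<sigma> w, gen \<sigma>)" for e
  proof
    assume "e \<in> in_arcs (orbit_cycle n \<sigma> b) w"
    then have "snd e = gen \<sigma>" "snd e (fst e) = w" by (auto simp: in_arcs_def head_Gamma)
    then have "fst e = genI \<sigma> w" by (metis genI_gen)
    then show "e = (genI \<sigma> w, gen \<sigma>)" using \<open>snd e = gen \<sigma>\<close> by (cases e) simp
  next
    assume "e = (genI \<sigma> w, gen \<sigma>)"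
    then show "e \<in> in_arcs (orbit_cycle n \<sigma> b) w" using w by (simp add: in_arcs_def head_Gamma)
  qed
  then show "in_arcs (orbit_cycle n \<sigma> b) w = {(genI \<sigma> w, gen \<sigma>)}" by blast
qed

lemma orbit_cycle_is_cycle:
  assumes "length y = n" shows "is_cycle (orbit_cycle n \<sigma> (base \<sigma> y))"
  unfolding is_cycle_def
proof (intro conjI ballI)
  show "Digraph_Component.connected (orbit_cycle n \<sigma> (base \<sigma> y))" by (rule orbit_cycle_connected[OF assms])
  show "finite (arcs (orbit_cycle n \<sigma> (base \<sigma> y)))"
    using finite_lists_length_eq[of "UNIV :: bool set" n] by (auto intro: finite_subset)
  fix w assume "w \<in> verts (orbit_cycle n \<sigma> (base \<sigma> y))"
  from in_out_arcs_orbit_cycle[OF this] show "degree (orbit_cycle n \<sigma> (base \<sigma> y)) w = 2"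
    by (simp add: degree_def in_degree_def out_degree_def)
qed

section \<open>The central cycle and the chains of blocks\<close>

lemma lt_snoc: "lt (w @ [True]) = even (length w)"
  by (induction w) auto

lemma base_last_zero:
  assumes "1 \<le> n" "base \<sigma> (zeros (n - 1) @ [True]) = zeros n"
  shows "\<sigma> = odd n"
proof -
  have "lt (zeros (n - 1) @ [True]) = \<sigma>" by (rule lt_base_zero) (use assms in auto)
  then show ?thesis using assms(1) by (auto simp: lt_snoc)
qed

lemma base_last: "1 \<le> n \<Longrightarrow> base (odd n) (zeros (n - 1) @ [True]) = zeros n"
proof (induction n rule: nat_induct_at_least)
  case (Suc n)
  then obtain k where k: "n = Suc k" by (cases n) auto
  show ?case using Suc unfolding k by (cases "odd k") auto
qed simp

text \<open>Any such cycle lies in one orbit cycle, whose type is forced by its two prescribed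
  vertices. In an orbit cycle a vertex has just one outgoing and one incoming arc; degree 2 requires
  both, so iterating the generator from the zero word gives everything.\<close>

lemma central_cycle_eq:
  assumes n: "2 \<le> n" shows "central_cycle n = orbit_cycle n (odd n) (zeros n)"
proof -
  let ?C = "orbit_cycle n (odd n) (zeros n)"
  have C: "?C = orbit_cycle n (odd n) (base (odd n) (zeros n))" by simp
  show ?thesis unfolding central_cycle_def
  proof (rule the_equality)
    show "subgraph ?C (Gamma_fin n) \<and> is_cycle ?C \<and> zeros n \<in> verts ?C \<and> zeros (n - 1) @ [True] \<in> verts ?C"
      using orbit_cycle_subgraph orbit_cycle_is_cycle[of "zeros n" n "odd n"] base_last[of n] n by auto
    fix K assume K: "subgraph K (Gamma_fin n) \<and> is_cycle K \<and> zeros n \<in> verts K \<and> zeros (n - 1) @ [True] \<in> verts K"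
    have wf: "wf_digraph K" using K by (auto simp: subgraph_def)
    have fin: "finite (verts K)"
      using K finite_lists_length_eq[of "UNIV :: bool set" n] by (auto simp: subgraph_def elim: finite_subset)
    obtain \<sigma> y where y: "length y = n" "subgraph K (orbit_cycle n \<sigma> (base \<sigma> y))"
      using two_connected_in_orbit_cycle[OF n] is_cycle_two_connected[OF wf fin] K by blast
    have "zeros n \<in> verts (orbit_cycle n \<sigma> (base \<sigma> y))" "zeros (n - 1) @ [True] \<in> verts (orbit_cycle n \<sigma> (base \<sigma> y))"
      using K y(2) by (auto simp: subgraph_def)
    then have b: "base \<sigma> y = zeros n" "base \<sigma> (zeros (n - 1) @ [True]) = zeros n" by auto
    then have \<sigma>: "\<sigma> = odd n" using base_last_zero n by auto
    have sub: "subgraph K ?C" using y(2) b(1) \<sigma> by simp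
    have arcs_at: "(w, gen \<sigma>) \<in> arcs K" if w: "w \<in> verts K" for w
    proof -
      have wC: "w \<in> verts ?C" using sub w by (auto simp: subgraph_def)
      have "out_arcs K w \<subseteq> out_arcs ?C w" "in_arcs K w \<subseteq> in_arcs ?C w"
        using sub by (auto simp: subgraph_def compatible_def out_arcs_def in_arcs_def)
      then have o: "out_arcs K w \<subseteq> {(w, gen \<sigma>)}" and i: "in_arcs K w \<subseteq> {(genI \<sigma> w, gen \<sigma>)}"
        using in_out_arcs_orbit_cycle[OF wC] \<sigma> by auto
      have "card (in_arcs K w) \<le> 1" using card_mono[OF _ i] by simp
      moreover have "degree K w = 2" using K w by (auto simp: is_cycle_def)
      ultimately have "out_arcs K w \<noteq> {}" by (auto simp: degree_def in_degree_def out_degree_def)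
      then have "(w, gen \<sigma>) \<in> out_arcs K w" using o by blast
      then show ?thesis by (simp add: out_arcs_def)
    qed
    have iter: "(gen \<sigma> ^^ d) (zeros n) \<in> verts K" for d
    proof (induction d)
      case (Suc d)
      have hK: "head K = head (Gamma_fin n)" using K by (simp add: subgraph_def compatible_def)
      from wf_digraph.head_in_verts[OF wf arcs_at[OF Suc]] show ?case by (simp add: hK)
    qed (use K in simp)
    have verts: "w \<in> verts K" if "w \<in> verts ?C" for w
      using orbit_funpow[of \<sigma> w "zeros n"] iter that \<sigma> by auto
    then have "subgraph ?C K" using arcs_at wf wf_orbit_cycle sub \<sigma> by (auto simp: subgraph_def compatible_def)
    then show "K = ?C" using sub subgraph_antisym by blast
  qed
qed

text \<open>Parent cycles are climbed. If the next one already occurs in the chain, the chain is cut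
  off there to keep its blocks distinct.\<close>

lemma block_chain_exists:
  assumes n: "2 \<le> n" and w: "nz w" "length w = n" "lt w = odd n"
  shows "\<exists>Bs. block_chain (Gamma_fin n) w (central_cycle n) Bs"
  using w
proof (induction "val w" arbitrary: w rule: less_induct)
  case less
  show ?case
  proof (cases "base (odd n) w = zeros n")
    case True
    have "is_block (Gamma_fin n) (central_cycle n)"
      unfolding is_block_iff[OF n] central_cycle_eq[OF n] using less.prems True by metis
    then have "block_chain (Gamma_fin n) w (central_cycle n) [central_cycle n]"
      using less.prems True by (simp add: block_chain_def central_cycle_eq[OF n])
    then show ?thesis by blast
  next
    case False
    define u where "u = base (par w) w"
    define B where "B = orbit_cycle n (par w) u"
    have nzu: "nz u"
    proof (rule ccontr)
      assume nu: "\<not> nz u"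
      then have "par w = odd n" using nz_par_base_zero[of w] less.prems by (simp add: u_def)
      then show False using False nu nz_iff[of u n] less.prems by (simp add: u_def)
    qed
    have "val u < val w" unfolding u_def by (rule val_base_less) (use less.prems base_eq_par_iff in blast)
    moreover have "lt u = odd n" using lt_base nzu less.prems by (simp add: u_def)
    ultimately obtain Bs where Bs: "block_chain (Gamma_fin n) u (central_cycle n) Bs"
      using less.hyps[of u] nzu less.prems by (auto simp: u_def)
    have block: "is_block (Gamma_fin n) B" unfolding is_block_iff[OF n] B_def u_def using less.prems by blast
    have wu: "w \<in> verts B" "u \<in> verts B" using less.prems by (auto simp: B_def u_def)
    show ?thesis
    proof (cases "B \<in> set Bs")
      case True
      then obtain xs ys where split: "Bs = xs @ B # ys" by (meson split_list)
      have "verts ((B # ys) ! i) \<inter> verts ((B # ys) ! Suc i) \<noteq> {}" if "Suc i < length (B # ys)" for i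
      proof -
        have "Bs ! (length xs + i) = (B # ys) ! i" unfolding split by (rule nth_append_length_plus)
        moreover have "Bs ! Suc (length xs + i) = (B # ys) ! Suc i"
          using nth_append_length_plus[of xs "B # ys" "Suc i"] unfolding split by simp
        moreover have "Suc (length xs + i) < length Bs" using that unfolding split by simp
        then have "verts (Bs ! (length xs + i)) \<inter> verts (Bs ! Suc (length xs + i)) \<noteq> {}"
          using Bs unfolding block_chain_def by metis
        ultimately show ?thesis by simp
      qed
      then have "block_chain (Gamma_fin n) w (central_cycle n) (B # ys)"
        using Bs wu unfolding block_chain_def split by auto
      then show ?thesis by blast
    next
      case False
      have "verts ((B # Bs) ! i) \<inter> verts ((B # Bs) ! Suc i) \<noteq> {}" if "Suc i < length (B # Bs)" for i
      proof (cases i)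
        case 0
        then show ?thesis using Bs wu(2) by (cases Bs) (auto simp: block_chain_def)
      next
        case (Suc l)
        then show ?thesis using Bs that by (auto simp: block_chain_def)
      qed
      then have "block_chain (Gamma_fin n) w (central_cycle n) (B # Bs)"
        using Bs wu block False unfolding block_chain_def by auto
      then show ?thesis by blast
    qed
  qed
qed

text \<open>Supplies that two cycles of different types share at most one vertex.\<close>

lemma base_both_inj: "base True v = base True w \<Longrightarrow> base False v = base False w \<Longrightarrow> v = w"
proof (induction v arbitrary: w)
  case Nil
  then show ?case by (metis length_base length_0_conv)
next
  case (Cons x v)
  have "length w = Suc (length v)" using arg_cong[OF Cons.prems(1), of length] by simp
  then obtain y w' where w: "w = y # w'" by (cases w) auto
  show ?case using Cons unfolding w by (cases x; cases y) auto
qed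

text \<open>Before the last block the chain avoids the zero word: on this side the first block that
  contains it is the central cycle, which occurs only at the end. The penultimate block therefore
  has a nonzero base and a different type, and it meets the central cycle in one vertex.\<close>

lemma block_chain_last:
  assumes n: "2 \<le> n" and x: "nz x" "length x = n" "lt x = odd n" "base (odd n) x \<noteq> zeros n"
    and Bs: "block_chain (Gamma_fin n) x (central_cycle n) Bs"
  shows "2 \<le> length Bs" "\<exists>v. verts (Bs ! (length Bs - 2)) \<inter> verts (last Bs) = {v} \<and> v \<noteq> zeros n"
proof -
  let ?C = "orbit_cycle n (odd n) (zeros n)"
  have ne: "Bs \<noteq> []" and last: "last Bs = ?C" and dist: "distinct Bs" and hd: "x \<in> verts (hd Bs)"
    and blocks: "\<And>B. B \<in> set Bs \<Longrightarrow> \<exists>\<sigma> y. length y = n \<and> B = orbit_cycle n \<sigma> (base \<sigma> y)"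
    and adj: "\<And>i. Suc i < length Bs \<Longrightarrow> verts (Bs ! i) \<inter> verts (Bs ! Suc i) \<noteq> {}"
    using Bs unfolding block_chain_def is_block_iff[OF n] central_cycle_eq[OF n] by auto
  have "hd Bs \<noteq> last Bs" using hd x(4) last by auto
  then show two: "2 \<le> length Bs" using ne by (cases Bs; cases "tl Bs") auto
  have lastn: "Bs ! (length Bs - 1) = ?C" using last ne by (simp add: last_conv_nth)
  have inv: "\<exists>\<sigma> y. length y = n \<and> nz (base \<sigma> y) \<and> lt (base \<sigma> y) = odd n \<and> Bs ! i = orbit_cycle n \<sigma> (base \<sigma> y)"
    if "Suc i < length Bs" for i
    using that
  proof (induction i)
    case 0
    obtain \<sigma> y where y: "length y = n" "Bs ! 0 = orbit_cycle n \<sigma> (base \<sigma> y)" using blocks[of "Bs ! 0"] ne by auto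
    have bx: "base \<sigma> y = base \<sigma> x" using hd y ne by (auto simp: hd_conv_nth)
    have "nz (base \<sigma> x)"
    proof (rule ccontr)
      assume nb: "\<not> nz (base \<sigma> x)"
      then have "\<sigma> = odd n" using lt_base_zero[OF x(1)] x(3) by auto
      then show False using x(2,4) nb nz_iff[of "base \<sigma> x" n] by auto
    qed
    then show ?case using y bx lt_base x(3) by metis
  next
    case (Suc i)
    then obtain \<sigma> y where y: "nz (base \<sigma> y)" "lt (base \<sigma> y) = odd n" "Bs ! i = orbit_cycle n \<sigma> (base \<sigma> y)" by auto
    obtain u where u: "u \<in> verts (Bs ! i)" "u \<in> verts (Bs ! Suc i)" using adj[of i] Suc.prems by auto
    have bu: "base \<sigma> u = base \<sigma> y" "length u = n" using u(1) y(3) by auto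
    then have "nz (base \<sigma> u)" using y(1) by simp
    then have "nz u" "lt u = odd n" using y(2) lt_base[of \<sigma> u] nz_baseD[of \<sigma> u] bu(1) by simp_all
    note nzu = this
    obtain \<rho> y' where y': "length y' = n" "Bs ! Suc i = orbit_cycle n \<rho> (base \<rho> y')"
      using blocks[of "Bs ! Suc i"] Suc.prems by auto
    have bu': "base \<rho> y' = base \<rho> u" using u(2) y'(2) by auto
    have "nz (base \<rho> u)"
    proof (rule ccontr)
      assume nb: "\<not> nz (base \<rho> u)"
      then have "\<rho> = odd n" "base \<rho> u = zeros n" using lt_base_zero[OF nzu(1), of \<rho>] nzu(2) nz_iff[of "base \<rho> u" n] bu(2) by auto
      then have "Bs ! Suc i = Bs ! (length Bs - 1)" using y'(2) bu' lastn by simp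
      moreover have lt: "Suc i < length Bs" "length Bs - 1 < length Bs" using Suc.prems by linarith+
      ultimately have "Suc i = length Bs - 1" using nth_eq_iff_index_eq[OF dist lt] by blast
      then show False using Suc.prems by linarith
    qed
    then show ?case using y' bu' lt_base nzu(2) by metis
  qed
  have "Suc (length Bs - 2) = length Bs - 1" using two by simp
  moreover have two': "Suc (length Bs - 2) < length Bs" using two by simp
  from adj[OF two'] obtain v where v0: "v \<in> verts (Bs ! (length Bs - 2))" "v \<in> verts (Bs ! Suc (length Bs - 2))"
    by blast
  ultimately have v: "v \<in> verts (Bs ! (length Bs - 2))" "v \<in> verts ?C" using lastn by simp_all
  from inv[OF two'] obtain \<sigma> y where
    y: "length y = n" "nz (base \<sigma> y)" "Bs ! (length Bs - 2) = orbit_cycle n \<sigma> (base \<sigma> y)" by blast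
  have bv: "base \<sigma> v = base \<sigma> y" "base (odd n) v = zeros n" using v y(3) by simp_all
  have neq: "\<sigma> \<noteq> odd n"
  proof
    assume "\<sigma> = odd n"
    then have "base \<sigma> y = zeros n" using bv by simp
    then show False using y(2) by simp
  qed
  have uniq: "u = v" if "u \<in> verts (Bs ! (length Bs - 2))" "u \<in> verts ?C" for u
  proof (rule base_both_inj)
    have a: "base \<sigma> u = base \<sigma> v" using that(1) bv(1) y(3) by simp
    have c: "base (odd n) u = base (odd n) v" using that(2) bv(2) by simp
    show "base True u = base True v" "base False u = base False v" using a c neq by (cases \<sigma>; simp)+
  qed
  have "v \<noteq> zeros n"
  proof
    assume "v = zeros n"
    then have "base \<sigma> y = zeros n" using bv(1) by simp
    then show False using y(2) by simp
  qed
  then show "\<exists>v. verts (Bs ! (length Bs - 2)) \<inter> verts (last Bs) = {v} \<and> v \<noteq> zeros n"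
    unfolding last using v uniq by (intro exI[of _ v]) blast
qed

lemma good_level:
  assumes "2 \<le> n" "nz (stake n \<xi>)" "lt (stake n \<xi>) = odd n" "base (odd n) (stake n \<xi>) \<noteq> zeros n"
  shows "n \<in> good_levels \<xi>"
proof -
  obtain Bs where "block_chain (Gamma_fin n) (stake n \<xi>) (central_cycle n) Bs"
    using block_chain_exists[OF assms(1,2) _ assms(3)] by auto
  then have "block_chain (Gamma_fin n) (stake n \<xi>) (central_cycle n) (CP n \<xi>)"
    unfolding CP_def min_block_chain_def by (rule arg_min_natI)
  from block_chain_last[OF assms(1,2) _ assms(3,4) this] show ?thesis
    using assms(1) by (simp add: good_levels_def)
qed

section \<open>Almost every boundary point\<close>

lemma space_uniform_boundary [simp]: "space uniform_boundary = UNIV"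
  by (simp add: uniform_boundary_def space_stream_space)

interpretation boundary: prob_space uniform_boundary
  unfolding uniform_boundary_def by (rule prob_space.prob_space_stream_space) unfold_locales

lemma sets_const_positions:
  fixes J :: "nat set" shows "{\<xi>. \<forall>i\<in>J. \<xi> !! i = b} \<in> sets uniform_boundary"
proof -
  have "Measurable.pred uniform_boundary (\<lambda>\<xi>. \<forall>i\<in>J. \<xi> !! i = b)"
    unfolding uniform_boundary_def by measurable
  then show ?thesis by (simp add: pred_def)
qed

lemma prob_const_positions:
  assumes "finite J"
  shows "boundary.prob {\<xi>. \<forall>i\<in>J. \<xi> !! i = b} = (1 / 2) ^ card J"
proof -
  let ?M = "measure_pmf (bernoulli_pmf (1 / 2)) :: bool measure"
  interpret P: product_prob_space "\<lambda>_ :: nat. ?M" UNIV ..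
  have "emeasure uniform_boundary {\<xi>. \<forall>i\<in>J. \<xi> !! i = b} =
      emeasure (\<Pi>\<^sub>M i\<in>UNIV. ?M) (to_stream -` {\<xi>. \<forall>i\<in>J. \<xi> !! i = b} \<inter> space (\<Pi>\<^sub>M i\<in>UNIV. ?M))"
    using sets_const_positions[of J b] unfolding uniform_boundary_def
    by (subst stream_space_eq_distr) (rule emeasure_distr, auto)
  also have "to_stream -` {\<xi>. \<forall>i\<in>J. \<xi> !! i = b} \<inter> space (\<Pi>\<^sub>M i\<in>UNIV. ?M) =
      {X \<in> space (\<Pi>\<^sub>M i\<in>UNIV. ?M). \<forall>i\<in>J. X i \<in> {b}}"
    by (auto simp: to_stream_def)
  also have "emeasure (\<Pi>\<^sub>M i\<in>UNIV. ?M) \<dots> = (\<Prod>i\<in>J. emeasure ?M {b})"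
    by (rule P.emeasure_PiM_Collect) (use assms in auto)
  also have "emeasure ?M {b} = ennreal (1 / 2)"
    by (cases b) (simp_all add: emeasure_pmf_single)
  also have "(\<Prod>i\<in>J. ennreal (1 / 2)) = ennreal ((1 / 2) ^ card J)"
    by (subst prod_constant, rule ennreal_power) simp
  finally show ?thesis by (simp add: measure_def)
qed

text \<open>The first Borel-Cantelli lemma: constancy on \<open>J r\<close> has probability 2 to the
  power \<open>- card (J r)\<close>.\<close>

lemma AE_eventually_not_const:
  fixes J :: "nat \<Rightarrow> nat set"
  assumes "\<And>r. finite (J r)" "summable (\<lambda>r. (1 / 2 :: real) ^ card (J r))"
  shows "AE \<xi> in uniform_boundary. \<forall>\<^sub>F r in sequentially. \<exists>i\<in>J r. \<xi> !! i \<noteq> b"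
proof -
  have "AE \<xi> in uniform_boundary. \<forall>\<^sub>F r in sequentially. \<xi> \<in> space uniform_boundary - {\<xi>. \<forall>i\<in>J r. \<xi> !! i = b}"
    by (rule borel_cantelli_AE1)
      (use assms in \<open>auto simp: prob_const_positions sets_const_positions less_top[symmetric]\<close>)
  then show ?thesis by eventually_elim (auto elim: eventually_mono)
qed

lemma summable_half_power_div:
  assumes "0 < q" shows "summable (\<lambda>r. (1 / 2 :: real) ^ (r div q))"
proof (rule summable_comparison_test'[where N = 0])
  show "summable (\<lambda>r. 2 * (2 powr (- 1 / real q)) ^ r)"
    by (intro summable_mult summable_geometric) (use assms in \<open>auto simp: powr_less_one\<close>)
  fix r
  have "real r \<le> real (q + q * (r div q))"
    using dividend_less_times_div[OF assms, of r] by linarith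
  then have "real r / real q \<le> real (r div q) + 1"
    using assms by (simp add: divide_simps algebra_simps)
  then have "2 powr (- real (r div q)) \<le> 2 powr (1 + real r * (- 1 / real q))"
    by (intro powr_mono) auto
  also have "\<dots> = 2 * 2 powr (real r * (- 1 / real q))" by (subst powr_add) simp
  also have "2 powr (real r * (- 1 / real q)) = (2 powr (- 1 / real q)) ^ r"
    by (subst powr_realpow[symmetric]) (simp_all add: powr_powr mult.commute)
  finally show "norm ((1 / 2 :: real) ^ (r div q)) \<le> 2 * (2 powr (- 1 / real q)) ^ r"
    by (simp add: powr_minus powr_realpow power_one_over inverse_eq_divide)
qed

text \<open>Behind a record at \<open>r\<close> it provides a one of the opposite parity, hence
  bounds the next record by \<open>(1 + 2 / q) * r\<close>.\<close>

definition dense_ones :: "nat \<Rightarrow> bool stream \<Rightarrow> bool" where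
  "dense_ones q \<xi> \<longleftrightarrow> (\<forall>\<^sub>F r in sequentially. \<exists>s < r div q. \<xi> !! (r + 1 + 2 * s))"

lemma AE_dense_ones:
  assumes "0 < q" shows "AE \<xi> in uniform_boundary. dense_ones q \<xi>"
proof -
  define J where "J = (\<lambda>r. (\<lambda>s. r + 1 + 2 * s) ` {..<r div q})"
  have "card (J r) = r div q" for r by (simp add: J_def card_image inj_on_def)
  then have "AE \<xi> in uniform_boundary. \<forall>\<^sub>F r in sequentially. \<exists>i\<in>J r. \<xi> !! i \<noteq> False"
    using summable_half_power_div[OF assms] by (intro AE_eventually_not_const) (auto simp: J_def)
  then show ?thesis by eventually_elim (auto simp: dense_ones_def J_def elim: eventually_mono)
qed

lemma AE_zeros: "AE \<xi> in uniform_boundary. \<forall>\<^sub>F r in sequentially. \<exists>i\<ge>r. \<not> \<xi> !! i"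
proof -
  have "AE \<xi> in uniform_boundary. \<forall>\<^sub>F r in sequentially. \<exists>i\<in>{r..<r + r}. \<xi> !! i \<noteq> True"
    by (rule AE_eventually_not_const) (auto intro!: summable_geometric)
  then show ?thesis by eventually_elim (auto elim!: eventually_mono)
qed

lemma rich_if_dense_ones:
  assumes "dense_ones 1 \<xi>" shows "rich \<xi>"
  unfolding rich_def
proof (intro allI)
  fix r b
  obtain R where R: "\<And>r. r \<ge> R \<Longrightarrow> \<exists>s < r div 1. \<xi> !! (r + 1 + 2 * s)"
    using assms unfolding dense_ones_def eventually_sequentially by blast
  define r' where "r' = 2 * (r + R) + of_bool b"
  obtain s where "\<xi> !! (r' + 1 + 2 * s)" using R[of r'] by (auto simp: r'_def)
  then show "\<exists>i>r. \<xi> !! i \<and> even i = b" by (intro exI[of _ "r' + 1 + 2 * s"]) (auto simp: r'_def)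
qed

text \<open>Records at consecutive positions from some point on would make all later letters
  ones.\<close>

lemma gaps_if_zeros:
  assumes rich: "rich \<xi>" and zeros: "\<forall>\<^sub>F r in sequentially. \<exists>i\<ge>r. \<not> \<xi> !! i"
  shows "\<exists>j\<ge>J. spos \<xi> (Suc j) \<noteq> Suc (spos \<xi> j)"
proof (rule ccontr)
  assume "\<nexists>j. j \<ge> J \<and> spos \<xi> (Suc j) \<noteq> Suc (spos \<xi> j)"
  then have shift: "spos \<xi> (J + d) = spos \<xi> J + d" for d by (induction d) auto
  have one: "\<xi> !! i" if "i \<ge> spos \<xi> J" for i
  proof -
    have "spos \<xi> (J + (i - spos \<xi> J)) = i" unfolding shift using that by simp
    then show ?thesis using spos_is_one[OF rich, of "J + (i - spos \<xi> J)"] by (simp only:)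
  qed
  obtain R where "\<And>r. r \<ge> R \<Longrightarrow> \<exists>i\<ge>r. \<not> \<xi> !! i" using zeros unfolding eventually_sequentially by blast
  then obtain i where "i \<ge> max R (spos \<xi> J)" "\<not> \<xi> !! i" by (meson max.cobounded1)
  then show False using one by simp
qed

lemma growth_if_dense_ones:
  assumes rich: "rich \<xi>" and dense: "\<And>q. 0 < q \<Longrightarrow> dense_ones q \<xi>" and eps: "0 < (\<epsilon> :: real)"
  shows "\<exists>J. \<forall>j\<ge>J. real (Suc (spos \<xi> (Suc (Suc j)))) \<le> (1 + \<epsilon>) * real (Suc (spos \<xi> j))"
proof -
  \<comment> \<open>Two records are passed, and (1 + 2/q)^2 is at most 1 + 8/q since
    \<open>q\<close> is at least 1.\<close>
  obtain q0 :: nat where q0: "8 / \<epsilon> \<le> q0" using real_arch_simple by blast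
  define q where "q = Suc q0"
  have q: "0 < q" "8 / real q \<le> \<epsilon>" "1 \<le> real q"
  proof -
    have "8 / \<epsilon> \<le> real q" using q0 by (simp add: q_def)
    then show "8 / real q \<le> \<epsilon>" using eps by (simp add: q_def divide_simps mult.commute)
  qed (simp_all add: q_def)
  obtain R where R: "\<And>r. r \<ge> R \<Longrightarrow> \<exists>s < r div q. \<xi> !! (r + 1 + 2 * s)"
    using dense[OF q(1)] unfolding dense_ones_def eventually_sequentially by blast
  have step: "real (spos \<xi> (Suc j)) \<le> (1 + 2 / q) * real (spos \<xi> j)" if "j \<ge> R" for j
  proof -
    have "spos \<xi> j \<ge> R" using le_spos[OF rich, of j] that by simp
    then obtain s where s: "s < spos \<xi> j div q" "\<xi> !! (spos \<xi> j + 1 + 2 * s)" using R by blast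
    have "spos \<xi> (Suc j) \<le> spos \<xi> j + 1 + 2 * s"
      unfolding spos.simps by (rule Least_le) (use s in auto)
    also have "\<dots> \<le> spos \<xi> j + 2 * (spos \<xi> j div q)" using s(1) by simp
    finally have "real (spos \<xi> (Suc j)) \<le> real (spos \<xi> j) + 2 * real (spos \<xi> j div q)"
      by (metis of_nat_add of_nat_le_iff of_nat_mult of_nat_numeral)
    also have "\<dots> \<le> real (spos \<xi> j) + 2 * (real (spos \<xi> j) / real q)"
    proof -
      have "real (q * (spos \<xi> j div q)) \<le> real (spos \<xi> j)" unfolding of_nat_le_iff by simp
      then show ?thesis using q(1) by (simp add: field_simps)
    qed
    finally show ?thesis by (simp add: algebra_simps)
  qed
  show ?thesis
  proof (intro exI[of _ R] allI impI)
    fix j assume j: "j \<ge> R"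
    have "real (spos \<xi> (Suc (Suc j))) \<le> (1 + 2 / q) * real (spos \<xi> (Suc j))" using step[of "Suc j"] j by simp
    also have "\<dots> \<le> (1 + 2 / q) * ((1 + 2 / q) * real (spos \<xi> j))"
      using step[OF j] by (intro mult_left_mono) auto
    also have "\<dots> = (1 + 2 / q) * (1 + 2 / q) * real (spos \<xi> j)" by simp
    also have "\<dots> \<le> (1 + \<epsilon>) * real (spos \<xi> j)"
    proof (rule mult_right_mono)
      have "1 / real q * (1 / real q) \<le> 1 / real q * 1" using q by (intro mult_left_mono) auto
      then have "(1 + 2 / real q) * (1 + 2 / q) \<le> 1 + 8 / real q" by (simp add: algebra_simps)
      then show "(1 + 2 / real q) * (1 + 2 / q) \<le> 1 + \<epsilon>" using q(2) by linarith
    qed simp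
    finally show "real (Suc (spos \<xi> (Suc (Suc j)))) \<le> (1 + \<epsilon>) * real (Suc (spos \<xi> j))"
      using eps by (simp add: algebra_simps)
  qed
qed

lemma AE_regular:
  "AE \<xi> in uniform_boundary. rich \<xi> \<and> (\<forall>M. ((\<lambda>n. Mav_prob \<xi> n M) \<longlongrightarrow> qlim \<xi> M) (level_filter \<xi>)) \<and>
     critical_exponent (realizable_masses \<xi>) (qlim \<xi>) 1"
proof -
  \<comment> \<open>Only countably many \<open>q\<close> are required, because the growth estimate
    chooses \<open>q\<close> from \<open>\<epsilon>\<close>.\<close>
  have "AE \<xi> in uniform_boundary. \<forall>q. dense_ones (Suc q) \<xi>"
    by (subst AE_all_countable) (intro allI AE_dense_ones, simp)
  with AE_zeros show ?thesis
  proof eventually_elim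
    fix \<xi> assume zeros: "\<forall>\<^sub>F r in sequentially. \<exists>i\<ge>r. \<not> \<xi> !! i" and dense: "\<forall>q. dense_ones (Suc q) \<xi>"
    have rich: "rich \<xi>" using dense by (intro rich_if_dense_ones) (metis One_nat_def)
    have "dense_ones q \<xi>" if "0 < q" for q using dense that by (metis gr0_implies_Suc)
    then have "critical_exponent (realizable_masses \<xi>) (qlim \<xi>) 1"
      using critical[OF rich gaps_if_zeros[OF rich zeros] growth_if_dense_ones[OF rich]] by blast
    then show "rich \<xi> \<and> (\<forall>M. ((\<lambda>n. Mav_prob \<xi> n M) \<longlongrightarrow> qlim \<xi> M) (level_filter \<xi>)) \<and>
        critical_exponent (realizable_masses \<xi>) (qlim \<xi>) 1"
      using rich Mav_prob_tendsto[OF rich] by blast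
  qed
qed

text \<open>If the last letter of the prefix is a one, the prefix lies on the side of the central
  cycle; a second record inside the prefix keeps it off the central cycle itself. Both hold at
  arbitrarily large levels.\<close>

lemma infinite_good_levels:
  assumes rich: "rich \<xi>" shows "infinite (good_levels \<xi>)"
  unfolding infinite_nat_iff_unbounded
proof
  fix m
  obtain i where i: "i > m + spos \<xi> 1 + 2" "\<xi> !! i" using rich unfolding rich_def by blast
  define n where "n = Suc i"
  have lt1: "spos \<xi> 1 < n" using i(1) by (simp add: n_def)
  have lt0: "spos \<xi> 0 < n" using spos_Suc(1)[OF rich, of 0] lt1 by simp
  interpret rich_level n \<xi> by (rule rich_level[OF rich lt0])
  have "stake n \<xi> = stake i \<xi> @ [True]" unfolding n_def stake_Suc using i(2) by simp
  then have "lt (stake n \<xi>) = odd n" by (simp add: lt_snoc n_def)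
  moreover have "base (odd n) (stake n \<xi>) \<noteq> zeros n"
  proof
    assume zero: "base (odd n) (stake n \<xi>) = zeros n"
    have "odd n = par (stake n \<xi>)"
    proof (rule ccontr)
      assume "odd n \<noteq> par (stake n \<xi>)"
      then have "base (odd n) (stake n \<xi>) = stake n \<xi>" using base_nonzero_iff[OF nz_stake] by blast
      then have "nz (zeros n)" using zero nz_stake by metis
      then show False by simp
    qed
    then have "base (even (spos \<xi> 0)) (pre \<xi> (spos \<xi> 0) n) = zeros n"
      using zero par_pre[OF rich lt0] unfolding stake_eq by simp
    then have "pre \<xi> (spos \<xi> 1) n = zeros n" using level_base[OF rich, of 0 n] lt1 by simp
    then have "nz (zeros n)" using pre_nz[OF rich lt1] by metis
    then show False by simp
  qed
  ultimately have "n \<in> good_levels \<xi>" using nz_stake i(1) by (intro good_level) (simp_all add: n_def)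
  then show "\<exists>n>m. n \<in> good_levels \<xi>" using i(1) by (intro exI[of _ n]) (simp add: n_def)
qed

theorem theorem6p3p1:
  shows "AE \<xi> in uniform_boundary. \<xi> \<in> E1 \<longrightarrow>
    infinite (good_levels \<xi>) \<and>
    (\<exists>q :: nat \<Rightarrow> real.
       (\<forall>M. ((\<lambda>n. Mav_prob \<xi> n M) \<longlongrightarrow> q M) (level_filter \<xi>)) \<and>
       critical_exponent (realizable_masses \<xi>) q 1)"
  using AE_regular by eventually_elim (use infinite_good_levels in blast)

end
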